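(* Let $n\ge2$ and let $G$ be a tightly transitive and almost minimal subgroup of $\mathrm{Homeo}_+(\mathbb S^1)$ which is isomorphic to $\mathbb Z^n$. Then there exist an irrational $\alpha\in(0,1)$, an integer $k\ge1$, a $k$-admissible $g\in G_{\alpha,n}$ and $f\in\mathrm{Homeo}_+(\mathbb S^1)_{k,g}$ such that $G$ is topologically conjugate to $G_{\alpha,n,k,g,f}$.
   Context: $\mathbb S^1$ is the unit circle in $\mathbb C$. $\mathrm{Homeo}_+(X)$ denotes the group of orientation preserving homeomorphisms of $X$. Two subgroups $G,H$ of $\mathrm{Homeo}_+(\mathbb S^1)$ are topologically conjugate if $\phi G\phi^{-1}=H$ for some $\phi\in \mathrm{Homeo}_+(\mathbb S^1)$. A group $G$ of homeomorphisms of a space $X$ is topologically transitive if for any nonempty open $U,V\subseteq X$ there is $g\in G$ with $g(U)\cap V\ne\emptyset$. It is tightly transitive if it is topologically transitive and no subgroup $F\le G$ with $[G:F]=\infty$ is topologically transitive. A point $x$ is nontransitive if $Gx$ is not dense in $X$; $G$ is almost minimal if it has at most countably many nontransitive points. The groups $G_{\alpha,n}$. For $a\in\mathbb R$ let $L_a(x)=x+a$ on $\mathbb R$. Fix a homeomorphism $\hbar$ from $\mathbb R$ to $(0,1)$, for example $\hbar(x)=\frac1\pi(\frac\pi2+\arctan x)$. For $\sigma\in \mathrm{Homeo}_+(\mathbb R)$ define $\hbar(\sigma)\in\mathrm{Homeo}_+(\mathbb R)$ by $\hbar(\sigma)(x)=\hbar\sigma\hbar^{-1}(x-i)+i$ for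 $x\in(i,i+1)$, $i\in\mathbb Z$, and $\hbar(\sigma)(x)=x$ for $x\in\mathbb Z$. For irrational $\alpha\in(0,1)$ put $G_{\alpha,2}=\langle L_1,L_\alpha\rangle$ and, inductively, let $G_{\alpha,n+1}$ be the group generated by $\{\hbar(\sigma):\sigma\in G_{\alpha,n}\}\cup\{L_1\}$. It is known that $G_{\alpha,n}$ is isomorphic to $\mathbb Z^n$. The groups $G_{\alpha,n,k,g,f}$. Let $n\ge2$, $k\ge1$, $\alpha\in(0,1)$ irrational. Put $G_{\alpha,n}^s=\{g^s:g\in G_{\alpha,n}\}$ for integers $s\ge 1$. Call $g\in G_{\alpha,n}$ $k$-admissible if $g\notin\bigcup_{s\ge1,\ \gcd(k,s)\ne1}G_{\alpha,n}^s$. Put $x_j=e^{2\pi \mathrm i j/k}$ for $j=1,\dots,k$ and $x_{k+1}=x_1$; $(x_i,x_{i+1})$ is the open arc from $x_i$ to $x_{i+1}$ anticlockwise (for $k=1$, the circle minus $x_1$). Fix an orientation preserving homeomorphism $\phi:\mathbb R\to(x_1,x_2)$ and write $\tilde\sigma=\phi\sigma\phi^{-1}$ for $\sigma\in\mathrm{Homeo}_+(\mathbb R)$. For $k$-admissible $g$, $\mathrm{Homeo}_+(\mathbb S^1)_{k,g}$ is the set of $f\in\mathrm{Homeo}_+(\mathbb S^1)$ with $f(x_i)=x_{i+1}$ for $i=1,\dots,k$ and $f^k|_{(x_1,x_2)}=\tilde g$. For such $f$ and $\sigma\in\mathrm{Homeo}_+(\mathbb R)$, let $\overline\sigma^f\in\mathrm{Homeo}_+(\mathbb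 S^1)$ be given by $\overline\sigma^f(x)=f^{i-1}\tilde\sigma f^{-(i-1)}(x)$ for $x\in(x_i,x_{i+1})$, $i=1,\dots,k$, and $\overline\sigma^f(x_i)=x_i$. Then $G_{\alpha,n,k,g,f}$ is the subgroup of $\mathrm{Homeo}_+(\mathbb S^1)$ generated by $\{\overline\sigma^f:\sigma\in G_{\alpha,n}\}\cup\{f\}$. *)

theory Defs
  imports
    "HOL-Analysis.Analysis"
    "HOL-Algebra.Bij"
    "HOL-Algebra.Generated_Groups"
    "HOL-Algebra.Product_Groups"
begin

definition Homeo_plus_R :: "(real \<Rightarrow> real) monoid" where
  "Homeo_plus_R =
     BijGroup UNIV \<lparr>carrier := {f. (\<exists>g. homeomorphism UNIV UNIV f g) \<and> strict_mono f}\<rparr>"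

abbreviation S1 :: "complex set" where
  "S1 \<equiv> sphere 0 1"

text \<open>A homeomorphism of the circle preserves orientation iff it has an increasing lift
  through the covering map \<^term>\<open>cis\<close>. As in \<^const>\<open>BijGroup\<close>, elements are
  functions on \<^typ>\<open>complex\<close> that are \<^const>\<open>undefined\<close> off the circle.\<close>

definition Homeo_plus_S1 :: "(complex \<Rightarrow> complex) monoid" where
  "Homeo_plus_S1 =
     BijGroup S1 \<lparr>carrier :=
       {f \<in> extensional S1. (\<exists>g. homeomorphism S1 S1 f g) \<and>
          (\<exists>F::real \<Rightarrow> real. continuous_on UNIV F \<and> strict_mono F \<and>
             (\<forall>t. F (t + 2 * pi) = F t + 2 * pi) \<and> (\<forall>t. f (cis t) = cis (F t)))}\<rparr>"

definition topologically_conjugate ::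
    "(complex \<Rightarrow> complex) set \<Rightarrow> (complex \<Rightarrow> complex) set \<Rightarrow> bool" where
  "topologically_conjugate G H \<longleftrightarrow>
     (\<exists>\<phi>\<in>carrier Homeo_plus_S1.
        (\<lambda>\<sigma>. \<phi> \<otimes>\<^bsub>Homeo_plus_S1\<^esub> \<sigma> \<otimes>\<^bsub>Homeo_plus_S1\<^esub> inv\<^bsub>Homeo_plus_S1\<^esub> \<phi>) ` G = H)"

definition topologically_transitive :: "'a topology \<Rightarrow> ('a \<Rightarrow> 'a) set \<Rightarrow> bool" where
  "topologically_transitive X G \<longleftrightarrow>
     (\<forall>U V. openin X U \<and> openin X V \<and> U \<noteq> {} \<and> V \<noteq> {} \<longrightarrow> (\<exists>g\<in>G. g ` U \<inter> V \<noteq> {}))"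

definition tightly_transitive :: "'a topology \<Rightarrow> ('a \<Rightarrow> 'a) monoid \<Rightarrow> bool" where
  "tightly_transitive X G \<longleftrightarrow>
     topologically_transitive X (carrier G) \<and>
     (\<forall>F. subgroup F G \<and> infinite (rcosets\<^bsub>G\<^esub> F) \<longrightarrow> \<not> topologically_transitive X F)"

definition nontransitive_point :: "'a topology \<Rightarrow> ('a \<Rightarrow> 'a) set \<Rightarrow> 'a \<Rightarrow> bool" where
  "nontransitive_point X G x \<longleftrightarrow>
     x \<in> topspace X \<and> X closure_of ((\<lambda>g. g x) ` G) \<noteq> topspace X"

definition almost_minimal :: "'a topology \<Rightarrow> ('a \<Rightarrow> 'a) set \<Rightarrow> bool" where
  "almost_minimal X G \<longleftrightarrow> countable {x. nontransitive_point X G x}"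

definition transl :: "real \<Rightarrow> real \<Rightarrow> real" where
  "transl a x = x + a"

text \<open>The chosen homeomorphism \<open>h\<close> from the line onto the unit interval is a parameter
  throughout; \<open>hbar h \<sigma>\<close> is a copy of \<open>\<sigma>\<close> on each interval between consecutive integers.\<close>

definition hbar :: "(real \<Rightarrow> real) \<Rightarrow> (real \<Rightarrow> real) \<Rightarrow> real \<Rightarrow> real" where
  "hbar h \<sigma> x =
     (if x \<in> \<int> then x
      else h (\<sigma> (inv_into UNIV h (x - of_int \<lfloor>x\<rfloor>))) + of_int \<lfloor>x\<rfloor>)"

text \<open>The recursion starts at 2; the group is unspecified for smaller indices.\<close>

fun G_line :: "(real \<Rightarrow> real) \<Rightarrow> real \<Rightarrow> nat \<Rightarrow> (real \<Rightarrow> real) set" where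
  "G_line h \<alpha> (Suc (Suc 0)) = generate Homeo_plus_R {transl 1, transl \<alpha>}"
| "G_line h \<alpha> (Suc (Suc (Suc m))) =
     generate Homeo_plus_R (hbar h ` G_line h \<alpha> (Suc (Suc m)) \<union> {transl 1})"

definition admissible :: "(real \<Rightarrow> real) \<Rightarrow> real \<Rightarrow> nat \<Rightarrow> nat \<Rightarrow> (real \<Rightarrow> real) \<Rightarrow> bool" where
  "admissible h \<alpha> n k g \<longleftrightarrow>
     g \<in> G_line h \<alpha> n \<and>
     g \<notin> (\<Union>s\<in>{s. 1 \<le> s \<and> gcd k s \<noteq> 1}. {u [^]\<^bsub>Homeo_plus_R\<^esub> s | u. u \<in> G_line h \<alpha> n})"

definition cpt :: "nat \<Rightarrow> nat \<Rightarrow> complex" where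
  "cpt k j = cis (2 * pi * real j / real k)"

text \<open>For \<open>i\<close> from 1 to \<open>k\<close> these are the open anticlockwise arcs
  from \<^term>\<open>cpt k i\<close> to \<^term>\<open>cpt k (i + 1)\<close>; for \<open>k = 1\<close> it is the circle minus a point.\<close>

definition arc_between :: "nat \<Rightarrow> nat \<Rightarrow> complex set" where
  "arc_between k i = (\<lambda>t. cis (2 * pi * t / real k)) ` {real i <..< real (i + 1)}"

text \<open>Orientation preserving homeomorphisms from the line onto an arc, oriented anticlockwise.\<close>

definition oriented_parametrization :: "complex set \<Rightarrow> (real \<Rightarrow> complex) \<Rightarrow> bool" where
  "oriented_parametrization A \<phi> \<longleftrightarrow>
     (\<exists>\<psi>. homeomorphism UNIV A \<phi> \<psi>) \<and>
     (\<exists>\<theta>::real \<Rightarrow> real. continuous_on UNIV \<theta> \<and> strict_mono \<theta> \<and> (\<forall>t. \<phi> t = cis (\<theta> t)))"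

definition transport :: "(real \<Rightarrow> complex) \<Rightarrow> (real \<Rightarrow> real) \<Rightarrow> complex \<Rightarrow> complex" where
  "transport \<phi> \<sigma> z = \<phi> (\<sigma> (inv_into UNIV \<phi> z))"

text \<open>Below, \<open>\<phi>\<close> is always an oriented parametrization of \<^term>\<open>arc_between k 1\<close>.\<close>

definition Homeo_plus_S1_kg ::
    "(real \<Rightarrow> complex) \<Rightarrow> nat \<Rightarrow> (real \<Rightarrow> real) \<Rightarrow> (complex \<Rightarrow> complex) set" where
  "Homeo_plus_S1_kg \<phi> k g =
     {f \<in> carrier Homeo_plus_S1.
        (\<forall>i\<in>{1..k}. f (cpt k i) = cpt k (i + 1)) \<and>
        (\<forall>z\<in>arc_between k 1. (f [^]\<^bsub>Homeo_plus_S1\<^esub> k) z = transport \<phi> g z)}"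

definition overline ::
    "(real \<Rightarrow> complex) \<Rightarrow> nat \<Rightarrow> (complex \<Rightarrow> complex) \<Rightarrow> (real \<Rightarrow> real) \<Rightarrow> complex \<Rightarrow> complex" where
  "overline \<phi> k f \<sigma> =
     (\<lambda>z\<in>S1. if z \<in> cpt k ` {1..k} then z
        else let i = (THE i. i \<in> {1..k} \<and> z \<in> arc_between k i) in
          (f [^]\<^bsub>Homeo_plus_S1\<^esub> (int i - 1))
            (transport \<phi> \<sigma> ((f [^]\<^bsub>Homeo_plus_S1\<^esub> (- (int i - 1))) z)))"

text \<open>The group depends on \<open>g\<close> only through
  the requirement \<^prop>\<open>f \<in> Homeo_plus_S1_kg \<phi> k g\<close>.\<close>

definition G_circle ::
    "(real \<Rightarrow> real) \<Rightarrow> (real \<Rightarrow> complex) \<Rightarrow> real \<Rightarrow> nat \<Rightarrow> nat \<Rightarrow> (complex \<Rightarrow> complex)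
       \<Rightarrow> (complex \<Rightarrow> complex) set" where
  "G_circle h \<phi> \<alpha> n k f =
     generate Homeo_plus_S1 (overline \<phi> k f ` G_line h \<alpha> n \<union> {f})"

end

theory Submission
  imports Defs
begin

text \<open>
  All lifts of elements of \<open>G\<close> to the line, along the covering \<open>circ\<close>, form a group \<open>H\<close>. It is
  abelian (\<open>commuting_lifts\<close>), finitely generated, transitive and almost minimal, and it contains
  the deck transformation \<open>transl 1\<close>. These properties, collected in the predicate \<open>tame\<close>, have
  strong consequences (\<open>tame_structure\<close>). Since \<open>H\<close> has no global fixed point, one of its elements
  is free of fixed points, and there is a translation number homomorphism \<open>\<tau>\<close> from \<open>H\<close> to the real
  numbers. If the image of \<open>\<tau>\<close> is dense, \<open>\<tau>\<close> defines a monotone semiconjugacy to translations. If this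
  map were constant on an interval, the points where it is not locally constant would be countable
  in number, which is impossible for a map onto the line; so \<open>H\<close> is conjugate to a group of
  translations. If the image is cyclic, the kernel of \<open>\<tau>\<close> has a common fixed point, because finitely
  many commuting maps with fixed points have one. The orbit of this point is discrete, so \<open>H\<close> is
  conjugate to a group that contains \<open>transl 1\<close> and preserves the integers. Such a group is the
  direct product of the powers of \<open>transl 1\<close> and the stabilizer of \<open>0\<close>. The stabilizer acts in the same way on all unit intervals, so
  that it is given by the map \<open>hbar\<close> from a group on the line (\<open>descend\<close>, \<open>ascend\<close>), and this
  group is again tame.

  Iterating this on the line terminates because the rank drops in each step
  (\<open>coordinates_on_descend\<close>). At the end there is a dense group of translations, and tightness
  enters: two independent translations are already transitive, so the group is commensurable with a
  lattice of rank two, hence is one, and rescaling produces the translations by \<open>1\<close> and \<open>\<alpha>\<close>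
  (\<open>tight_translations_rank_two\<close>). Going back up, each step applies \<open>hbar\<close> and adds \<open>transl 1\<close>,
  which is the recursion for \<open>G_line\<close>. This is \<open>tame_classification\<close>.

  For the circle the first step is special, because the deck transformation must be followed through
  the conjugations. If \<open>H\<close> consisted of translations it would have rank two by tightness, but its
  rank is \<open>n + 1\<close> (\<open>rank_of_cyclic_extension\<close>). So \<open>H\<close> preserves the integers, the deck transformation
  becomes \<open>transl k \<circ> hbar \<gamma>\<close> with \<open>k \<ge> 1\<close>, and the fundamental domain from \<open>0\<close> to \<open>k\<close> consists of
  the \<open>k\<close> arcs. Conjugating this map to the deck transformation of the model circle, with the unit
  intervals placed on the model arcs, turns \<open>transl 1\<close> into the required \<open>f\<close> and gives
  \<open>f\<^sup>k = \<gamma>\<inverse>\<close> on the first arc (\<open>arc_model\<close>). So \<open>g\<close> is the inverse of \<open>\<gamma>\<close>. Admissibility holds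
  because \<open>G\<close> is torsion free (\<open>admissible_inverse\<close>).

  Tightness is inherited by the arc in a relative form only (\<open>tight_rel\<close>): it concerns subgroups
  that contain \<open>\<gamma>\<close>. This suffices, since at the last step \<open>\<gamma>\<close> induces a single translation,
  which is either trivial or can be chosen as one of the two.
\<close>

section \<open>Increasing homeomorphisms of the line\<close>

abbreviation finv :: "('a \<Rightarrow> 'b) \<Rightarrow> 'b \<Rightarrow> 'a" where
  "finv \<equiv> inv_into UNIV"

definition line_homeos :: "(real \<Rightarrow> real) set" where
  "line_homeos = {f. strict_mono f \<and> surj f}"

lemma line_homeosI:
  assumes "\<And>x y. x < y \<Longrightarrow> f x < f y" "\<And>y. \<exists>x. f x = y"
  shows "f \<in> line_homeos"
proof -
  have "surj f" using assms(2) by (metis surjI)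
  then show ?thesis using assms(1) by (auto simp: line_homeos_def strict_mono_def)
qed

lemma line_homeos_less [simp]: "f \<in> line_homeos \<Longrightarrow> f x < f y \<longleftrightarrow> x < y"
  by (auto simp: line_homeos_def strict_mono_less)

lemma line_homeos_le [simp]: "f \<in> line_homeos \<Longrightarrow> f x \<le> f y \<longleftrightarrow> x \<le> y"
  by (auto simp: line_homeos_def strict_mono_less_eq)

lemma line_homeos_eq [simp]: "f \<in> line_homeos \<Longrightarrow> f x = f y \<longleftrightarrow> x = y"
  by (auto simp: line_homeos_def strict_mono_eq)

lemma line_homeos_inj: "f \<in> line_homeos \<Longrightarrow> inj f"
  by (auto simp: inj_def)

lemma line_homeos_surj: "f \<in> line_homeos \<Longrightarrow> surj f"
  by (auto simp: line_homeos_def)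

lemma line_homeos_inv_left [simp]: "f \<in> line_homeos \<Longrightarrow> finv f (f x) = x"
  by (simp add: line_homeos_inj)

lemma line_homeos_inv_right [simp]: "f \<in> line_homeos \<Longrightarrow> f (finv f x) = x"
  by (simp add: line_homeos_surj surj_f_inv_f)

lemma line_homeos_id [simp]: "id \<in> line_homeos"
  by (auto intro: line_homeosI)

lemma line_homeos_comp [simp]: "f \<in> line_homeos \<Longrightarrow> g \<in> line_homeos \<Longrightarrow> f \<circ> g \<in> line_homeos"
  by (rule line_homeosI) (auto, metis line_homeos_inv_right)

lemma line_homeos_inv [simp]:
  assumes "f \<in> line_homeos"
  shows "finv f \<in> line_homeos"
proof (rule line_homeosI)
  show "finv f x < finv f y" if "x < y" for x y
    using that assms line_homeos_less[OF assms, of "finv f x" "finv f y"] by simp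
  show "\<exists>x. finv f x = y" for y
    using assms line_homeos_inv_left by blast
qed

lemma line_homeos_inv_less:
  assumes "f \<in> line_homeos"
  shows "finv f x < y \<longleftrightarrow> x < f y"
  using line_homeos_less[OF assms, of "finv f x" y] assms by simp

lemma line_homeos_less_inv:
  assumes "f \<in> line_homeos"
  shows "y < finv f x \<longleftrightarrow> f y < x"
  using line_homeos_less[OF assms, of y "finv f x"] assms by simp

lemma line_homeos_inv_inv [simp]: "f \<in> line_homeos \<Longrightarrow> finv (finv f) = f"
  by (simp add: line_homeos_inj line_homeos_surj bij_def inv_inv_eq)

lemma line_homeos_comp_inv [simp]:
  "f \<in> line_homeos \<Longrightarrow> f \<circ> finv f = id" "f \<in> line_homeos \<Longrightarrow> finv f \<circ> f = id"
  by (auto simp: fun_eq_iff)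

lemma line_homeos_inv_unique:
  "f \<in> line_homeos \<Longrightarrow> f \<circ> g = id \<Longrightarrow> finv f = g"
  by (auto simp: fun_eq_iff) (metis line_homeos_inv_left)

lemma line_homeos_inv_comp:
  "f \<in> line_homeos \<Longrightarrow> g \<in> line_homeos \<Longrightarrow> finv (f \<circ> g) = finv g \<circ> finv f"
  by (rule line_homeos_inv_unique) (auto simp: fun_eq_iff)

lemma line_homeos_continuous: "f \<in> line_homeos \<Longrightarrow> continuous_on UNIV f"
  by (rule continuous_onI_mono) (auto simp: line_homeos_surj)

lemma line_homeos_funpow [simp]: "f \<in> line_homeos \<Longrightarrow> f ^^ n \<in> line_homeos"
  by (induction n) auto

lemma transl_line_homeos [simp]: "transl a \<in> line_homeos"
  by (rule line_homeosI) (auto simp: transl_def, metis diff_add_cancel)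

lemma transl_comp: "transl a \<circ> transl b = transl (a + b)"
  by (auto simp: transl_def)

lemma transl_0 [simp]: "transl 0 = id"
  by (auto simp: transl_def)

lemma inv_transl [simp]: "finv (transl a) = transl (- a)"
  by (rule line_homeos_inv_unique) (auto simp: transl_comp)

lemma transl_eq_iff [simp]: "transl a = transl b \<longleftrightarrow> a = b"
  by (metis add_left_cancel transl_def)

lemma funpow_transl: "transl a ^^ n = transl (real n * a)"
  by (induction n) (auto simp: transl_def fun_eq_iff algebra_simps)

lemma carrier_Homeo_plus_R: "carrier Homeo_plus_R = line_homeos"
proof -
  have "homeomorphism UNIV UNIV f (finv f)" if "f \<in> line_homeos" for f
    using that by (auto simp: homeomorphism_def line_homeos_continuous line_homeos_surj)
  moreover have "f \<in> line_homeos" if "homeomorphism UNIV UNIV f g" "strict_mono f" for f g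
    using that by (auto simp: homeomorphism_def line_homeos_def)
  moreover have "strict_mono f" if "f \<in> line_homeos" for f
    using that by (auto simp: line_homeos_def)
  ultimately show ?thesis by (auto simp: Homeo_plus_R_def)
qed

lemma mult_Homeo_plus_R:
  "f \<in> line_homeos \<Longrightarrow> g \<in> line_homeos \<Longrightarrow> f \<otimes>\<^bsub>Homeo_plus_R\<^esub> g = f \<circ> g"
  by (auto simp: Homeo_plus_R_def BijGroup_def Bij_def bij_def line_homeos_inj line_homeos_surj
      compose_def extensional_def fun_eq_iff)

lemma one_Homeo_plus_R: "\<one>\<^bsub>Homeo_plus_R\<^esub> = id"
  by (auto simp: Homeo_plus_R_def BijGroup_def)

lemma group_Homeo_plus_R: "group Homeo_plus_R"
proof (rule groupI)
  fix f assume "f \<in> carrier Homeo_plus_R"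
  then show "\<exists>g\<in>carrier Homeo_plus_R. g \<otimes>\<^bsub>Homeo_plus_R\<^esub> f = \<one>\<^bsub>Homeo_plus_R\<^esub>"
    by (intro bexI[of _ "finv f"])
      (auto simp: carrier_Homeo_plus_R mult_Homeo_plus_R one_Homeo_plus_R)
qed (auto simp: carrier_Homeo_plus_R mult_Homeo_plus_R one_Homeo_plus_R comp_assoc)

lemma inv_Homeo_plus_R: "f \<in> line_homeos \<Longrightarrow> inv\<^bsub>Homeo_plus_R\<^esub> f = finv f"
  by (rule group.inv_equality[OF group_Homeo_plus_R])
    (auto simp: carrier_Homeo_plus_R mult_Homeo_plus_R one_Homeo_plus_R)

lemma nat_pow_Homeo_plus_R: "f \<in> line_homeos \<Longrightarrow> f [^]\<^bsub>Homeo_plus_R\<^esub> (n::nat) = f ^^ n"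
proof (induction n)
  case 0
  then show ?case by (simp add: one_Homeo_plus_R nat_pow_def)
next
  case (Suc n)
  then have "f [^]\<^bsub>Homeo_plus_R\<^esub> Suc n = f ^^ n \<circ> f"
    by (simp add: mult_Homeo_plus_R nat_pow_def)
  then show ?case by (simp only: funpow_Suc_right)
qed

definition conj_by :: "(real \<Rightarrow> real) \<Rightarrow> (real \<Rightarrow> real) \<Rightarrow> real \<Rightarrow> real" where
  "conj_by \<xi> f = \<xi> \<circ> f \<circ> finv \<xi>"

lemma conj_by_line_homeos [simp]:
  "\<xi> \<in> line_homeos \<Longrightarrow> f \<in> line_homeos \<Longrightarrow> conj_by \<xi> f \<in> line_homeos"
  by (simp add: conj_by_def)

lemma conj_by_apply [simp]: "\<xi> \<in> line_homeos \<Longrightarrow> conj_by \<xi> f (\<xi> x) = \<xi> (f x)"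
  by (simp add: conj_by_def)

lemma conj_by_id [simp]: "\<xi> \<in> line_homeos \<Longrightarrow> conj_by \<xi> id = id"
  by (simp add: conj_by_def)

lemma conj_by_comp:
  "\<xi> \<in> line_homeos \<Longrightarrow> conj_by \<xi> (f \<circ> g) = conj_by \<xi> f \<circ> conj_by \<xi> g"
  by (auto simp: conj_by_def fun_eq_iff)

lemma conj_by_inv:
  "\<xi> \<in> line_homeos \<Longrightarrow> f \<in> line_homeos \<Longrightarrow> conj_by \<xi> (finv f) = finv (conj_by \<xi> f)"
  by (rule sym, rule line_homeos_inv_unique) (simp_all add: conj_by_comp[symmetric])

lemma conj_by_conj_by:
  "\<xi> \<in> line_homeos \<Longrightarrow> \<psi> \<in> line_homeos \<Longrightarrow> conj_by \<xi> (conj_by \<psi> f) = conj_by (\<xi> \<circ> \<psi>) f"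
  by (simp add: conj_by_def line_homeos_inv_comp comp_assoc)

lemma conj_by_inv_left [simp]: "\<xi> \<in> line_homeos \<Longrightarrow> conj_by (finv \<xi>) (conj_by \<xi> f) = f"
  by (simp add: conj_by_def fun_eq_iff)

lemma conj_by_inv_right [simp]: "\<xi> \<in> line_homeos \<Longrightarrow> conj_by \<xi> (conj_by (finv \<xi>) f) = f"
  by (simp add: conj_by_def fun_eq_iff)

lemma conj_by_funpow: "\<xi> \<in> line_homeos \<Longrightarrow> conj_by \<xi> (f ^^ n) = conj_by \<xi> f ^^ n"
  by (induction n) (auto simp: conj_by_comp)

lemma conj_by_image_image:
  "\<xi> \<in> line_homeos \<Longrightarrow> \<psi> \<in> line_homeos \<Longrightarrow> conj_by \<xi> ` conj_by \<psi> ` H = conj_by (\<xi> \<circ> \<psi>) ` H"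
  by (auto simp: image_image conj_by_conj_by)

lemma conj_by_image_inv [simp]:
  "\<xi> \<in> line_homeos \<Longrightarrow> conj_by (finv \<xi>) ` conj_by \<xi> ` H = H"
  "\<xi> \<in> line_homeos \<Longrightarrow> conj_by \<xi> ` conj_by (finv \<xi>) ` H = H"
  by (auto simp: image_image)

section \<open>Groups of homeomorphisms of the line\<close>

definition line_group :: "(real \<Rightarrow> real) set \<Rightarrow> bool" where
  "line_group H \<longleftrightarrow> H \<subseteq> line_homeos \<and> id \<in> H \<and> (\<forall>f\<in>H. \<forall>g\<in>H. f \<circ> g \<in> H) \<and> (\<forall>f\<in>H. finv f \<in> H)"

definition commuting :: "(real \<Rightarrow> real) set \<Rightarrow> bool" where
  "commuting H \<longleftrightarrow> (\<forall>f\<in>H. \<forall>g\<in>H. f \<circ> g = g \<circ> f)"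

text \<open>Finite generation, in the form of the induction principle for which it is used.\<close>

definition fin_gen :: "(real \<Rightarrow> real) set \<Rightarrow> bool" where
  "fin_gen H \<longleftrightarrow> (\<exists>S. finite S \<and> S \<subseteq> H \<and> (\<forall>K. line_group K \<and> S \<subseteq> K \<longrightarrow> H \<subseteq> K))"

text \<open>Transitivity, and the points that almost minimality forces to be countable in number, both tested
  on bounded open intervals only.\<close>

definition interval_transitive :: "(real \<Rightarrow> real) set \<Rightarrow> bool" where
  "interval_transitive H \<longleftrightarrow>
     (\<forall>a b c d. a < b \<and> c < d \<longrightarrow> (\<exists>h\<in>H. \<exists>x. a < x \<and> x < b \<and> c < h x \<and> h x < d))"

definition avoiding_points :: "(real \<Rightarrow> real) set \<Rightarrow> real set" where
  "avoiding_points H = {x. \<exists>c d. c < d \<and> (\<forall>h\<in>H. \<not> (c < h x \<and> h x < d))}"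

definition tame :: "(real \<Rightarrow> real) set \<Rightarrow> bool" where
  "tame H \<longleftrightarrow> line_group H \<and> commuting H \<and> fin_gen H \<and> interval_transitive H \<and> countable (avoiding_points H)"

text \<open>The form of tightness that survives the passage from the circle to an arc. Here \<open>\<gamma>\<close> is the
  element that the deck transformation of the circle induces on the arc. Only subgroups containing
  \<open>\<gamma>\<close> can be tested: a transitive subgroup of infinite index on the arc that does not contain \<open>\<gamma>\<close>
  may generate, together with a map that permutes the arcs, a subgroup of finite index on the
  circle. Of finite index only the consequence is kept that every element has a power in the
  subgroup.\<close>

definition tight_rel :: "(real \<Rightarrow> real) set \<Rightarrow> (real \<Rightarrow> real) \<Rightarrow> bool" where
  "tight_rel H \<gamma> \<longleftrightarrow>
     (\<forall>K. line_group K \<and> K \<subseteq> H \<and> \<gamma> \<in> K \<and> interval_transitive K \<longrightarrow> (\<forall>h\<in>H. \<exists>m\<ge>1. h ^^ m \<in> K))"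

lemma line_groupD:
  assumes "line_group H"
  shows "f \<in> H \<Longrightarrow> f \<in> line_homeos" "id \<in> H" "f \<in> H \<Longrightarrow> g \<in> H \<Longrightarrow> f \<circ> g \<in> H" "f \<in> H \<Longrightarrow> finv f \<in> H"
  using assms by (auto simp: line_group_def)

lemma line_group_funpow: "line_group H \<Longrightarrow> f \<in> H \<Longrightarrow> f ^^ n \<in> H"
  by (induction n) (auto simp: line_group_def)

lemma tameD:
  assumes "tame H"
  shows "line_group H" "commuting H" "fin_gen H" "interval_transitive H" "countable (avoiding_points H)"
  using assms by (auto simp: tame_def)

lemma fin_genE:
  assumes "fin_gen H"
  obtains S where "finite S" "S \<subseteq> H" "\<And>K. line_group K \<Longrightarrow> S \<subseteq> K \<Longrightarrow> H \<subseteq> K"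
proof -
  from assms obtain S where "finite S \<and> S \<subseteq> H \<and> (\<forall>K. line_group K \<and> S \<subseteq> K \<longrightarrow> H \<subseteq> K)"
    unfolding fin_gen_def ..
  then show ?thesis using that[of S] by simp
qed

lemma commutingD: "commuting H \<Longrightarrow> f \<in> H \<Longrightarrow> g \<in> H \<Longrightarrow> f (g x) = g (f x)"
  unfolding commuting_def by (metis comp_apply)

lemma line_group_conj:
  assumes "\<xi> \<in> line_homeos" "line_group H"
  shows "line_group (conj_by \<xi> ` H)"
  unfolding line_group_def
proof (intro conjI ballI)
  show "conj_by \<xi> ` H \<subseteq> line_homeos" using assms by (auto simp: line_group_def)
  show "id \<in> conj_by \<xi> ` H" using assms line_groupD(2) by (metis conj_by_id image_eqI)
next
  fix f g assume "f \<in> conj_by \<xi> ` H" "g \<in> conj_by \<xi> ` H"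
  then show "f \<circ> g \<in> conj_by \<xi> ` H"
    using assms by (auto simp: line_group_def) (metis conj_by_comp image_eqI)
next
  fix f assume "f \<in> conj_by \<xi> ` H"
  then show "finv f \<in> conj_by \<xi> ` H"
    using assms by (auto simp: line_group_def subset_iff) (metis conj_by_inv image_eqI)
qed

lemma interval_transitive_conj:
  assumes \<xi>: "\<xi> \<in> line_homeos" and "interval_transitive H"
  shows "interval_transitive (conj_by \<xi> ` H)"
  unfolding interval_transitive_def
proof (intro allI impI)
  fix a b c d :: real assume "a < b \<and> c < d"
  then obtain h x where h: "h \<in> H" "finv \<xi> a < x" "x < finv \<xi> b" "finv \<xi> c < h x" "h x < finv \<xi> d"
    using assms(2) \<xi> unfolding interval_transitive_def by (metis line_homeos_inv line_homeos_less)
  then have "a < \<xi> x" "\<xi> x < b" "c < \<xi> (h x)" "\<xi> (h x) < d"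
    using line_homeos_inv_less[OF \<xi>] line_homeos_less_inv[OF \<xi>] by auto
  then show "\<exists>h\<in>conj_by \<xi> ` H. \<exists>x. a < x \<and> x < b \<and> c < h x \<and> h x < d"
    using imageI[OF h(1), of "conj_by \<xi>"] conj_by_apply[OF \<xi>, of h x]
    by (intro bexI[of _ "conj_by \<xi> h"] exI[of _ "\<xi> x"]) simp_all
qed

lemma avoiding_points_conj:
  assumes \<xi>: "\<xi> \<in> line_homeos"
  shows "avoiding_points (conj_by \<xi> ` H) \<subseteq> \<xi> ` avoiding_points H"
proof
  fix y assume "y \<in> avoiding_points (conj_by \<xi> ` H)"
  then obtain c d where cd: "c < d" "\<And>h. h \<in> H \<Longrightarrow> \<not> (c < conj_by \<xi> h y \<and> conj_by \<xi> h y < d)"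
    by (auto simp: avoiding_points_def)
  have "\<not> (finv \<xi> c < h (finv \<xi> y) \<and> h (finv \<xi> y) < finv \<xi> d)" if "h \<in> H" for h
    using cd(2)[OF that] \<xi> unfolding conj_by_def comp_def
    using line_homeos_inv_less[OF \<xi>] line_homeos_less_inv[OF \<xi>] by auto
  then have "finv \<xi> y \<in> avoiding_points H"
    using cd(1) \<xi> unfolding avoiding_points_def mem_Collect_eq
    by (intro exI[of _ "finv \<xi> c"] exI[of _ "finv \<xi> d"]) simp
  then show "y \<in> \<xi> ` avoiding_points H"
    using imageI[of "finv \<xi> y" "avoiding_points H" \<xi>] \<xi> by simp
qed

lemma fin_gen_conj:
  assumes \<xi>: "\<xi> \<in> line_homeos" and "fin_gen H"
  shows "fin_gen (conj_by \<xi> ` H)"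
proof -
  obtain S where S: "finite S" "S \<subseteq> H" "\<And>K. line_group K \<Longrightarrow> S \<subseteq> K \<Longrightarrow> H \<subseteq> K"
    using fin_genE[OF assms(2)] by metis
  have "conj_by \<xi> ` H \<subseteq> K" if K: "line_group K" "conj_by \<xi> ` S \<subseteq> K" for K
  proof -
    have "S \<subseteq> conj_by (finv \<xi>) ` K"
      using image_mono[OF K(2), of "conj_by (finv \<xi>)"] \<xi> by simp
    then have "H \<subseteq> conj_by (finv \<xi>) ` K"
      using S(3)[of "conj_by (finv \<xi>) ` K"] line_group_conj[OF _ K(1)] \<xi> by simp
    then show ?thesis using image_mono[of H "conj_by (finv \<xi>) ` K" "conj_by \<xi>"] \<xi> by simp
  qed
  then show ?thesis unfolding fin_gen_def using S(1,2)
    by (intro exI[of _ "conj_by \<xi> ` S"]) auto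
qed

lemma commuting_conj:
  "\<xi> \<in> line_homeos \<Longrightarrow> commuting H \<Longrightarrow> commuting (conj_by \<xi> ` H)"
  unfolding commuting_def by (intro ballI) (elim imageE, metis conj_by_comp)

lemma tame_conj:
  assumes "\<xi> \<in> line_homeos" "tame H"
  shows "tame (conj_by \<xi> ` H)"
proof -
  have "countable (avoiding_points (conj_by \<xi> ` H))"
    using avoiding_points_conj[OF assms(1)] assms(2)
    by (meson countable_image countable_subset tame_def)
  then show ?thesis
    using assms unfolding tame_def
    by (simp add: line_group_conj commuting_conj fin_gen_conj interval_transitive_conj)
qed

lemma tight_rel_conj:
  assumes \<xi>: "\<xi> \<in> line_homeos" and "tight_rel H \<gamma>"
  shows "tight_rel (conj_by \<xi> ` H) (conj_by \<xi> \<gamma>)"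
  unfolding tight_rel_def
proof (intro allI impI ballI)
  fix K h
  assume K: "line_group K \<and> K \<subseteq> conj_by \<xi> ` H \<and> conj_by \<xi> \<gamma> \<in> K \<and> interval_transitive K"
    and "h \<in> conj_by \<xi> ` H"
  then obtain h' where h': "h' \<in> H" "h = conj_by \<xi> h'" by auto
  let ?K = "conj_by (finv \<xi>) ` K"
  have "?K \<subseteq> H" using K image_mono[of K "conj_by \<xi> ` H" "conj_by (finv \<xi>)"] \<xi> by simp
  moreover have "\<gamma> \<in> ?K" using K \<xi> by (metis conj_by_inv_left image_eqI)
  ultimately obtain m where m: "m \<ge> 1" "h' ^^ m \<in> ?K"
    using assms(2) K \<xi> h'(1) line_group_conj[of "finv \<xi>" K] interval_transitive_conj[of "finv \<xi>" K]
    unfolding tight_rel_def by (metis line_homeos_inv)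
  then have "conj_by \<xi> (h' ^^ m) \<in> K" using \<xi> by auto
  then show "\<exists>m\<ge>1. h ^^ m \<in> K" using m(1) h'(2) \<xi> by (auto simp: conj_by_funpow)
qed

section \<open>Fixed points and fixed point free homeomorphisms\<close>

text \<open>A bounded upward orbit would have a supremum, and the supremum would be fixed.\<close>

lemma orbit_unbounded:
  assumes t: "t \<in> line_homeos" "\<And>x. x < t x"
  shows "\<exists>n. y < (t ^^ n) x"
proof (rule ccontr)
  assume "\<nexists>n. y < (t ^^ n) x"
  then have bdd: "bdd_above (range (\<lambda>n. (t ^^ n) x))" by (auto simp: not_less intro: bdd_aboveI)
  define L where "L = (SUP n. (t ^^ n) x)"
  have "finv t L < L" using t(2)[of "finv t L"] t(1) by simp
  then obtain n where "finv t L < (t ^^ n) x"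
    unfolding L_def using less_cSUP_iff[OF _ bdd] by blast
  then have "L < (t ^^ Suc n) x" using t(1) by (simp add: line_homeos_inv_less)
  moreover have "(t ^^ Suc n) x \<le> L" unfolding L_def by (rule cSUP_upper[OF _ bdd]) simp
  ultimately show False by simp
qed

text \<open>The powers of \<open>t\<close> carry the fundamental domain \<open>[x\<^sub>0, t x\<^sub>0)\<close> onto intervals that tile the line,
  so an affine map on this domain extends uniquely to a conjugacy. In the proof the inverse \<open>\<theta>\<close> of the
  conjugacy is constructed, because it has an explicit formula.\<close>

lemma conjugate_to_translation:
  assumes t: "t \<in> line_homeos" "\<And>x. x < t x"
  obtains \<psi> where "\<psi> \<in> line_homeos" "\<And>x. \<psi> (t x) = \<psi> x + 1"
    "\<And>x. x0 \<le> x \<Longrightarrow> x \<le> t x0 \<Longrightarrow> \<psi> x = (x - x0) / (t x0 - x0)"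
proof -
  interpret R: group Homeo_plus_R by (rule group_Homeo_plus_R)
  define p where "p n = t [^]\<^bsub>Homeo_plus_R\<^esub> n" for n :: int
  have p_in [simp]: "p n \<in> line_homeos" for n
    using R.int_pow_closed[of t n] t(1) by (simp add: p_def carrier_Homeo_plus_R)
  have p_add: "p (m + n) = p m \<circ> p n" for m n
    using R.int_pow_mult[of t m n] t(1) p_in
    by (simp add: p_def carrier_Homeo_plus_R mult_Homeo_plus_R)
  have p_0 [simp]: "p 0 = id" by (simp add: p_def one_Homeo_plus_R)
  have p_1: "p 1 = t" using R.int_pow_1[of t] t(1) by (simp add: p_def carrier_Homeo_plus_R)
  have p_nat: "p (int n) = t ^^ n" for n
    using t(1) by (simp add: p_def int_pow_int nat_pow_Homeo_plus_R)
  have p_suc: "p (n + 1) x = t (p n x)" "p (n + 1) x = p n (t x)" for n x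
    using fun_cong[OF p_add[of 1 n], of x] fun_cong[OF p_add[of n 1], of x]
    by (simp_all add: p_1 add.commute)
  define l where "l = t x0 - x0"
  have l: "l > 0" using t(2)[of x0] by (simp add: l_def)
  define \<theta> where "\<theta> y = p \<lfloor>y\<rfloor> (x0 + frac y * l)" for y
  have mono_n: "p m x0 \<le> p n x0" if "m \<le> n" for m n
    using that
  proof (induction n rule: int_ge_induct)
    case (step i)
    then show ?case using t(2)[of "p i x0"] by (simp add: p_suc(1))
  qed simp
  have lo: "p \<lfloor>y\<rfloor> x0 \<le> \<theta> y" for y
    using l by (simp add: \<theta>_def frac_ge_0)
  have hi: "\<theta> y < p (\<lfloor>y\<rfloor> + 1) x0" for y
  proof -
    have "x0 + frac y * l < t x0" using l frac_lt_1[of y] mult_strict_right_mono[of "frac y" 1 l] l_def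
      by linarith
    then show ?thesis by (simp add: \<theta>_def p_suc(2))
  qed
  have less: "\<theta> y < \<theta> z" if "y < z" for y z
  proof (cases "\<lfloor>y\<rfloor> = \<lfloor>z\<rfloor>")
    case True
    then have "frac y < frac z" using that by (simp add: frac_def)
    then show ?thesis using l True by (simp add: \<theta>_def)
  next
    case False
    then have "\<lfloor>y\<rfloor> + 1 \<le> \<lfloor>z\<rfloor>" using that floor_mono[of y z] by linarith
    then show ?thesis using hi[of y] lo[of z] mono_n by (meson less_le_trans order.trans)
  qed
  have onto: "\<exists>y. \<theta> y = x" for x
  proof -
    obtain a where a: "x < p (int a) x0" using orbit_unbounded[OF t] p_nat by metis
    obtain b where "x0 < (t ^^ b) x" using orbit_unbounded[OF t] by metis
    moreover have "p (- int b) (p (int b) x) = x" by (metis add.left_inverse comp_apply id_apply p_0 p_add)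
    ultimately have b: "p (- int b) x0 < x" by (metis line_homeos_less p_in p_nat)
    have bound: "m < int a" if "p m x0 \<le> x" for m
      using a that mono_n[of "int a" m] by linarith
    define n where "n = (GREATEST m. p m x0 \<le> x)"
    have n: "p n x0 \<le> x" "\<And>m. p m x0 \<le> x \<Longrightarrow> m \<le> n"
    proof -
      have ex: "\<exists>n. p n x0 \<le> x \<and> (\<forall>m. p m x0 \<le> x \<longrightarrow> m \<le> n)"
      proof -
        let ?A = "{m. - int b \<le> m \<and> p m x0 \<le> x}"
        have "finite ?A" by (rule finite_subset[of _ "{- int b..int a}"]) (use bound in force)+
        moreover have "- int b \<in> ?A" using b by auto
        ultimately have "Max ?A \<in> ?A" "\<And>m. m \<in> ?A \<Longrightarrow> m \<le> Max ?A"
          using Max_in[of ?A] Max_ge[of ?A] by blast+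
        then show ?thesis by (intro exI[of _ "Max ?A"]) (auto, meson linear order.trans)
      qed
      then obtain n' where n': "p n' x0 \<le> x" "\<And>m. p m x0 \<le> x \<Longrightarrow> m \<le> n'" by blast
      then have "n = n'" unfolding n_def by (intro Greatest_equality) auto
      then show "p n x0 \<le> x" "\<And>m. p m x0 \<le> x \<Longrightarrow> m \<le> n" using n' by auto
    qed
    have n1: "x < p (n + 1) x0" using n(2)[of "n + 1"] by force
    define w where "w = finv (p n) x"
    have w: "p n w = x" by (simp add: w_def)
    have "p n x0 \<le> p n w" "p n w < p n (t x0)" using n(1) n1 by (simp_all add: w p_suc(2))
    then have w2: "x0 \<le> w" "w < t x0" by simp_all
    define u where "u = (w - x0) / l"
    have u: "0 \<le> u" "u < 1" using w2 l by (auto simp: u_def l_def field_simps)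
    have "\<lfloor>of_int n + u\<rfloor> = n" "frac (of_int n + u) = u"
      using u by (auto simp: frac_def floor_eq_iff)
    then have "\<theta> (of_int n + u) = x" using l by (simp add: \<theta>_def u_def w)
    then show ?thesis ..
  qed
  have \<theta>: "\<theta> \<in> line_homeos" by (rule line_homeosI) (use less onto in auto)
  have \<theta>1: "\<theta> (y + 1) = t (\<theta> y)" for y
    by (simp add: \<theta>_def p_suc(1) frac_def)
  show ?thesis
  proof (rule that)
    show "finv \<theta> \<in> line_homeos" using \<theta> by simp
    show eq: "finv \<theta> (t x) = finv \<theta> x + 1" for x
      using \<theta>1[of "finv \<theta> x"] \<theta> by (metis line_homeos_inv_left line_homeos_inv_right)
    fix x assume x: "x0 \<le> x" "x \<le> t x0"
    define y where "y = (x - x0) / l"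
    have "\<theta> y = x"
    proof (cases "x = t x0")
      case True
      then have "y = 1" using l by (simp add: y_def l_def)
      then show ?thesis using True by (simp add: \<theta>_def p_1 frac_def)
    next
      case False
      then have y: "0 \<le> y" "y < 1" using x l by (auto simp: y_def l_def field_simps)
      then have "\<lfloor>y\<rfloor> = 0" "frac y = y" by (auto simp: frac_def floor_eq_iff)
      then show ?thesis using l by (simp add: \<theta>_def y_def)
    qed
    then show "finv \<theta> x = (x - x0) / (t x0 - x0)"
      using \<theta> by (metis l_def line_homeos_inv_left y_def)
  qed
qed

lemma fixes_SUP:
  assumes f: "f \<in> line_homeos" and "\<And>y. y \<in> Y \<Longrightarrow> f y = y" "Y \<noteq> {}" "bdd_above Y"
  shows "f (Sup Y) = Sup Y"
proof (rule antisym)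
  have *: "Sup Y \<le> g (Sup Y)" if g: "g \<in> line_homeos" "\<And>y. y \<in> Y \<Longrightarrow> g y = y" for g
    by (rule cSup_least[OF assms(3)]) (metis assms(4) cSup_upper g line_homeos_le)
  show "Sup Y \<le> f (Sup Y)" using * assms(1,2) by blast
  have "finv f y = y" if "y \<in> Y" for y using assms(2)[OF that] f by (metis line_homeos_inv_left)
  then have "Sup Y \<le> finv f (Sup Y)" using *[of "finv f"] f by simp
  then have "f (Sup Y) \<le> f (finv f (Sup Y))" using *[of "finv f"] f line_homeos_le[OF f] by blast
  then show "f (Sup Y) \<le> Sup Y" using f by simp
qed

lemma fixes_INF:
  assumes f: "f \<in> line_homeos" and "\<And>y. y \<in> Y \<Longrightarrow> f y = y" "Y \<noteq> {}" "bdd_below Y"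
  shows "f (Inf Y) = Inf Y"
proof (rule antisym)
  have *: "g (Inf Y) \<le> Inf Y" if g: "g \<in> line_homeos" "\<And>y. y \<in> Y \<Longrightarrow> g y = y" for g
    by (rule cInf_greatest[OF assms(3)]) (metis assms(4) cInf_lower g line_homeos_le)
  show "f (Inf Y) \<le> Inf Y" using * assms(1,2) by blast
  have "finv f y = y" if "y \<in> Y" for y using assms(2)[OF that] f by (metis line_homeos_inv_left)
  then have "finv f (Inf Y) \<le> Inf Y" using *[of "finv f"] f by simp
  then have "f (finv f (Inf Y)) \<le> f (Inf Y)" using *[of "finv f"] f line_homeos_le[OF f] by blast
  then show "Inf Y \<le> f (Inf Y)" using f by simp
qed

lemma orbit_SUP_fixed:
  assumes g: "g \<in> line_homeos" "bdd_above (range (\<lambda>n. (g ^^ n) x))" "x \<le> g x"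
  shows "g (SUP n. (g ^^ n) x) = (SUP n. (g ^^ n) x)" (is "g ?L = ?L")
proof (rule antisym)
  show "?L \<le> g ?L"
  proof (rule cSUP_least)
    fix n
    have up: "(g ^^ n) x \<le> ?L" by (rule cSUP_upper[OF _ g(2)]) simp
    have "(g ^^ n) x \<le> (g ^^ n) (g x)" using g(1,3) line_homeos_funpow line_homeos_le by blast
    also have "\<dots> = g ((g ^^ n) x)" by (simp add: funpow_swap1)
    also have "\<dots> \<le> g ?L" using up g(1) by simp
    finally show "(g ^^ n) x \<le> g ?L" .
  qed simp
  have "?L \<le> finv g ?L"
  proof (rule cSUP_least)
    fix n
    have "g ((g ^^ n) x) \<le> ?L" using cSUP_upper[OF _ g(2), of "Suc n"] by simp
    then show "(g ^^ n) x \<le> finv g ?L" using line_homeos_less_inv[OF g(1)]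
      by (metis g(1) line_homeos_inv_less linorder_not_less)
  qed simp
  then have "g ?L \<le> g (finv g ?L)" using g(1) line_homeos_le by blast
  then show "g ?L \<le> ?L" using g(1) by simp
qed

lemma orbit_INF_fixed:
  assumes g: "g \<in> line_homeos" "bdd_below (range (\<lambda>n. (g ^^ n) x))" "g x \<le> x"
  shows "g (INF n. (g ^^ n) x) = (INF n. (g ^^ n) x)" (is "g ?L = ?L")
proof (rule antisym)
  show "g ?L \<le> ?L"
  proof (rule cINF_greatest)
    fix n
    have lo: "?L \<le> (g ^^ n) x" by (rule cINF_lower[OF g(2)]) simp
    have "g ?L \<le> g ((g ^^ n) x)" using lo g(1) by simp
    also have "\<dots> = (g ^^ n) (g x)" by (simp add: funpow_swap1)
    also have "\<dots> \<le> (g ^^ n) x" using g(1,3) line_homeos_funpow line_homeos_le by blast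
    finally show "g ?L \<le> (g ^^ n) x" .
  qed simp
  have "finv g ?L \<le> ?L"
  proof (rule cINF_greatest)
    fix n
    have "?L \<le> g ((g ^^ n) x)" using cINF_lower[OF g(2), of "Suc n"] by simp
    then show "finv g ?L \<le> (g ^^ n) x" using line_homeos_less_inv[OF g(1)]
      by (metis g(1) linorder_not_less)
  qed simp
  then have "g (finv g ?L) \<le> g ?L" using g(1) line_homeos_le by blast
  then show "?L \<le> g ?L" using g(1) by simp
qed

text \<open>The common fixed point \<open>x\<close> of \<open>S\<close> is pushed by \<open>g\<close>, or by its inverse, towards the fixed point \<open>p\<close>
  of \<open>g\<close>, which bounds the orbit. All points of the orbit are fixed by \<open>S\<close> because of commutation,
  and so is the limit, which is fixed by \<open>g\<close> as well.\<close>

lemma common_fixed_point_step: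
  assumes S: "S \<subseteq> line_homeos" "\<And>f. f \<in> S \<Longrightarrow> f x = x"
    and g: "g \<in> line_homeos" "\<And>f y. f \<in> S \<Longrightarrow> f (g y) = g (f y)" "g p = p"
  shows "\<exists>y. g y = y \<and> (\<forall>f\<in>S. f y = y)"
proof -
  have fin: "\<exists>y. k y = y \<and> (\<forall>f\<in>S. f y = y)"
    if k: "k \<in> line_homeos" "\<And>f y. f \<in> S \<Longrightarrow> f (k y) = k (f y)" "k p = p"
      "x \<le> p \<and> x \<le> k x \<or> p \<le> x \<and> k x \<le> x" for k
  proof -
    have fixp: "(k ^^ n) p = p" for n using k(3) by (induction n) auto
    have orbit_fixed: "f ((k ^^ n) x) = (k ^^ n) x" if "f \<in> S" for f n
      using that S(2) k(2) by (induction n) (simp, metis comp_apply funpow.simps(2))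
    show ?thesis using k(4)
    proof
      assume x: "x \<le> p \<and> x \<le> k x"
      then have "(k ^^ n) x \<le> p" for n by (metis fixp k(1) line_homeos_funpow line_homeos_le)
      then have bdd: "bdd_above (range (\<lambda>n. (k ^^ n) x))" by (intro bdd_aboveI[of _ p]) auto
      show ?thesis
        using orbit_SUP_fixed[OF k(1) bdd] x fixes_SUP[OF _ _ _ bdd] orbit_fixed S(1) by blast
    next
      assume x: "p \<le> x \<and> k x \<le> x"
      then have "p \<le> (k ^^ n) x" for n by (metis fixp k(1) line_homeos_funpow line_homeos_le)
      then have bdd: "bdd_below (range (\<lambda>n. (k ^^ n) x))" by (intro bdd_belowI[of _ p]) auto
      show ?thesis
        using orbit_INF_fixed[OF k(1) bdd] x fixes_INF[OF _ _ _ bdd] orbit_fixed S(1) by blast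
    qed
  qed
  have inv: "f (finv g y) = finv g (f y)" if "f \<in> S" for f y
    using g(1) g(2)[OF that, of "finv g y"] by (metis line_homeos_inv_left line_homeos_inv_right)
  have invp: "finv g p = p" using g(1,3) by (metis line_homeos_inv_left)
  show ?thesis
  proof (cases "x \<le> p \<and> x \<le> g x \<or> p \<le> x \<and> g x \<le> x")
    case True
    then show ?thesis using fin[OF g] by blast
  next
    case False
    then have "x \<le> p \<and> x \<le> finv g x \<or> p \<le> x \<and> finv g x \<le> x"
      using line_homeos_inv_less[OF g(1)] line_homeos_less_inv[OF g(1)]
      by (metis linorder_le_cases linorder_not_le)
    then obtain y where "finv g y = y" "\<forall>f\<in>S. f y = y"
      using fin[OF line_homeos_inv[OF g(1)] inv invp] by blast
    then show ?thesis using g(1) by (metis line_homeos_inv_right)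
  qed
qed

lemma common_fixed_point:
  assumes "finite S" "S \<subseteq> line_homeos" "commuting S" "\<And>f. f \<in> S \<Longrightarrow> \<exists>x. f x = x"
  shows "\<exists>x. \<forall>f\<in>S. f x = x"
  using assms
proof (induction S rule: finite_induct)
  case (insert g S)
  have c: "commuting S" using insert.prems(2) by (auto simp: commuting_def)
  obtain x where x: "\<forall>f\<in>S. f x = x" using insert.IH insert.prems(1,3) c by blast
  obtain p where p: "g p = p" using insert.prems(3) by blast
  have "\<exists>y. g y = y \<and> (\<forall>f\<in>S. f y = y)"
    using common_fixed_point_step[of S x g p] x p insert.prems(1) commutingD[OF insert.prems(2)]
    by blast
  then show ?case by auto
qed simp

lemma fixed_point_or_moved:
  assumes t: "t \<in> line_homeos"
  shows "(\<exists>x. t x = x) \<or> (\<forall>x. x < t x) \<or> (\<forall>x. t x < x)"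
proof (rule ccontr)
  assume no: "\<not> ?thesis"
  then obtain a b where ab: "t a - a \<le> 0" "0 \<le> t b - b"
    by (metis diff_ge_0_iff_ge diff_le_0_iff_le not_less)
  have c: "continuous_on A (\<lambda>x. t x - x)" for A
    using continuous_on_subset[OF line_homeos_continuous[OF t], of A] by (auto intro!: continuous_intros)
  have "\<exists>x. t x - x = 0"
    using IVT'[of "\<lambda>x. t x - x" a 0 b] IVT2'[of "\<lambda>x. t x - x" a 0 b] ab c
    by (metis linear)
  then show False using no by auto
qed

lemma line_group_stabilizer: "line_group {f \<in> line_homeos. f x = x}"
  unfolding line_group_def by (auto, metis line_homeos_inv_left)

text \<open>If every element had a fixed point, the finitely many generators, and with them the whole group,
  would have a common one, and no element could carry an interval across it.\<close>

lemma tame_fixed_point_free: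
  assumes "tame H"
  obtains t where "t \<in> H" "\<And>x. x < t x"
proof -
  note H = tameD[OF assms]
  obtain S where S: "finite S" "S \<subseteq> H" "\<And>K. line_group K \<Longrightarrow> S \<subseteq> K \<Longrightarrow> H \<subseteq> K"
    using fin_genE[OF H(3)] by metis
  have "\<exists>t\<in>H. \<forall>x. t x \<noteq> x"
  proof (rule ccontr)
    assume "\<not> (\<exists>t\<in>H. \<forall>x. t x \<noteq> x)"
    then have "\<And>f. f \<in> S \<Longrightarrow> \<exists>x. f x = x" using S(2) by blast
    moreover have "S \<subseteq> line_homeos" using S(2) H(1) by (auto simp: line_group_def)
    moreover have "commuting S" using S(2) H(2) by (auto simp: commuting_def)
    ultimately obtain x where x: "\<forall>f\<in>S. f x = x" using common_fixed_point S(1) by blast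
    then have orbit_fixed: "h x = x" if "h \<in> H" for h
      using S(3)[OF line_group_stabilizer[of x]] \<open>S \<subseteq> line_homeos\<close> that by blast
    obtain h y where h: "h \<in> H" "x - 1 < y" "y < x" "x < h y" "h y < x + 1"
      using H(4)[unfolded interval_transitive_def, rule_format, of "x - 1" x x "x + 1"] by auto
    have "h y < h x" using h(1,3) line_groupD(1)[OF H(1)] by simp
    then show False using orbit_fixed[OF h(1)] h(4) by simp
  qed
  then obtain t where t: "t \<in> H" "\<And>x. t x \<noteq> x" by blast
  have tl: "t \<in> line_homeos" using t(1) H(1) line_groupD(1) by blast
  have "(\<forall>x. x < t x) \<or> (\<forall>x. t x < x)" using fixed_point_or_moved[OF tl] t(2) by blast
  then show ?thesis
  proof
    assume "\<forall>x. x < t x" then show ?thesis using that t(1) by blast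
  next
    assume "\<forall>x. t x < x"
    then have "\<And>x. x < finv t x" using line_homeos_less_inv[OF tl] by blast
    then show ?thesis using that line_groupD(4)[OF H(1) t(1)] by blast
  qed
qed

section \<open>Translation numbers\<close>

definition periodic_homeos :: "(real \<Rightarrow> real) set" where
  "periodic_homeos = {f \<in> line_homeos. \<forall>x. f (x + 1) = f x + 1}"

lemma periodic_homeosD: "f \<in> periodic_homeos \<Longrightarrow> f \<in> line_homeos"
  by (simp add: periodic_homeos_def)

lemma periodic_homeos_int:
  assumes "f \<in> periodic_homeos"
  shows "f (x + of_int n) = f x + of_int n"
proof (induction n rule: int_induct[where k = 0])
  case (step1 i)
  have "f (x + of_int (i + 1)) = f ((x + of_int i) + 1)" by (simp add: algebra_simps)
  then show ?case using step1 assms by (simp add: periodic_homeos_def)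
next
  case (step2 i)
  have "f ((x + of_int (i - 1)) + 1) = f (x + of_int (i - 1)) + 1"
    using assms unfolding periodic_homeos_def by blast
  then show ?case using step2 by (simp add: algebra_simps)
qed simp

lemma line_group_periodic_homeos: "line_group periodic_homeos"
  unfolding line_group_def
proof (intro conjI ballI)
  fix f assume f: "f \<in> periodic_homeos"
  have "finv f (x + 1) = finv f x + 1" for x
    using f by (auto simp: periodic_homeos_def) (metis line_homeos_inv_left line_homeos_inv_right)
  then show "finv f \<in> periodic_homeos" using f by (simp add: periodic_homeos_def)
qed (auto simp: periodic_homeos_def)

lemma transl_periodic [simp]: "transl a \<in> periodic_homeos"
  by (auto simp: periodic_homeos_def transl_def)

lemma periodic_homeos_displacement:
  assumes "f \<in> periodic_homeos"
  shows "\<bar>f x - f 0 - x\<bar> \<le> 1"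
proof -
  have "f (0 + of_int \<lfloor>x\<rfloor>) \<le> f x" "f x \<le> f (0 + of_int (\<lfloor>x\<rfloor> + 1))"
    using periodic_homeosD[OF assms] by (simp_all add: line_homeos_le)
  then show ?thesis using assms by (simp only: periodic_homeos_int) linarith
qed

text \<open>The sequence of displacements of \<open>0\<close> is additive up to \<open>1\<close>, hence stays within distance \<open>1\<close> of
  a unique linear sequence.\<close>

lemma translation_number_exists:
  assumes f: "f \<in> periodic_homeos"
  shows "\<exists>\<tau>. \<forall>n. \<bar>(f ^^ n) 0 - real n * \<tau>\<bar> \<le> 1"
proof -
  define a where "a n = (f ^^ n) 0" for n
  have add: "\<bar>a (m + n) - a m - a n\<bar> \<le> 1" for m n
    using periodic_homeos_displacement[OF line_group_funpow[OF line_group_periodic_homeos f], of m "a n"]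
    by (simp add: a_def funpow_add)
  have mult: "\<bar>a (Suc k * m) - real (Suc k) * a m\<bar> \<le> real k" for k m
  proof (induction k)
    case (Suc k)
    have "a (Suc (Suc k) * m) = a (m + Suc k * m)" by simp
    then show ?case using Suc add[of m "Suc k * m"] by (simp add: algebra_simps del: mult_Suc)
  qed simp
  have cross: "(a m - 1) / real m \<le> (a n + 1) / real n" if mn: "m > 0" "n > 0" for m n
  proof -
    obtain i j where ij: "m = Suc i" "n = Suc j" using mn gr0_implies_Suc by metis
    have "real n * a m - real n \<le> a (n * m)" using mult[of j m] ij by (simp add: abs_le_iff algebra_simps del: mult_Suc)
    moreover have "a (m * n) \<le> real m * a n + real m" using mult[of i n] ij by (simp add: abs_le_iff algebra_simps del: mult_Suc)
    ultimately have "real n * (a m - 1) \<le> real m * (a n + 1)" by (simp add: algebra_simps)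
    then show ?thesis using mn by (simp add: field_simps)
  qed
  define \<tau> where "\<tau> = (SUP m\<in>{0<..}. (a m - 1) / real m)"
  have bdd: "bdd_above ((\<lambda>m. (a m - 1) / real m) ` {0<..})"
    using cross[of _ 1] by (auto intro!: bdd_aboveI[of _ "(a 1 + 1) / real 1"])
  have "\<bar>a n - real n * \<tau>\<bar> \<le> 1" for n
  proof (cases "n = 0")
    case True then show ?thesis by (simp add: a_def)
  next
    case False
    then have n: "n > 0" by simp
    have "(a n - 1) / real n \<le> \<tau>" unfolding \<tau>_def by (rule cSUP_upper[OF _ bdd]) (use n in simp)
    moreover have "\<tau> \<le> (a n + 1) / real n" unfolding \<tau>_def
      by (rule cSUP_least) (use n cross in auto)
    ultimately show ?thesis using n by (auto simp: field_simps abs_le_iff)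
  qed
  then show ?thesis by (auto simp: a_def)
qed

lemma bounded_multiples_imp_0:
  fixes x :: real
  assumes "\<And>n. real n * x \<le> c"
  shows "x \<le> 0"
  using assms reals_Archimedean3[of x] by (meson not_le)

lemma commuting_funpow_comp:
  assumes "commuting H" "line_group H" "f \<in> H" "g \<in> H"
  shows "(f \<circ> g) ^^ n = f ^^ n \<circ> g ^^ n"
proof (induction n)
  case (Suc n)
  have "(f ^^ n) (g x) = g ((f ^^ n) x)" for x
    using commutingD[OF assms(1) line_group_funpow[OF assms(2,3)] assms(4)] .
  then show ?case using Suc by (auto simp: fun_eq_iff)
qed simp

text \<open>Only the relation of a translation number to the movement of points is kept, because this relation
  is invariant under conjugation and rescaling.\<close>

definition translation_number_on :: "(real \<Rightarrow> real) set \<Rightarrow> ((real \<Rightarrow> real) \<Rightarrow> real) \<Rightarrow> bool" where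
  "translation_number_on H \<tau> \<longleftrightarrow>
     (\<forall>f\<in>H. \<forall>g\<in>H. \<tau> (f \<circ> g) = \<tau> f + \<tau> g) \<and>
     (\<forall>f\<in>H. \<tau> f > 0 \<longrightarrow> (\<forall>x. x < f x)) \<and>
     (\<forall>f\<in>H. \<tau> f = 0 \<longrightarrow> (\<exists>x. f x = x))"

lemma translation_number_onD:
  assumes "translation_number_on H \<tau>"
  shows "f \<in> H \<Longrightarrow> g \<in> H \<Longrightarrow> \<tau> (f \<circ> g) = \<tau> f + \<tau> g"
    "f \<in> H \<Longrightarrow> \<tau> f > 0 \<Longrightarrow> x < f x"
    "f \<in> H \<Longrightarrow> \<tau> f = 0 \<Longrightarrow> \<exists>x. f x = x"
  using assms by (auto simp: translation_number_on_def)

lemma translation_number_id_inv: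
  assumes "line_group H" "translation_number_on H \<tau>"
  shows "\<tau> id = 0" "f \<in> H \<Longrightarrow> \<tau> (finv f) = - \<tau> f"
proof -
  show 0: "\<tau> id = 0"
    using translation_number_onD(1)[OF assms(2), of id id] line_groupD(2)[OF assms(1)] by simp
  show "\<tau> (finv f) = - \<tau> f" if "f \<in> H"
    using translation_number_onD(1)[OF assms(2) that line_groupD(4)[OF assms(1) that]]
      line_groupD(1)[OF assms(1) that] 0 by simp
qed

lemma translation_number_periodic:
  assumes H: "line_group H" "commuting H" "transl 1 \<in> H"
  shows "\<exists>\<tau>. translation_number_on H \<tau> \<and> \<tau> (transl 1) = 1"
proof -
  have per: "f \<in> periodic_homeos" if "f \<in> H" for f
    using commutingD[OF H(2) that H(3)] line_groupD(1)[OF H(1) that]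
    by (simp add: periodic_homeos_def transl_def)
  define \<tau> where "\<tau> f = (SOME \<tau>. \<forall>n. \<bar>(f ^^ n) 0 - real n * \<tau>\<bar> \<le> 1)" for f :: "real \<Rightarrow> real"
  have near: "\<bar>(f ^^ n) 0 - real n * \<tau> f\<bar> \<le> 1" if "f \<in> H" for f n
    using someI_ex[OF translation_number_exists[OF per[OF that]]] by (simp add: \<tau>_def)
  have add: "\<tau> (f \<circ> g) = \<tau> f + \<tau> g" if fg: "f \<in> H" "g \<in> H" for f g
  proof -
    have *: "\<bar>real n * \<tau> (f \<circ> g) - (real n * \<tau> f + real n * \<tau> g)\<bar> \<le> 4" for n
    proof -
      have "((f \<circ> g) ^^ n) 0 = (f ^^ n) ((g ^^ n) 0)"
        using commuting_funpow_comp[OF H(2,1) fg] by simp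
      then show ?thesis
        using near[OF fg(1), of n] near[OF fg(2), of n] near[OF line_groupD(3)[OF H(1) fg], of n]
          periodic_homeos_displacement[OF line_group_funpow[OF line_group_periodic_homeos per[OF fg(1)]],
            of n "(g ^^ n) 0"]
        by linarith
    qed
    have "\<tau> (f \<circ> g) - (\<tau> f + \<tau> g) \<le> 0" "(\<tau> f + \<tau> g) - \<tau> (f \<circ> g) \<le> 0"
      by (rule bounded_multiples_imp_0[of _ 4]; use * in \<open>simp add: algebra_simps abs_le_iff\<close>)+
    then show ?thesis by simp
  qed
  have one: "\<tau> (transl 1) = 1"
  proof -
    have "1 - \<tau> (transl 1) \<le> 0" "\<tau> (transl 1) - 1 \<le> 0"
      by (rule bounded_multiples_imp_0[of _ 1];
          use near[OF H(3)] in \<open>simp add: funpow_transl transl_def abs_le_iff algebra_simps\<close>)+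
    then show ?thesis by simp
  qed
  \<comment> \<open>A point that does not move to the right stays below an integer forever.\<close>
  have nonpos: "\<tau> f \<le> 0" if f: "f \<in> H" "f x \<le> x" for f x
  proof (rule bounded_multiples_imp_0)
    fix n
    have fl: "f ^^ n \<in> line_homeos" using line_groupD(1)[OF H(1) f(1)] by simp
    have down: "(f ^^ n) x \<le> x"
    proof (induction n)
      case (Suc n)
      have "f ((f ^^ n) x) \<le> f x" using Suc line_groupD(1)[OF H(1) f(1)] by simp
      then show ?case using f(2) by simp
    qed simp
    have "(f ^^ n) 0 \<le> (f ^^ n) (x + of_int \<lceil>- x\<rceil>)" using fl by simp linarith
    also have "\<dots> = (f ^^ n) x + of_int \<lceil>- x\<rceil>"
      by (rule periodic_homeos_int[OF line_group_funpow[OF line_group_periodic_homeos per[OF f(1)]]])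
    finally show "real n * \<tau> f \<le> x + of_int \<lceil>- x\<rceil> + 1"
      using down near[OF f(1), of n] by linarith
  qed
  have inv: "\<tau> (finv f) = - \<tau> f" if "f \<in> H" for f
  proof -
    have "\<tau> id = 0" using add[of id id] line_groupD(2)[OF H(1)] by simp
    then show ?thesis
      using add[OF that line_groupD(4)[OF H(1) that]] line_groupD(1)[OF H(1) that] by simp
  qed
  have pow: "\<tau> (f ^^ n) = real n * \<tau> f" if "f \<in> H" for f n
  proof (induction n)
    case 0 then show ?case using add[of id id] line_groupD(2)[OF H(1)] by (simp add: id_def[symmetric])
  next
    case (Suc n) then show ?case
      using add[OF that line_group_funpow[OF H(1) that, of n]] unfolding funpow.simps(2)
      by (simp only: of_nat_Suc) (simp add: algebra_simps)
  qed
  have pos: "\<tau> f > 0" if f: "f \<in> H" "\<And>x. x < f x" for f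
  proof -
    obtain N where N: "1 < (f ^^ N) 0"
      using orbit_unbounded[OF line_groupD(1)[OF H(1) f(1)] f(2)] by blast
    let ?g = "transl 1 \<circ> finv (f ^^ N)"
    have fN: "f ^^ N \<in> H" using line_group_funpow[OF H(1) f(1)] .
    have "finv (f ^^ N) 1 < 0" using N line_groupD(1)[OF H(1) fN] by (simp add: line_homeos_inv_less)
    then have "?g 1 \<le> 1" by (simp add: transl_def)
    then have "\<tau> ?g \<le> 0" using nonpos line_groupD(3)[OF H(1) H(3)] line_groupD(4)[OF H(1) fN] by blast
    then have "1 \<le> real N * \<tau> f"
      using add[OF H(3) line_groupD(4)[OF H(1) fN]] inv[OF fN] pow[OF f(1)] one by simp
    then show ?thesis by (smt (verit) mult_nonneg_nonpos of_nat_0_le_iff)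
  qed
  have "\<exists>x. f x = x" if f: "f \<in> H" "\<tau> f = 0" for f
  proof -
    have fl: "f \<in> line_homeos" using line_groupD(1)[OF H(1) f(1)] .
    have "\<not> (\<forall>x. f x < x)"
    proof
      assume "\<forall>x. f x < x"
      then have "\<tau> (finv f) > 0"
        using pos[OF line_groupD(4)[OF H(1) f(1)]] line_homeos_less_inv[OF fl] by blast
      then show False using inv[OF f(1)] f(2) by simp
    qed
    then show ?thesis using fixed_point_or_moved[OF fl] pos[OF f(1)] f(2) by force
  qed
  moreover have "x < f x" if "f \<in> H" "\<tau> f > 0" for f x
    using nonpos[OF that(1), of x] that(2) by (meson not_le)
  ultimately show ?thesis using add one unfolding translation_number_on_def by blast
qed

lemma translation_number_conj:
  assumes \<xi>: "\<xi> \<in> line_homeos" and \<tau>: "translation_number_on (conj_by \<xi> ` H) \<tau>" and "c > 0"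
  shows "translation_number_on H (\<lambda>f. \<tau> (conj_by \<xi> f) / c)"
  unfolding translation_number_on_def
proof (intro conjI ballI impI allI)
  note D = translation_number_onD[OF \<tau>]
  show "\<tau> (conj_by \<xi> (f \<circ> g)) / c = \<tau> (conj_by \<xi> f) / c + \<tau> (conj_by \<xi> g) / c"
    if "f \<in> H" "g \<in> H" for f g
    using D(1)[OF imageI[OF that(1)] imageI[OF that(2)]]
    by (simp add: conj_by_comp[OF \<xi>] add_divide_distrib)
  show "x < f x" if "f \<in> H" "0 < \<tau> (conj_by \<xi> f) / c" for f x
    using D(2)[OF imageI[OF that(1)], of "\<xi> x"] that(2) \<xi> assms(3) by (simp add: zero_less_divide_iff)
  show "\<exists>x. f x = x" if f: "f \<in> H" "\<tau> (conj_by \<xi> f) / c = 0" for f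
  proof -
    obtain y where y: "conj_by \<xi> f y = y" using D(3)[OF imageI[OF f(1)]] f(2) assms(3) by auto
    then have "\<xi> (f (finv \<xi> y)) = \<xi> (finv \<xi> y)"
      using conj_by_apply[OF \<xi>, of f "finv \<xi> y"] \<xi> by simp
    then show ?thesis using line_homeos_eq[OF \<xi>] by blast
  qed
qed

lemma translation_number:
  assumes H: "line_group H" "commuting H" "t \<in> H" "\<And>x. x < t x"
  shows "\<exists>\<tau>. translation_number_on H \<tau> \<and> \<tau> t = 1"
proof -
  obtain \<psi> where \<psi>: "\<psi> \<in> line_homeos" "\<And>x. \<psi> (t x) = \<psi> x + 1"
    using conjugate_to_translation[OF line_groupD(1)[OF H(1,3)] H(4)] by metis
  have t: "conj_by \<psi> t = transl 1"
    using \<psi> by (auto simp: conj_by_def transl_def fun_eq_iff)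
  obtain \<tau> where \<tau>: "translation_number_on (conj_by \<psi> ` H) \<tau>" "\<tau> (transl 1) = 1"
    using translation_number_periodic[OF line_group_conj[OF \<psi>(1) H(1)] commuting_conj[OF \<psi>(1) H(2)]]
      imageI[OF H(3), of "conj_by \<psi>"] t by auto
  then show ?thesis
    using translation_number_conj[OF \<psi>(1) \<tau>(1), of 1] t
    by (intro exI[of _ "\<lambda>f. \<tau> (conj_by \<psi> f) / 1"]) simp
qed

section \<open>Subgroups of the real numbers\<close>

definition real_subgroup :: "real set \<Rightarrow> bool" where
  "real_subgroup D \<longleftrightarrow> 0 \<in> D \<and> (\<forall>x\<in>D. \<forall>y\<in>D. x + y \<in> D) \<and> (\<forall>x\<in>D. - x \<in> D)"

lemma real_subgroup_int_mult:
  assumes "real_subgroup D" "x \<in> D"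
  shows "of_int n * x \<in> D"
proof (induction n rule: int_induct[where k = 0])
  case base then show ?case using assms by (simp add: real_subgroup_def)
next
  case (step1 i)
  then have "of_int i * x + x \<in> D" using assms by (simp add: real_subgroup_def)
  then show ?case by (simp add: algebra_simps)
next
  case (step2 i)
  then have "of_int i * x + - x \<in> D" using assms unfolding real_subgroup_def by blast
  then show ?case by (simp add: algebra_simps)
qed

lemma line_group_transl_int_mult:
  assumes "line_group K" "transl x \<in> K"
  shows "transl (of_int n * x) \<in> K"
proof -
  have "real_subgroup {x. transl x \<in> K}"
    using line_groupD[OF assms(1)] unfolding real_subgroup_def
    by (auto simp: transl_comp[symmetric] id_def inv_transl[symmetric] simp del: inv_transl)
  then show ?thesis using real_subgroup_int_mult[of "{x. transl x \<in> K}" x n] assms(2) by simp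
qed

text \<open>Between \<open>0\<close> and any \<open>\<epsilon>\<close> there is an element, or else the least positive element generates.\<close>

lemma real_subgroup_dense_or_cyclic:
  assumes D: "real_subgroup D"
  shows "(\<forall>a b. a < b \<longrightarrow> (\<exists>x\<in>D. a < x \<and> x < b)) \<or> (\<exists>c\<in>D. \<forall>x\<in>D. \<exists>n::int. x = of_int n * c)"
proof (cases "\<forall>\<epsilon>>0. \<exists>x\<in>D. 0 < x \<and> x < \<epsilon>")
  case True
  have "\<exists>x\<in>D. a < x \<and> x < b" if ab: "a < b" for a b
  proof -
    obtain x where x: "x \<in> D" "0 < x" "x < b - a" using True ab by (metis diff_gt_0_iff_gt)
    define n where "n = \<lfloor>a / x\<rfloor> + 1"
    have "a / x < of_int n" "of_int n \<le> a / x + 1" unfolding n_def by linarith+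
    then have "a < of_int n * x" "of_int n * x \<le> a + x" using x(2) by (auto simp: field_simps)
    then show ?thesis using real_subgroup_int_mult[OF D x(1), of n] x(3) by force
  qed
  then show ?thesis by blast
next
  case False
  then obtain \<epsilon> where \<epsilon>: "\<epsilon> > 0" "\<And>x. x \<in> D \<Longrightarrow> 0 < x \<Longrightarrow> \<epsilon> \<le> x" by (meson not_le)
  show ?thesis
  proof (cases "\<exists>x\<in>D. 0 < x")
    case False
    then have "x = 0" if "x \<in> D" for x
      using that D unfolding real_subgroup_def by (metis linorder_neqE_linordered_idom neg_0_less_iff_less)
    then show ?thesis using D by (intro disjI2 bexI[of _ 0]) (auto simp: real_subgroup_def)
  next
    case True
    let ?P = "{x \<in> D. 0 < x}"
    define c where "c = Inf ?P"
    have P: "?P \<noteq> {}" "bdd_below ?P" using True \<epsilon>(2) by (auto intro: bdd_belowI[of _ \<epsilon>])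
    have c_le: "c \<le> x" if "x \<in> D" "0 < x" for x unfolding c_def by (rule cInf_lower) (use that P in auto)
    have "\<epsilon> \<le> c" unfolding c_def by (rule cInf_greatest[OF P(1)]) (use \<epsilon> in auto)
    then have "c > 0" using \<epsilon>(1) by simp
    have "c \<in> D"
    proof -
      \<comment> \<open>Two distinct elements close to the infimum would differ by less than \<open>\<epsilon>\<close>.\<close>
      obtain x where x: "x \<in> ?P" "x < c + \<epsilon>" using cInf_less_iff[OF P, of "c + \<epsilon>"] \<epsilon>(1) by (auto simp: c_def)
      have "x = c"
      proof (rule ccontr)
        assume "x \<noteq> c"
        then have "c < x" using c_le x(1) by force
        then obtain y where y: "y \<in> ?P" "y < x" using cInf_less_iff[OF P, of x] by (auto simp: c_def)
        have "x + - y \<in> D" using x(1) y(1) D unfolding real_subgroup_def by blast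
        then have "\<epsilon> \<le> x - y" using \<epsilon>(2)[of "x - y"] y(2) by simp
        moreover have "c \<le> y" using c_le y(1) by blast
        ultimately show False using x(2) by linarith
      qed
      then show ?thesis using x(1) by blast
    qed
    moreover have "\<exists>n::int. x = of_int n * c" if "x \<in> D" for x
    proof -
      let ?n = "\<lfloor>x / c\<rfloor>"
      have fl: "of_int ?n \<le> x / c" "x / c < of_int ?n + 1" by linarith+
      have "of_int ?n * c \<le> x / c * c" using fl(1) \<open>c > 0\<close> by (intro mult_right_mono) auto
      moreover have "x / c * c < (of_int ?n + 1) * c" using fl(2) \<open>c > 0\<close> by (intro mult_strict_right_mono) auto
      ultimately have r: "0 \<le> x - of_int ?n * c" "x - of_int ?n * c < c"
        using \<open>c > 0\<close> by (auto simp: algebra_simps)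
      have "x + of_int (- ?n) * c \<in> D"
        using that real_subgroup_int_mult[OF D \<open>c \<in> D\<close>, of "- ?n"] D unfolding real_subgroup_def by blast
      then have "x - of_int ?n * c \<in> D" by simp
      then have "x - of_int ?n * c = 0" using r c_le by force
      then show ?thesis by (intro exI[of _ ?n]) simp
    qed
    ultimately show ?thesis by blast
  qed
qed

section \<open>Structure of tame groups\<close>

text \<open>A weakly increasing map with dense range has no jumps.\<close>

lemma mono_dense_range_surj:
  fixes \<psi> :: "real \<Rightarrow> real"
  assumes "mono \<psi>" "\<And>a b. a < b \<Longrightarrow> \<exists>x. a < \<psi> x \<and> \<psi> x < b"
  shows "surj \<psi>"
proof -
  have "\<exists>x. \<psi> x = y" for y
  proof -
    let ?A = "{x. \<psi> x \<le> y}"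
    obtain x1 where x1: "y < \<psi> x1" using assms(2)[of y "y + 1"] by auto
    obtain x2 where x2: "\<psi> x2 < y" using assms(2)[of "y - 1" y] by auto
    have "x2 \<in> ?A" using x2 by simp
    then have ne: "?A \<noteq> {}" by blast
    have "x \<le> x1" if "\<psi> x \<le> y" for x
      using that x1 monoD[OF assms(1), of x1 x] by linarith
    then have bdd: "bdd_above ?A" by (intro bdd_aboveI[of _ x1]) auto
    let ?s = "Sup ?A"
    have "\<not> \<psi> ?s < y"
    proof
      assume "\<psi> ?s < y"
      then obtain x where x: "\<psi> ?s < \<psi> x" "\<psi> x < y" using assms(2) by blast
      then have "x \<le> ?s" by (intro cSup_upper[OF _ bdd]) simp
      then show False using x(1) monoD[OF assms(1), of x ?s] by linarith
    qed
    moreover have "\<not> y < \<psi> ?s"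
    proof
      assume "y < \<psi> ?s"
      then obtain x where x: "y < \<psi> x" "\<psi> x < \<psi> ?s" using assms(2) by blast
      have "?s \<le> x"
      proof (rule cSup_least[OF ne])
        fix z assume "z \<in> ?A"
        then show "z \<le> x" using x(1) monoD[OF assms(1), of x z] by force
      qed
      then show False using x(2) monoD[OF assms(1), of ?s x] by linarith
    qed
    ultimately show ?thesis by (intro exI[of _ ?s]) linarith
  qed
  then show ?thesis by (metis surjI)
qed

text \<open>The value at \<open>x\<close> is the supremum of the translation numbers of the elements that carry \<open>0\<close> to a
  point not beyond \<open>x\<close>.\<close>

lemma semiconjugacy_exists:
  assumes H: "line_group H" "commuting H" "t \<in> H" "\<And>x. x < t x"
    and \<tau>: "translation_number_on H \<tau>"
  shows "\<exists>\<psi>. mono \<psi> \<and> (\<forall>h\<in>H. \<forall>x. \<psi> (h x) = \<psi> x + \<tau> h)"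
proof -
  note D = translation_number_onD[OF \<tau>] and G = line_groupD[OF H(1)]
  have \<tau>_mono: "\<tau> f \<le> \<tau> g" if "f \<in> H" "g \<in> H" "f x \<le> g x" for f g x
  proof (rule ccontr)
    assume "\<not> \<tau> f \<le> \<tau> g"
    then have "\<tau> (f \<circ> finv g) > 0"
      using D(1)[OF that(1) G(4)[OF that(2)]] translation_number_id_inv(2)[OF H(1) \<tau> that(2)] by simp
    then have "g x < (f \<circ> finv g) (g x)" using D(2)[OF G(3)[OF that(1) G(4)[OF that(2)]]] by blast
    then show False using that(3) G(1)[OF that(2)] by simp
  qed
  let ?A = "\<lambda>x. {h \<in> H. h 0 \<le> x}"
  define \<psi> where "\<psi> x = Sup (\<tau> ` ?A x)" for x
  have tl: "t \<in> line_homeos" using G(1) H(3) .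
  have ne: "\<tau> ` ?A x \<noteq> {}" for x
  proof -
    obtain n where "0 < (t ^^ n) x" using orbit_unbounded[OF tl H(4)] by blast
    then have "finv (t ^^ n) 0 \<le> x"
      using line_homeos_inv_less[OF line_homeos_funpow[OF tl]] by (simp add: less_imp_le)
    then show ?thesis using G(4)[OF line_group_funpow[OF H(1,3)]] by blast
  qed
  have bdd: "bdd_above (\<tau> ` ?A x)" for x
  proof -
    obtain n where n: "x < (t ^^ n) 0" using orbit_unbounded[OF tl H(4)] by blast
    show ?thesis
      by (rule bdd_aboveI[of _ "\<tau> (t ^^ n)"])
        (use n \<tau>_mono[of _ "t ^^ n" 0] line_group_funpow[OF H(1,3)] in force)
  qed
  have up: "\<tau> h \<le> \<psi> x" if "h \<in> H" "h 0 \<le> x" for h x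
    unfolding \<psi>_def by (rule cSup_upper[OF _ bdd]) (use that in auto)
  have ge: "\<psi> x + \<tau> h \<le> \<psi> (h x)" if h: "h \<in> H" for h x
  proof -
    have "\<psi> x \<le> \<psi> (h x) - \<tau> h"
      unfolding \<psi>_def[of x]
    proof (rule cSup_least[OF ne])
      fix r assume "r \<in> \<tau> ` ?A x"
      then obtain g where g: "g \<in> H" "g 0 \<le> x" "r = \<tau> g" by blast
      have "\<tau> (h \<circ> g) \<le> \<psi> (h x)" using up[OF G(3)[OF h g(1)]] g(2) G(1)[OF h] by simp
      then show "r \<le> \<psi> (h x) - \<tau> h" using D(1)[OF h g(1)] g(3) by simp
    qed
    then show ?thesis by simp
  qed
  have "\<psi> (h x) = \<psi> x + \<tau> h" if h: "h \<in> H" for h x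
    using ge[OF h, of x] ge[OF G(4)[OF h], of "h x"] translation_number_id_inv(2)[OF H(1) \<tau> h] G(1)[OF h]
    by simp
  moreover have "mono \<psi>"
    unfolding \<psi>_def by (intro monoI cSup_subset_mono ne bdd) auto
  ultimately show ?thesis by blast
qed

text \<open>The points where the semiconjugacy \<open>\<psi>\<close> is not locally constant form an invariant set. If \<open>\<psi>\<close>
  were constant on some interval, this set would miss the interval and so would consist of avoiding
  points; it would be countable. But \<open>\<psi>\<close> takes on its complement only the values
  that it takes at rational points, and it is onto. This excludes the analogue of the Denjoy examples.\<close>

lemma tame_dense_conjugate_to_translations:
  assumes H: "tame H" "t \<in> H" "\<And>x. x < t x"
    and \<tau>: "translation_number_on H \<tau>"
    and dense: "\<And>a b. a < b \<Longrightarrow> \<exists>h\<in>H. a < \<tau> h \<and> \<tau> h < b"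
  shows "\<exists>\<psi>\<in>line_homeos. \<forall>h\<in>H. conj_by \<psi> h = transl (\<tau> h)"
proof -
  note T = tameD[OF H(1)]
  obtain \<psi> where \<psi>: "mono \<psi>" "\<And>h x. h \<in> H \<Longrightarrow> \<psi> (h x) = \<psi> x + \<tau> h"
    using semiconjugacy_exists[OF T(1,2) H(2,3) \<tau>] by blast
  have "\<exists>x. a < \<psi> x \<and> \<psi> x < b" if ab: "a < b" for a b
  proof -
    obtain h where "h \<in> H" "a - \<psi> 0 < \<tau> h" "\<tau> h < b - \<psi> 0"
      using dense[of "a - \<psi> 0" "b - \<psi> 0"] ab by auto
    then show ?thesis using \<psi>(2)[of h 0] by (intro exI[of _ "h 0"]) auto
  qed
  then have onto: "surj \<psi>" by (rule mono_dense_range_surj[OF \<psi>(1)])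
  have strict: "\<psi> a < \<psi> b" if ab: "a < b" for a b
  proof (rule ccontr)
    assume "\<not> \<psi> a < \<psi> b"
    then have const: "\<psi> x = \<psi> a" if "a \<le> x" "x \<le> b" for x
      using that monoD[OF \<psi>(1), of a x] monoD[OF \<psi>(1), of x b] by linarith
    define F where "F = {x. \<forall>\<epsilon>>0. \<psi> (x - \<epsilon>) < \<psi> (x + \<epsilon>)}"
    have inv: "h x \<in> F" if h: "h \<in> H" "x \<in> F" for h x
      unfolding F_def
    proof (intro CollectI allI impI)
      fix \<epsilon> :: real assume \<epsilon>: "\<epsilon> > 0"
      have hl: "h \<in> line_homeos" using line_groupD(1)[OF T(1) h(1)] .
      define \<delta> where "\<delta> = min (x - finv h (h x - \<epsilon>)) (finv h (h x + \<epsilon>) - x)"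
      have "\<delta> > 0" using \<epsilon> by (simp add: \<delta>_def line_homeos_inv_less[OF hl] line_homeos_less_inv[OF hl])
      then have "\<psi> (x - \<delta>) < \<psi> (x + \<delta>)" using h(2) by (auto simp: F_def)
      then have "\<psi> (h (x - \<delta>)) < \<psi> (h (x + \<delta>))" using \<psi>(2)[OF h(1)] by simp
      moreover have "h x - \<epsilon> \<le> h (x - \<delta>)" "h (x + \<delta>) \<le> h x + \<epsilon>"
        using line_homeos_le[OF hl, of "finv h (h x - \<epsilon>)" "x - \<delta>"]
          line_homeos_le[OF hl, of "x + \<delta>" "finv h (h x + \<epsilon>)"] hl by (auto simp: \<delta>_def)
      ultimately show "\<psi> (h x - \<epsilon>) < \<psi> (h x + \<epsilon>)"
        using monoD[OF \<psi>(1)] by (meson le_less_trans less_le_trans)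
    qed
    have "x \<notin> F" if x: "a < x" "x < b" for x
    proof -
      define \<epsilon> where "\<epsilon> = min (x - a) (b - x)"
      have "\<epsilon> > 0" "\<psi> (x - \<epsilon>) = \<psi> a" "\<psi> (x + \<epsilon>) = \<psi> a"
        using x by (auto simp: \<epsilon>_def intro!: const)
      then show ?thesis unfolding F_def by force
    qed
    then have "F \<subseteq> avoiding_points H"
      unfolding avoiding_points_def using inv ab by blast
    then have F: "countable F" using T(5) countable_subset by blast
    have "\<psi> x \<in> \<psi> ` F \<union> \<psi> ` \<rat>" for x
    proof (cases "x \<in> F")
      case False
      then obtain \<epsilon> where \<epsilon>: "\<epsilon> > 0" "\<psi> (x + \<epsilon>) \<le> \<psi> (x - \<epsilon>)" unfolding F_def by (auto simp: not_less)
      obtain q where q: "q \<in> \<rat>" "x - \<epsilon> < q" "q < x + \<epsilon>" using Rats_dense_in_real[of "x - \<epsilon>" "x + \<epsilon>"] \<epsilon>(1) by auto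
      have "\<psi> x = \<psi> q"
        using monoD[OF \<psi>(1), of "x - \<epsilon>" x] monoD[OF \<psi>(1), of x "x + \<epsilon>"]
          monoD[OF \<psi>(1), of "x - \<epsilon>" q] monoD[OF \<psi>(1), of q "x + \<epsilon>"] q \<epsilon> by linarith
      then show ?thesis using q(1) by blast
    qed simp
    then have "UNIV \<subseteq> \<psi> ` F \<union> \<psi> ` \<rat>" using onto by (metis subsetI surjD)
    moreover have "countable (\<psi> ` F \<union> \<psi> ` \<rat>)" using F countable_image[OF countable_rat, of \<psi>] by simp
    ultimately show False using uncountable_UNIV_real countable_subset by blast
  qed
  then have \<psi>l: "\<psi> \<in> line_homeos" using onto by (intro line_homeosI) (auto, metis surjD)
  have "conj_by \<psi> h y = transl (\<tau> h) y" if "h \<in> H" for h y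
    using conj_by_apply[OF \<psi>l, of h "finv \<psi> y"] \<psi>(2)[OF that] \<psi>l by (simp add: transl_def)
  then show ?thesis using \<psi>l by (intro bexI[of _ \<psi>]) (auto simp: fun_eq_iff)
qed

text \<open>The elements of translation number zero are generated by the corrections \<open>transl (- \<tau> u) \<circ> u\<close>
  of the generators \<open>u\<close>; a common fixed point of these finitely many maps has an orbit consisting of
  its integer translates.\<close>

lemma integral_orbit_exists:
  assumes H: "line_group H" "commuting H" "fin_gen H" "transl 1 \<in> H"
    and \<tau>: "translation_number_on H \<tau>" "\<tau> (transl 1) = 1" "\<And>h. h \<in> H \<Longrightarrow> \<tau> h \<in> \<int>"
  shows "\<exists>x. \<forall>h\<in>H. h x - x \<in> \<int>"
proof -
  note D = translation_number_onD[OF \<tau>(1)] and G = line_groupD[OF H(1)]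
  obtain S where S: "finite S" "S \<subseteq> H" "\<And>K. line_group K \<Longrightarrow> S \<subseteq> K \<Longrightarrow> H \<subseteq> K"
    using fin_genE[OF H(3)] by metis
  have tr: "transl (of_int n) \<in> H \<and> \<tau> (transl (of_int n)) = of_int n" for n
  proof (induction n rule: int_induct[where k = 0])
    case base then show ?case using G(2) translation_number_id_inv(1)[OF H(1) \<tau>(1)] by (simp add: id_def)
  next
    case (step1 i)
    then show ?case using G(3)[OF H(4), of "transl (of_int i)"] D(1)[OF H(4), of "transl (of_int i)"] \<tau>(2)
      by (simp add: transl_comp add.commute)
  next
    case (step2 i)
    have "\<tau> (transl (-1)) = -1" "transl (-1) \<in> H"
      using translation_number_id_inv(2)[OF H(1) \<tau>(1) H(4)] G(4)[OF H(4)] \<tau>(2) by simp_all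
    then show ?case using G(3)[of "transl (-1)" "transl (of_int i)"] D(1)[of "transl (-1)" "transl (of_int i)"] step2
      by (simp add: transl_comp add.commute)
  qed
  define p where "p u = transl (- \<tau> u) \<circ> u" for u
  have p: "p u \<in> H" "\<tau> (p u) = 0" if u: "u \<in> H" for u
  proof -
    obtain n where n: "- \<tau> u = of_int n" using \<tau>(3)[OF u] by (metis Ints_cases Ints_minus)
    show "p u \<in> H" "\<tau> (p u) = 0"
      using tr[of n] G(3)[OF _ u] D(1)[OF _ u] n unfolding p_def by auto
  qed
  have "finite (p ` S)" "p ` S \<subseteq> line_homeos" using S p(1) G(1) by auto
  moreover have "commuting (p ` S)" using p(1) S(2) H(2) unfolding commuting_def by blast
  moreover have "\<exists>x. f x = x" if "f \<in> p ` S" for f using that p S(2) D(3) by blast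
  ultimately obtain x where x: "\<forall>f\<in>p ` S. f x = x" using common_fixed_point by metis
  let ?K = "{h \<in> H. h x - x \<in> \<int>}"
  have per: "h \<in> periodic_homeos" if "h \<in> H" for h
    using commutingD[OF H(2) that H(4)] G(1)[OF that] by (simp add: periodic_homeos_def transl_def)
  have shift: "h (y + r) = h y + r" if "h \<in> H" "r \<in> \<int>" for h y r
    using that periodic_homeos_int[OF per] by (metis Ints_cases)
  have "line_group ?K"
    unfolding line_group_def
  proof (intro conjI ballI)
    fix f g assume fg: "f \<in> ?K" "g \<in> ?K"
    have "f (g x) - x = (f x - x) + (g x - x)" using shift[of f "g x - x" x] fg by simp
    moreover have "(f x - x) + (g x - x) \<in> \<int>" using fg by (intro Ints_add) auto
    ultimately have "f (g x) - x \<in> \<int>" by (simp only:)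
    then show "f \<circ> g \<in> ?K" using fg G(3) by simp
  next
    fix f assume f: "f \<in> ?K"
    have "f (x - (f x - x)) = x" using shift[of f "- (f x - x)" x] f by (simp only: mem_Collect_eq Ints_minus) simp
    then have "finv f x = x - (f x - x)" using f G(1) by (metis (no_types, lifting) line_homeos_inv_left mem_Collect_eq)
    moreover have "- (f x - x) \<in> \<int>" using f by (simp only: mem_Collect_eq Ints_minus)
    ultimately show "finv f \<in> ?K" using f G(4) by simp
  qed (use G in auto)
  moreover have "S \<subseteq> ?K"
  proof
    fix u assume u: "u \<in> S"
    have "p u x = x" using x u by blast
    then have "u x - x = \<tau> u" by (simp add: p_def transl_def)
    then show "u \<in> ?K" using \<tau>(3) u S(2) by auto
  qed
  ultimately show ?thesis using S(3) by blast
qed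

lemma tame_structure:
  assumes "tame H"
  obtains
    (translational) \<psi> D where "\<psi> \<in> line_homeos" "conj_by \<psi> ` H = transl ` D"
  | (integral) \<psi> where "\<psi> \<in> line_homeos" "transl 1 \<in> conj_by \<psi> ` H" "\<And>h. h \<in> conj_by \<psi> ` H \<Longrightarrow> h 0 \<in> \<int>"
proof -
  note T = tameD[OF assms]
  note G = line_groupD[OF T(1)]
  obtain t where t: "t \<in> H" "\<And>x. x < t x" using tame_fixed_point_free[OF assms] by metis
  obtain \<tau> where \<tau>: "translation_number_on H \<tau>" "\<tau> t = 1" using translation_number[OF T(1,2) t] by blast
  note D = translation_number_onD[OF \<tau>(1)]
  have "real_subgroup (\<tau> ` H)"
    unfolding real_subgroup_def
    using translation_number_id_inv[OF T(1) \<tau>(1)] D(1) G(2,3,4)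
    by (auto simp: image_iff) metis+
  then consider "\<And>a b. a < b \<Longrightarrow> \<exists>h\<in>H. a < \<tau> h \<and> \<tau> h < b"
    | c where "c \<in> \<tau> ` H" "\<And>h. h \<in> H \<Longrightarrow> \<exists>n::int. \<tau> h = of_int n * c"
    using real_subgroup_dense_or_cyclic[of "\<tau> ` H"] by fast
  then show ?thesis
  proof cases
    case 1
    obtain \<psi> where "\<psi> \<in> line_homeos" "\<forall>h\<in>H. conj_by \<psi> h = transl (\<tau> h)"
      using tame_dense_conjugate_to_translations[OF assms t \<tau>(1) 1] by blast
    then show ?thesis using translational[of \<psi> "\<tau> ` H"] by (auto simp: image_image)
  next
    case (2 c)
    \<comment> \<open>The generator of the cyclic group of translation numbers may be taken positive.\<close>
    obtain s where s: "s \<in> H" "\<tau> s > 0" "\<And>h. h \<in> H \<Longrightarrow> \<exists>n::int. \<tau> h = of_int n * \<tau> s"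
    proof -
      obtain s where s: "s \<in> H" "c = \<tau> s" using 2(1) by blast
      have "c \<noteq> 0" using 2(2)[OF t(1)] \<tau>(2) by auto
      show ?thesis
      proof (cases "c > 0")
        case True then show ?thesis using that[of s] s 2(2) by blast
      next
        case False
        then have "\<tau> (finv s) > 0" "\<And>n::int. of_int n * c = of_int (- n) * \<tau> (finv s)"
          using s translation_number_id_inv(2)[OF T(1) \<tau>(1) s(1)] \<open>c \<noteq> 0\<close> by auto
        then show ?thesis using that[of "finv s"] G(4)[OF s(1)] 2(2) by metis
      qed
    qed
    have sl: "s \<in> line_homeos" using G(1) s(1) .
    obtain \<psi> where \<psi>: "\<psi> \<in> line_homeos" "\<And>x. \<psi> (s x) = \<psi> x + 1"
      using conjugate_to_translation[OF sl D(2)[OF s(1,2)]] by metis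
    have s1: "conj_by \<psi> s = transl 1"
      using \<psi> by (auto simp: conj_by_def transl_def fun_eq_iff)
    let ?H = "conj_by \<psi> ` H"
    note T' = tameD[OF tame_conj[OF \<psi>(1) assms]]
    define \<tau>' where "\<tau>' h = \<tau> (conj_by (finv \<psi>) h) / \<tau> s" for h
    have "translation_number_on ?H \<tau>'"
      unfolding \<tau>'_def using \<psi>(1) \<tau>(1) s(2) by (intro translation_number_conj) auto
    moreover have "\<tau>' (transl 1) = 1" using s1[symmetric] s(2) \<psi>(1) by (simp add: \<tau>'_def)
    moreover have "\<tau>' h \<in> \<int>" if "h \<in> ?H" for h
      using that s(2,3) \<psi>(1) by (auto simp: \<tau>'_def) (metis Ints_of_int less_irrefl nonzero_mult_div_cancel_right)
    moreover have one: "transl 1 \<in> ?H" using s(1) s1 by (metis imageI)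
    ultimately obtain x where x: "\<forall>h\<in>?H. h x - x \<in> \<int>"
      using integral_orbit_exists[OF T'(1,2,3)] by blast
    let ?\<psi> = "transl (- x) \<circ> \<psi>"
    have eq: "conj_by ?\<psi> ` H = conj_by (transl (- x)) ` ?H"
      using \<psi>(1) by (simp add: conj_by_image_image)
    show ?thesis
    proof (rule integral[of ?\<psi>])
      show "?\<psi> \<in> line_homeos" using \<psi>(1) by simp
      have "conj_by (transl (- x)) (transl 1) = transl 1" by (simp add: conj_by_def transl_comp)
      then show "transl 1 \<in> conj_by ?\<psi> ` H" unfolding eq using one by (metis imageI)
      show "h 0 \<in> \<int>" if "h \<in> conj_by ?\<psi> ` H" for h
        using that x unfolding eq by (auto simp: conj_by_def transl_def)
    qed
  qed
qed

section \<open>Passing to a fundamental interval\<close>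

lemma open_real_contains_interval:
  assumes "open (U :: real set)" "x \<in> U"
  shows "\<exists>a b. a < x \<and> x < b \<and> (\<forall>y. a < y \<and> y < b \<longrightarrow> y \<in> U)"
proof -
  obtain e where e: "e > 0" "\<And>y. dist y x < e \<Longrightarrow> y \<in> U" using assms unfolding open_dist by blast
  show ?thesis using e by (intro exI[of _ "x - e"] exI[of _ "x + e"]) (auto simp: dist_real_def abs_less_iff)
qed

locale unit_interval_coordinate =
  fixes h :: "real \<Rightarrow> real"
  assumes homeo: "\<exists>h'. homeomorphism UNIV {0<..<1} h h'"
begin

lemma h_range: "0 < h x" "h x < 1"
proof -
  have "h ` UNIV = {0<..<1}" using homeo unfolding homeomorphism_def by blast
  then have "h x \<in> {0<..<1}" by blast
  then show "0 < h x" "h x < 1" by auto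
qed

lemma h_inj: "inj h"
  using homeo by (auto simp: homeomorphism_def intro!: injI) metis

lemma h_eq_iff [simp]: "h x = h y \<longleftrightarrow> x = y"
  using h_inj by (auto dest: injD)

lemma h_onto: "0 < y \<Longrightarrow> y < 1 \<Longrightarrow> \<exists>x. y = h x"
proof -
  assume "0 < y" "y < 1"
  moreover have "h ` UNIV = {0<..<1}" using homeo unfolding homeomorphism_def by blast
  ultimately have "y \<in> h ` UNIV" by simp
  then show ?thesis by blast
qed

lemma h_continuous: "continuous_on UNIV h"
  using homeo by (auto simp: homeomorphism_def)

lemma h_finv_continuous: "continuous_on {0<..<1} (finv h)"
proof -
  obtain h' where h': "homeomorphism UNIV {0<..<1} h h'" using homeo by blast
  have "finv h y = h' y" if "y \<in> {0<..<1}" for y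
  proof -
    have "h (h' y) = y" using h' that by (auto simp: homeomorphism_def)
    then show ?thesis using inv_into_f_f[OF h_inj, of "h' y"] by simp
  qed
  then have "continuous_on {0<..<1} (finv h) = continuous_on {0<..<1} h'"
    by (intro continuous_on_cong) auto
  then show ?thesis using h' by (auto simp: homeomorphism_def)
qed

text \<open>The coordinate may reverse the orientation; conjugation by it then still preserves order.\<close>

lemma h_monotone: "(\<forall>x y. x < y \<longrightarrow> h x < h y) \<or> (\<forall>x y. x < y \<longrightarrow> h y < h x)"
proof -
  have "strict_mono_on UNIV h \<or> strict_antimono_on UNIV h"
    using injective_eq_monotone_map[of UNIV h] h_inj h_continuous is_interval_univ by blast
  then show ?thesis by (auto simp: monotone_on_def)
qed

lemma h_conj_less:
  assumes "\<sigma> \<in> line_homeos"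
  shows "h (\<sigma> x) < h (\<sigma> y) \<longleftrightarrow> h x < h y"
proof -
  have s: "\<sigma> a < \<sigma> b \<longleftrightarrow> a < b" for a b using assms by simp
  show ?thesis using h_monotone
  proof
    assume "\<forall>x y. x < y \<longrightarrow> h x < h y"
    then have "h a < h b \<longleftrightarrow> a < b" for a b by (metis not_less_iff_gr_or_eq)
    then show ?thesis using s by simp
  next
    assume "\<forall>x y. x < y \<longrightarrow> h y < h x"
    then have "h a < h b \<longleftrightarrow> b < a" for a b by (metis not_less_iff_gr_or_eq)
    then show ?thesis using s by simp
  qed
qed

lemma floor_coordinate: "\<lfloor>h y + of_int i\<rfloor> = i"
  using h_range[of y] by (simp add: floor_eq_iff)

lemma coordinate_not_int: "h y + of_int i \<notin> \<int>"
proof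
  assume "h y + of_int i \<in> \<int>"
  then obtain j where j: "h y + of_int i = of_int j" by (metis Ints_cases)
  then have "j = i" using floor_coordinate[of y i] by simp
  then have "h y = 0" using j by simp
  then show False using h_range[of y] by simp
qed

lemma int_or_coordinate:
  obtains (int) i where "x = of_int i" | (coord) y i where "x = h y + of_int i"
proof (cases "frac x = 0")
  case True
  then have "x = of_int \<lfloor>x\<rfloor>" by (simp add: frac_def)
  then show ?thesis by (rule int)
next
  case False
  then have "0 < frac x" "frac x < 1" using frac_ge_0[of x] frac_lt_1[of x] by linarith+
  then obtain y where "frac x = h y" using h_onto by blast
  then have "x = h y + of_int \<lfloor>x\<rfloor>" by (simp add: frac_def)
  then show ?thesis by (rule coord)
qed

lemma hbar_int [simp]: "hbar h \<sigma> (of_int i) = of_int i"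
  by (simp add: hbar_def)

lemma hbar_coord [simp]: "hbar h \<sigma> (h y + of_int i) = h (\<sigma> y) + of_int i"
  using coordinate_not_int[of y i] floor_coordinate[of y i] by (simp add: hbar_def inv_into_f_f[OF h_inj])

lemma hbar_coord_0 [simp]: "hbar h \<sigma> (h y) = h (\<sigma> y)"
  using hbar_coord[of \<sigma> y 0] by simp

lemma hbar_0 [simp]: "hbar h \<sigma> 0 = 0"
  using hbar_int[of \<sigma> 0] by simp

lemma hbar_id [simp]: "hbar h id = id"
proof
  show "hbar h id x = id x" for x by (cases x rule: int_or_coordinate) simp_all
qed

lemma hbar_comp: "hbar h (\<sigma> \<circ> \<rho>) = hbar h \<sigma> \<circ> hbar h \<rho>"
proof
  show "hbar h (\<sigma> \<circ> \<rho>) x = (hbar h \<sigma> \<circ> hbar h \<rho>) x" for x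
    by (cases x rule: int_or_coordinate) simp_all
qed

lemma hbar_eq_iff [simp]: "hbar h \<sigma> = hbar h \<rho> \<longleftrightarrow> \<sigma> = \<rho>"
proof
  assume eq: "hbar h \<sigma> = hbar h \<rho>"
  have "h (\<sigma> y) = h (\<rho> y)" for y using fun_cong[OF eq, of "h y"] by simp
  then show "\<sigma> = \<rho>" by (auto simp: fun_eq_iff)
qed simp

lemma hbar_shift: "hbar h \<sigma> (x + of_int j) = hbar h \<sigma> x + of_int j"
proof (cases x rule: int_or_coordinate)
  case (int i)
  then show ?thesis using hbar_int[of \<sigma> "i + j"] by simp
next
  case (coord y i)
  then show ?thesis using hbar_coord[of \<sigma> y "i + j"] by (simp add: add.assoc)
qed

lemma floor_hbar: "\<lfloor>hbar h \<sigma> x\<rfloor> = \<lfloor>x\<rfloor>"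
  by (cases x rule: int_or_coordinate) (simp_all only: hbar_int hbar_coord floor_coordinate)

lemma hbar_line_homeos [simp]:
  assumes \<sigma>: "\<sigma> \<in> line_homeos"
  shows "hbar h \<sigma> \<in> line_homeos"
proof (rule line_homeosI)
  fix x y :: real assume xy: "x < y"
  show "hbar h \<sigma> x < hbar h \<sigma> y"
  proof (cases "\<lfloor>x\<rfloor> = \<lfloor>y\<rfloor>")
    case False
    then have "\<lfloor>hbar h \<sigma> x\<rfloor> < \<lfloor>hbar h \<sigma> y\<rfloor>" using floor_mono[of x y] xy by (simp add: floor_hbar)
    then show ?thesis by linarith
  next
    case True
    show ?thesis
    proof (cases y rule: int_or_coordinate)
      case (int j)
      then have "\<lfloor>x\<rfloor> = j" using True by simp
      then show ?thesis using int xy by linarith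
    next
      case (coord w j)
      note y = this
      show ?thesis
      proof (cases x rule: int_or_coordinate)
        case (int i)
        then have "i = j" using True y floor_coordinate by simp
        then show ?thesis using int y h_range[of "\<sigma> w"] by simp
      next
        case (coord v i)
        then have "i = j" using True y floor_coordinate by simp
        then show ?thesis using coord y xy h_conj_less[OF \<sigma>, of v w] by simp
      qed
    qed
  qed
next
  fix y
  have "hbar h \<sigma> (hbar h (finv \<sigma>) y) = hbar h (\<sigma> \<circ> finv \<sigma>) y" by (simp only: hbar_comp comp_apply)
  then show "\<exists>x. hbar h \<sigma> x = y" using \<sigma> by auto
qed

lemma hbar_inv: "\<sigma> \<in> line_homeos \<Longrightarrow> hbar h (finv \<sigma>) = finv (hbar h \<sigma>)"
  by (rule sym, rule line_homeos_inv_unique) (simp_all add: hbar_comp[symmetric])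

lemma hbar_funpow: "hbar h (\<sigma> ^^ n) = hbar h \<sigma> ^^ n"
  by (induction n) (simp_all only: funpow.simps hbar_comp hbar_id)

text \<open>A periodic homeomorphism that fixes \<open>0\<close> permutes \<open>(0,1)\<close>, and reads there as a homeomorphism
  of the line.\<close>

lemma periodic_fixing_0_is_hbar:
  assumes u: "u \<in> periodic_homeos" "u 0 = 0"
  shows "\<exists>\<sigma>\<in>line_homeos. u = hbar h \<sigma>"
proof -
  have ul: "u \<in> line_homeos" using periodic_homeosD[OF u(1)] .
  have u1: "u 1 = 1" using u by (auto simp: periodic_homeos_def) (metis add_0)
  define \<sigma> where "\<sigma> y = finv h (u (h y))" for y
  have u01: "0 < u (h y)" "u (h y) < 1" for y
    using line_homeos_less[OF ul, of 0 "h y"] line_homeos_less[OF ul, of "h y" 1] h_range[of y] u(2) u1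
    by simp_all
  have h\<sigma>: "h (\<sigma> y) = u (h y)" for y
    unfolding \<sigma>_def using h_onto[OF u01] by (metis f_inv_into_f rangeI)
  have "\<sigma> \<in> line_homeos"
  proof (rule line_homeosI)
    fix x y :: real assume "x < y"
    have *: "h (\<sigma> a) < h (\<sigma> b) \<longleftrightarrow> h a < h b" for a b using ul by (simp add: h\<sigma>)
    show "\<sigma> x < \<sigma> y" using h_monotone
    proof
      assume "\<forall>x y. x < y \<longrightarrow> h x < h y"
      then have "h a < h b \<longleftrightarrow> a < b" for a b by (metis not_less_iff_gr_or_eq)
      then show ?thesis using * \<open>x < y\<close> by blast
    next
      assume "\<forall>x y. x < y \<longrightarrow> h y < h x"
      then have "h a < h b \<longleftrightarrow> b < a" for a b by (metis not_less_iff_gr_or_eq)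
      then show ?thesis using * \<open>x < y\<close> by blast
    qed
  next
    fix y
    have "0 < finv u (h y)" "finv u (h y) < 1"
      using line_homeos_less_inv[OF ul, of 0 "h y"] line_homeos_inv_less[OF ul, of "h y" 1] h_range[of y] u(2) u1
      by simp_all
    then obtain x where "finv u (h y) = h x" using h_onto by blast
    then have "h (\<sigma> x) = h y" using ul h\<sigma>[of x] by (metis line_homeos_inv_right)
    then show "\<exists>x. \<sigma> x = y" by auto
  qed
  moreover have "u x = hbar h \<sigma> x" for x
  proof (cases x rule: int_or_coordinate)
    case (int i)
    then show ?thesis using periodic_homeos_int[OF u(1), of 0 i] u(2) by simp
  next
    case (coord y i)
    then show ?thesis using periodic_homeos_int[OF u(1), of "h y" i] by (simp add: h\<sigma>)
  qed
  ultimately show ?thesis by (intro bexI[of _ \<sigma>]) (auto simp: fun_eq_iff)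
qed

lemma coordinate_contains_interval:
  assumes "a < b" "0 \<le> a" "b \<le> 1"
  shows "\<exists>p q. p < q \<and> (\<forall>y. p < y \<and> y < q \<longrightarrow> a < h y \<and> h y < b)"
proof -
  let ?U = "h -` {a<..<b}"
  have "open ?U" using h_continuous by (simp add: open_vimage)
  moreover obtain y where "h y = (a + b) / 2" using h_onto[of "(a + b) / 2"] assms by auto
  then have "y \<in> ?U" using assms by simp
  ultimately obtain p q where "p < y" "y < q" "\<forall>z. p < z \<and> z < q \<longrightarrow> z \<in> ?U"
    using open_real_contains_interval by blast
  then show ?thesis by (intro exI[of _ p] exI[of _ q]) auto
qed

lemma coordinate_image_contains_interval:
  assumes "p < q"
  obtains a b where "a < b" "0 \<le> a" "b \<le> 1" "\<And>y. a < h y \<Longrightarrow> h y < b \<Longrightarrow> p < y \<and> y < q"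
proof -
  let ?U = "{0<..<1} \<inter> finv h -` {p<..<q}"
  have "open ?U"
    using continuous_openin_preimage[OF h_finv_continuous, of UNIV "{p<..<q}"]
      continuous_on_open_vimage[of "{0<..<1}" "finv h"] h_finv_continuous
    by (auto simp: Int_commute)
  moreover have "h ((p + q) / 2) \<in> ?U" using h_range assms inv_into_f_f[OF h_inj] by simp
  ultimately obtain a b where ab: "a < h ((p + q) / 2)" "h ((p + q) / 2) < b" "\<forall>z. a < z \<and> z < b \<longrightarrow> z \<in> ?U"
    using open_real_contains_interval by blast
  show ?thesis
  proof (rule that[of "max a 0" "min b 1"])
    show "max a 0 < min b 1" using ab(1,2) h_range[of "(p + q) / 2"] by auto
    show "p < y \<and> y < q" if "max a 0 < h y" "h y < min b 1" for y
      using ab(3)[rule_format, of "h y"] that inv_into_f_f[OF h_inj] by auto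
  qed auto
qed

text \<open>The groups on the line that contain \<open>transl 1\<close> and preserve the integers correspond to the
  groups of their stabilizers of \<open>0\<close>, read on the unit interval.\<close>

definition descend :: "(real \<Rightarrow> real) set \<Rightarrow> (real \<Rightarrow> real) set" where
  "descend H = {\<sigma> \<in> line_homeos. hbar h \<sigma> \<in> H}"

definition ascend :: "(real \<Rightarrow> real) set \<Rightarrow> (real \<Rightarrow> real) set" where
  "ascend K = {transl (of_int i) \<circ> hbar h \<sigma> |i \<sigma>. \<sigma> \<in> K}"

lemma ascend_normal_form:
  "(transl (of_int i) \<circ> hbar h \<sigma>) \<circ> (transl (of_int j) \<circ> hbar h \<rho>)
     = transl (of_int (i + j)) \<circ> hbar h (\<sigma> \<circ> \<rho>)"
  using hbar_shift[of \<sigma>] by (auto simp: fun_eq_iff transl_def hbar_comp)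

lemma ascend_eqD:
  assumes "transl (of_int i) \<circ> hbar h \<sigma> = transl (of_int j) \<circ> hbar h \<rho>"
  shows "i = j" "\<sigma> = \<rho>"
proof -
  show "i = j" using fun_cong[OF assms, of 0] by (simp add: transl_def)
  then have "hbar h \<sigma> x = hbar h \<rho> x" for x using fun_cong[OF assms, of x] by (simp add: transl_def)
  then show "\<sigma> = \<rho>" by (metis ext hbar_eq_iff)
qed

lemma hbar_in_ascend: "hbar h \<sigma> \<in> ascend K \<longleftrightarrow> \<sigma> \<in> K"
proof
  assume "hbar h \<sigma> \<in> ascend K"
  then obtain i \<rho> where "hbar h \<sigma> = transl (of_int i) \<circ> hbar h \<rho>" "\<rho> \<in> K" by (auto simp: ascend_def)
  then show "\<sigma> \<in> K" using ascend_eqD[of 0 \<sigma> i \<rho>] by simp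
next
  assume "\<sigma> \<in> K"
  moreover have "hbar h \<sigma> = transl (of_int 0) \<circ> hbar h \<sigma>" by simp
  ultimately show "hbar h \<sigma> \<in> ascend K" unfolding ascend_def by blast
qed

lemma line_group_ascend:
  assumes "line_group K"
  shows "line_group (ascend K)"
  unfolding line_group_def
proof (intro conjI ballI)
  note G = line_groupD[OF assms]
  show "ascend K \<subseteq> line_homeos" using G(1) by (auto simp: ascend_def)
  show "id \<in> ascend K" using hbar_in_ascend[of id] G(2) by simp
  fix f assume "f \<in> ascend K"
  then obtain i \<sigma> where f: "f = transl (of_int i) \<circ> hbar h \<sigma>" "\<sigma> \<in> K" by (auto simp: ascend_def)
  have "f \<circ> (transl (of_int (- i)) \<circ> hbar h (finv \<sigma>)) = id"
    unfolding f(1) ascend_normal_form using G(1)[OF f(2)] by simp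
  then have "finv f = transl (of_int (- i)) \<circ> hbar h (finv \<sigma>)"
    using f G(1) by (intro line_homeos_inv_unique) auto
  then show "finv f \<in> ascend K" using G(4)[OF f(2)] unfolding ascend_def by blast
  fix g assume "g \<in> ascend K"
  then show "f \<circ> g \<in> ascend K" using f G(3) ascend_normal_form unfolding ascend_def by blast
qed

lemma transl_in_ascend: "line_group K \<Longrightarrow> transl (of_int i) \<in> ascend K"
  unfolding ascend_def using line_groupD(2)[of K] hbar_id
  by (intro CollectI exI[of _ i] exI[of _ id]) simp

lemma line_group_descend:
  assumes "line_group H"
  shows "line_group (descend H)"
  using line_groupD[OF assms] unfolding line_group_def descend_def
  by (auto simp: hbar_comp hbar_inv)

lemma interval_transitive_ascend:
  assumes "interval_transitive K"
  shows "interval_transitive (ascend K)"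
  unfolding interval_transitive_def
proof (intro allI impI)
  fix a b c d :: real assume abcd: "a < b \<and> c < d"
  \<comment> \<open>Both intervals are shrunk until they lie between consecutive integers.\<close>
  have shrink: "\<exists>p q i. p < q \<and> (\<forall>y. p < y \<and> y < q \<longrightarrow> a < h y + of_int i \<and> h y + of_int i < b)"
    if ab: "a < b" for a b :: real
  proof -
    let ?i = "\<lfloor>a\<rfloor>" and ?b = "min b (of_int \<lfloor>a\<rfloor> + 1)"
    have "a < ?b" using ab by linarith
    then obtain p q where "p < q"
      "\<forall>y. p < y \<and> y < q \<longrightarrow> a - of_int ?i < h y \<and> h y < ?b - of_int ?i"
    proof -
      have "a - of_int ?i < ?b - of_int ?i" "0 \<le> a - of_int ?i" "?b - of_int ?i \<le> 1"
        using \<open>a < ?b\<close> by linarith+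
      then show ?thesis using coordinate_contains_interval that by blast
    qed
    then show ?thesis by (intro exI[of _ p] exI[of _ q] exI[of _ ?i]) fastforce
  qed
  obtain p q i where p: "p < q" "\<And>y. p < y \<Longrightarrow> y < q \<Longrightarrow> a < h y + of_int i \<and> h y + of_int i < b"
    using shrink[of a b] abcd by blast
  obtain r s j where r: "r < s" "\<And>y. r < y \<Longrightarrow> y < s \<Longrightarrow> c < h y + of_int j \<and> h y + of_int j < d"
    using shrink[of c d] abcd by blast
  obtain \<sigma> y where \<sigma>: "\<sigma> \<in> K" "p < y" "y < q" "r < \<sigma> y" "\<sigma> y < s"
    using assms p(1) r(1) unfolding interval_transitive_def by metis
  let ?u = "transl (of_int (j - i)) \<circ> hbar h \<sigma>"
  have "?u \<in> ascend K" using \<sigma>(1) unfolding ascend_def by blast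
  moreover have "?u (h y + of_int i) = h (\<sigma> y) + of_int j" by (simp add: transl_def)
  ultimately show "\<exists>u\<in>ascend K. \<exists>x. a < x \<and> x < b \<and> c < u x \<and> u x < d"
    using p(2)[OF \<sigma>(2,3)] r(2)[OF \<sigma>(4,5)] by (intro bexI[of _ ?u] exI[of _ "h y + of_int i"]) auto
qed

lemma ascend_descend:
  assumes H: "line_group H" "commuting H" "transl 1 \<in> H" "\<forall>u\<in>H. u 0 \<in> \<int>"
  shows "ascend (descend H) = H"
proof -
  note G = line_groupD[OF H(1)]
  have tr: "transl (of_int n) \<in> H" for n using line_group_transl_int_mult[OF H(1,3), of n] by simp
  show ?thesis
  proof (rule equalityI; rule subsetI)
    fix u assume "u \<in> ascend (descend H)"
    then show "u \<in> H" using tr G(3) by (auto simp: ascend_def descend_def)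
  next
    fix u assume u: "u \<in> H"
    obtain i where i: "u 0 = of_int i" using H(4) u by (metis Ints_cases)
    let ?v = "transl (of_int (- i)) \<circ> u"
    have v: "?v \<in> H" using G(3)[OF tr u] .
    have "?v \<in> periodic_homeos"
      using commutingD[OF H(2) v H(3)] G(1)[OF v] by (simp add: periodic_homeos_def transl_def)
    moreover have "?v 0 = 0" using i by (simp add: transl_def)
    ultimately obtain \<sigma> where \<sigma>: "\<sigma> \<in> line_homeos" "?v = hbar h \<sigma>"
      using periodic_fixing_0_is_hbar by blast
    have "u = transl (of_int i) \<circ> ?v" by (auto simp: transl_def fun_eq_iff)
    then have "u = transl (of_int i) \<circ> hbar h \<sigma>" unfolding \<sigma>(2) .
    moreover have "\<sigma> \<in> descend H" using \<sigma> v by (simp add: descend_def)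
    ultimately show "u \<in> ascend (descend H)" unfolding ascend_def by blast
  qed
qed

lemma conj_by_normal_form:
  assumes \<xi>: "\<xi> \<in> line_homeos"
  shows "conj_by (hbar h \<xi>) (transl (of_int i) \<circ> hbar h \<sigma>) = transl (of_int i) \<circ> hbar h (conj_by \<xi> \<sigma>)"
  using hbar_shift[of \<xi>] \<xi>
  by (auto simp: conj_by_def hbar_comp hbar_inv[symmetric] fun_eq_iff transl_def)

lemma conj_ascend:
  assumes \<xi>: "\<xi> \<in> line_homeos"
  shows "conj_by (hbar h \<xi>) ` ascend K = ascend (conj_by \<xi> ` K)"
proof (rule equalityI; rule subsetI)
  fix u assume "u \<in> conj_by (hbar h \<xi>) ` ascend K"
  then show "u \<in> ascend (conj_by \<xi> ` K)"
    unfolding ascend_def using conj_by_normal_form[OF \<xi>] by blast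
next
  fix u assume "u \<in> ascend (conj_by \<xi> ` K)"
  then obtain i \<sigma> where "\<sigma> \<in> K" "u = transl (of_int i) \<circ> hbar h (conj_by \<xi> \<sigma>)"
    unfolding ascend_def by blast
  then show "u \<in> conj_by (hbar h \<xi>) ` ascend K"
    unfolding ascend_def conj_by_normal_form[OF \<xi>, symmetric] by blast
qed

lemma tame_descend:
  assumes H: "tame H" "transl 1 \<in> H" "\<forall>u\<in>H. u 0 \<in> \<int>"
  shows "tame (descend H)"
proof -
  note T = tameD[OF H(1)]
  note G = line_groupD[OF T(1)]
  have asc: "ascend (descend H) = H" by (rule ascend_descend[OF T(1,2) H(2,3)])
  have "commuting (descend H)"
    unfolding commuting_def
  proof (intro ballI)
    fix f g assume "f \<in> descend H" "g \<in> descend H"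
    then have "hbar h (f \<circ> g) = hbar h (g \<circ> f)"
      using T(2) unfolding commuting_def hbar_comp descend_def by blast
    then show "f \<circ> g = g \<circ> f" by simp
  qed
  moreover have "fin_gen (descend H)"
  proof -
    obtain S where S: "finite S" "S \<subseteq> H" "\<And>K. line_group K \<Longrightarrow> S \<subseteq> K \<Longrightarrow> H \<subseteq> K"
      using fin_genE[OF T(3)] by metis
    have "\<forall>u\<in>S. \<exists>\<sigma>\<in>descend H. \<exists>i. u = transl (of_int i) \<circ> hbar h \<sigma>"
      using S(2) asc unfolding ascend_def by blast
    then obtain F where F: "\<And>u. u \<in> S \<Longrightarrow> F u \<in> descend H \<and> (\<exists>i. u = transl (of_int i) \<circ> hbar h (F u))"
      by metis
    have "descend H \<subseteq> K" if K: "line_group K" "F ` S \<subseteq> K" for K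
    proof -
      have "S \<subseteq> ascend K" using F K(2) unfolding ascend_def by blast
      then have "H \<subseteq> ascend K" by (rule S(3)[OF line_group_ascend[OF K(1)]])
      then show ?thesis using hbar_in_ascend by (auto simp: descend_def)
    qed
    then show ?thesis unfolding fin_gen_def using S(1) F by (intro exI[of _ "F ` S"]) auto
  qed
  moreover have "interval_transitive (descend H)"
    unfolding interval_transitive_def
  proof (intro allI impI)
    fix p q r s :: real assume "p < q \<and> r < s"
    then have pq: "p < q" and rs: "r < s" by auto
    obtain a b where a: "a < b" "0 \<le> a" "b \<le> 1" "\<And>y. a < h y \<Longrightarrow> h y < b \<Longrightarrow> p < y \<and> y < q"
      using coordinate_image_contains_interval[OF pq] by metis
    obtain c d where c: "c < d" "0 \<le> c" "d \<le> 1" "\<And>y. c < h y \<Longrightarrow> h y < d \<Longrightarrow> r < y \<and> y < s"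
      using coordinate_image_contains_interval[OF rs] by metis
    obtain u x where u: "u \<in> H" "a < x" "x < b" "c < u x" "u x < d"
      using T(4) a(1) c(1) unfolding interval_transitive_def by metis
    obtain i \<sigma> where \<sigma>: "u = transl (of_int i) \<circ> hbar h \<sigma>" "\<sigma> \<in> descend H"
      using u(1) asc unfolding ascend_def by blast
    obtain y where y: "x = h y" using h_onto[of x] u(2,3) a(2,3) by auto
    have ux: "u x = h (\<sigma> y) + of_int i" by (simp add: \<sigma>(1) y transl_def)
    then have "0 < h (\<sigma> y) + of_int i" "h (\<sigma> y) + of_int i < 1" using u(4,5) c(2,3) by linarith+
    then have "\<lfloor>h (\<sigma> y) + of_int i\<rfloor> = 0" by linarith
    then have "i = 0" by (simp add: floor_coordinate)
    then show "\<exists>\<sigma>\<in>descend H. \<exists>x. p < x \<and> x < q \<and> r < \<sigma> x \<and> \<sigma> x < s"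
      using a(4)[of y] c(4)[of "\<sigma> y"] u ux y \<sigma>(2) by (intro bexI[of _ \<sigma>] exI[of _ y]) auto
  qed
  moreover have "countable (avoiding_points (descend H))"
  proof -
    have "h ` avoiding_points (descend H) \<subseteq> avoiding_points H"
    proof
      fix x assume "x \<in> h ` avoiding_points (descend H)"
      then obtain y r s where y: "x = h y" "r < s" "\<And>\<sigma>. \<sigma> \<in> descend H \<Longrightarrow> \<not> (r < \<sigma> y \<and> \<sigma> y < s)"
        unfolding avoiding_points_def by blast
      obtain c d where c: "c < d" "0 \<le> c" "d \<le> 1" "\<And>y. c < h y \<Longrightarrow> h y < d \<Longrightarrow> r < y \<and> y < s"
        using coordinate_image_contains_interval[OF y(2)] by metis
      have "\<not> (c < u x \<and> u x < d)" if u: "u \<in> H" for u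
      proof
        assume ux: "c < u x \<and> u x < d"
        obtain i \<sigma> where \<sigma>: "u = transl (of_int i) \<circ> hbar h \<sigma>" "\<sigma> \<in> descend H"
          using u asc unfolding ascend_def by blast
        have eq: "u x = h (\<sigma> y) + of_int i" by (simp add: \<sigma>(1) y(1) transl_def)
        then have "0 < h (\<sigma> y) + of_int i" "h (\<sigma> y) + of_int i < 1" using ux c(2,3) by linarith+
        then have "\<lfloor>h (\<sigma> y) + of_int i\<rfloor> = 0" by linarith
        then have "i = 0" by (simp add: floor_coordinate)
        then show False using c(4)[of "\<sigma> y"] ux eq y(3)[OF \<sigma>(2)] by simp
      qed
      then show "x \<in> avoiding_points H" using c(1) unfolding avoiding_points_def by blast
    qed
    then have "countable (h ` avoiding_points (descend H))" using T(5) countable_subset by blast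
    then show ?thesis by (rule countable_image_inj_on) (use h_inj in \<open>auto intro: inj_on_subset\<close>)
  qed
  ultimately show ?thesis using line_group_descend[OF T(1)] by (simp add: tame_def)
qed

text \<open>A transitive group on the unit interval that contains \<open>\<gamma>'\<close> generates together with
  \<open>transl 1\<close> a transitive group on the line that contains \<open>\<gamma>\<close>.\<close>

lemma tight_rel_descend:
  assumes H: "line_group H" "commuting H" "transl 1 \<in> H" "\<forall>u\<in>H. u 0 \<in> \<int>"
    and tight: "tight_rel H (transl (of_int k) \<circ> hbar h \<gamma>')"
  shows "tight_rel (descend H) \<gamma>'"
  unfolding tight_rel_def
proof (intro allI impI ballI)
  fix K \<sigma> assume K: "line_group K \<and> K \<subseteq> descend H \<and> \<gamma>' \<in> K \<and> interval_transitive K" and \<sigma>: "\<sigma> \<in> descend H"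
  have "ascend K \<subseteq> ascend (descend H)" using K by (auto simp: ascend_def)
  then have "ascend K \<subseteq> H" using ascend_descend[OF H] by simp
  moreover have "transl (of_int k) \<circ> hbar h \<gamma>' \<in> ascend K" using K by (auto simp: ascend_def)
  moreover have "hbar h \<sigma> \<in> H" using \<sigma> by (simp add: descend_def)
  ultimately obtain m where m: "m \<ge> 1" "hbar h \<sigma> ^^ m \<in> ascend K"
    using tight K line_group_ascend[of K] interval_transitive_ascend[of K] unfolding tight_rel_def by blast
  then show "\<exists>m\<ge>1. \<sigma> ^^ m \<in> K" by (auto simp: hbar_funpow[symmetric] hbar_in_ascend)
qed

end

section \<open>Rank\<close>

text \<open>An injective homomorphism into the integer vectors supported on \<open>A\<close>. It bounds the rank from
  above, and the finite set \<open>A\<close> shrinks with each passage to a fundamental interval.\<close>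

definition coordinates_on ::
    "(real \<Rightarrow> real) set \<Rightarrow> nat set \<Rightarrow> ((real \<Rightarrow> real) \<Rightarrow> nat \<Rightarrow> int) \<Rightarrow> bool" where
  "coordinates_on H A \<kappa> \<longleftrightarrow>
     (\<forall>f\<in>H. \<forall>g\<in>H. \<forall>i. \<kappa> (f \<circ> g) i = \<kappa> f i + \<kappa> g i) \<and>
     (\<forall>f\<in>H. \<forall>i. i \<notin> A \<longrightarrow> \<kappa> f i = 0) \<and>
     (\<forall>f\<in>H. (\<forall>i. \<kappa> f i = 0) \<longrightarrow> f = id)"

definition int_vectors :: "nat \<Rightarrow> (nat \<Rightarrow> int) set" where
  "int_vectors d = {v. \<forall>i\<ge>d. v i = 0}"

definition free_basis :: "(real \<Rightarrow> real) set \<Rightarrow> nat \<Rightarrow> ((nat \<Rightarrow> int) \<Rightarrow> real \<Rightarrow> real) \<Rightarrow> bool" where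
  "free_basis H d \<rho> \<longleftrightarrow>
     (\<forall>v\<in>int_vectors d. \<forall>w\<in>int_vectors d. \<rho> (\<lambda>i. v i + w i) = \<rho> v \<circ> \<rho> w) \<and>
     inj_on \<rho> (int_vectors d) \<and> \<rho> ` int_vectors d = H"

lemma coordinates_onD:
  assumes "coordinates_on H A \<kappa>"
  shows "f \<in> H \<Longrightarrow> g \<in> H \<Longrightarrow> \<kappa> (f \<circ> g) i = \<kappa> f i + \<kappa> g i"
    "f \<in> H \<Longrightarrow> i \<notin> A \<Longrightarrow> \<kappa> f i = 0"
    "f \<in> H \<Longrightarrow> (\<And>i. \<kappa> f i = 0) \<Longrightarrow> f = id"
  using assms by (auto simp: coordinates_on_def)

lemma coordinates_on_conj:
  assumes \<xi>: "\<xi> \<in> line_homeos" and "coordinates_on H A \<kappa>"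
  shows "coordinates_on (conj_by \<xi> ` H) A (\<lambda>f. \<kappa> (conj_by (finv \<xi>) f))"
proof -
  note D = coordinates_onD[OF assms(2)]
  have comp: "conj_by (finv \<xi>) (conj_by \<xi> f \<circ> conj_by \<xi> g) = f \<circ> g" for f g
    using \<xi> by (simp add: conj_by_comp)
  show ?thesis
    unfolding coordinates_on_def ball_simps(9)
  proof (intro conjI ballI allI impI)
    fix f g i assume "f \<in> H" "g \<in> H"
    then show "\<kappa> (conj_by (finv \<xi>) (conj_by \<xi> f \<circ> conj_by \<xi> g)) i =
        \<kappa> (conj_by (finv \<xi>) (conj_by \<xi> f)) i + \<kappa> (conj_by (finv \<xi>) (conj_by \<xi> g)) i"
      unfolding comp using D(1) \<xi> by simp
  next
    fix f i assume "f \<in> H" "i \<notin> A"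
    then show "\<kappa> (conj_by (finv \<xi>) (conj_by \<xi> f)) i = 0" using D(2) \<xi> by simp
  next
    fix f assume "f \<in> H" "\<forall>i. \<kappa> (conj_by (finv \<xi>) (conj_by \<xi> f)) i = 0"
    then have "f = id" using D(3) \<xi> by simp
    then show "conj_by \<xi> f = id" using \<xi> by simp
  qed
qed

lemma free_basis_conj:
  assumes \<xi>: "\<xi> \<in> line_homeos" and "free_basis (conj_by \<xi> ` H) d \<rho>"
  shows "free_basis H d (\<lambda>v. conj_by (finv \<xi>) (\<rho> v))"
proof -
  have inj: "inj (conj_by (finv \<xi>))" using \<xi> by (metis conj_by_inv_right injI)
  have "(\<lambda>v. conj_by (finv \<xi>) (\<rho> v)) ` int_vectors d = conj_by (finv \<xi>) ` \<rho> ` int_vectors d"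
    by (simp add: image_image)
  also have "\<dots> = H" using assms by (simp add: free_basis_def)
  finally have im: "(\<lambda>v. conj_by (finv \<xi>) (\<rho> v)) ` int_vectors d = H" .
  have "inj_on (\<lambda>v. conj_by (finv \<xi>) (\<rho> v)) (int_vectors d)"
    using assms(2) inj unfolding free_basis_def inj_on_def inj_def by blast
  then show ?thesis
    using assms(2) im \<xi> unfolding free_basis_def by (simp add: conj_by_comp)
qed

context unit_interval_coordinate begin

text \<open>Let \<open>j\<close> be a coordinate that does not vanish on \<open>transl 1\<close>. Eliminating it by a row operation
  gives coordinates on the stabilizer of \<open>0\<close>. They are still injective: an element with vanishing new
  coordinates has a power that is a power of \<open>transl 1\<close>, and it fixes \<open>0\<close>.\<close>

lemma coordinates_on_descend:
  assumes H: "line_group H" "transl 1 \<in> H" and \<kappa>: "coordinates_on H A \<kappa>"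
  shows "\<exists>j\<in>A. \<exists>\<kappa>'. coordinates_on (descend H) (A - {j}) \<kappa>'"
proof -
  note D = coordinates_onD[OF \<kappa>] and G = line_groupD[OF H(1)]
  let ?T = "\<kappa> (transl 1)"
  have id0: "\<kappa> id i = 0" for i using D(1)[OF G(2) G(2), of i] by simp
  have inv: "\<kappa> (finv f) i = - \<kappa> f i" if "f \<in> H" for f i
    using D(1)[OF that G(4)[OF that], of i] G(1)[OF that] id0 by simp
  have pow: "\<kappa> (f ^^ n) i = int n * \<kappa> f i" if "f \<in> H" for f n i
  proof (induction n)
    case 0 then show ?case using id0[of i] by (simp add: id_def)
  next
    case (Suc n) then show ?case
      unfolding funpow.simps(2) D(1)[OF that line_group_funpow[OF H(1) that]] by (simp add: algebra_simps)
  qed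
  have "transl 1 \<noteq> id" by (auto simp: transl_def fun_eq_iff)
  then obtain j where j: "?T j \<noteq> 0" using D(3)[OF H(2)] by blast
  then have "j \<in> A" using D(2)[OF H(2)] by blast
  define \<kappa>' where "\<kappa>' \<sigma> i = ?T j * \<kappa> (hbar h \<sigma>) i - \<kappa> (hbar h \<sigma>) j * ?T i" for \<sigma> i
  have "coordinates_on (descend H) (A - {j}) \<kappa>'"
    unfolding coordinates_on_def
  proof (intro conjI ballI allI impI)
    fix f g i assume "f \<in> descend H" "g \<in> descend H"
    then show "\<kappa>' (f \<circ> g) i = \<kappa>' f i + \<kappa>' g i"
      by (simp add: \<kappa>'_def hbar_comp D(1) descend_def algebra_simps)
  next
    fix f i assume f: "f \<in> descend H" and "i \<notin> A - {j}"
    then show "\<kappa>' f i = 0" using D(2)[of "hbar h f" i] D(2)[OF H(2), of i]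
      by (cases "i = j") (auto simp: \<kappa>'_def descend_def)
  next
    fix f assume f: "f \<in> descend H" and 0: "\<forall>i. \<kappa>' f i = 0"
    let ?u = "hbar h f" and ?m = "?T j"
    have u: "?u \<in> H" using f by (simp add: descend_def)
    let ?l = "\<kappa> ?u j"
    have eq: "?m * \<kappa> ?u i = ?l * ?T i" for i using 0 by (simp add: \<kappa>'_def)
    \<comment> \<open>Powers with natural exponents suffice, up to replacing one of the two elements by its inverse.\<close>
    define v where "v = (if sgn ?m * sgn ?l \<ge> 0 then finv ?u else ?u)"
    have v: "v \<in> H" "v 0 = 0" using u G(1,4) f by (auto simp: v_def) (metis hbar_0 line_homeos_inv_left)
    have vi: "\<bar>?m\<bar> * \<kappa> v i = - \<bar>?l\<bar> * ?T i" for i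
      using eq[of i] inv[OF u, of i] by (auto simp: v_def abs_if sgn_if split: if_splits)
    let ?w = "v ^^ nat \<bar>?m\<bar> \<circ> transl 1 ^^ nat \<bar>?l\<bar>"
    have "\<kappa> ?w i = 0" for i
      using vi[of i] by (simp add: D(1) line_group_funpow[OF H(1)] v(1) H(2) pow)
    then have w: "?w = id" by (intro D(3) G(3) line_group_funpow[OF H(1)] v(1) H(2))
    have v0: "(v ^^ k) 0 = 0" for k using v(2) by (induction k) auto
    have vl: "v ^^ nat \<bar>?m\<bar> \<in> line_homeos" using G(1)[OF v(1)] by simp
    have "(v ^^ nat \<bar>?m\<bar>) (real (nat \<bar>?l\<bar>)) = (v ^^ nat \<bar>?m\<bar>) 0"
      using fun_cong[OF w, of 0] v0 by (simp add: funpow_transl transl_def)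
    then have "?l = 0" using line_homeos_eq[OF vl] by simp
    then have "\<kappa> ?u i = 0" for i using eq[of i] j by simp
    then have "?u = hbar h id" using D(3)[OF u] by simp
    then show "f = id" by (simp only: hbar_eq_iff)
  qed
  then show ?thesis using \<open>j \<in> A\<close> by blast
qed

lemma free_basis_ascend:
  assumes "free_basis K d \<rho>"
  shows "free_basis (ascend K) (Suc d) (\<lambda>v. transl (of_int (v d)) \<circ> hbar h (\<rho> (v(d := 0))))"
    (is "free_basis _ _ ?\<rho>")
proof -
  have upd: "v(d := 0) \<in> int_vectors d" if "v \<in> int_vectors (Suc d)" for v
    using that by (auto simp: int_vectors_def)
  have hom: "?\<rho> (\<lambda>i. v i + w i) = ?\<rho> v \<circ> ?\<rho> w"
    if "v \<in> int_vectors (Suc d)" "w \<in> int_vectors (Suc d)" for v w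
  proof -
    have "(\<lambda>i. v i + w i)(d := 0) = (\<lambda>i. (v(d := 0)) i + (w(d := 0)) i)" by auto
    then have "\<rho> ((\<lambda>i. v i + w i)(d := 0)) = \<rho> (v(d := 0)) \<circ> \<rho> (w(d := 0))"
      using assms upd that by (simp only: free_basis_def)
    then show ?thesis unfolding ascend_normal_form by simp
  qed
  have inj: "inj_on ?\<rho> (int_vectors (Suc d))"
  proof (rule inj_onI)
    fix v w assume vw: "v \<in> int_vectors (Suc d)" "w \<in> int_vectors (Suc d)" "?\<rho> v = ?\<rho> w"
    have "v d = w d" "\<rho> (v(d := 0)) = \<rho> (w(d := 0))" using ascend_eqD[OF vw(3)] by auto
    then have "v d = w d" "v(d := 0) = w(d := 0)"
      using assms upd[OF vw(1)] upd[OF vw(2)] by (auto simp: free_basis_def dest: inj_onD)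
    then show "v = w" by (metis fun_upd_triv fun_upd_upd)
  qed
  have "?\<rho> ` int_vectors (Suc d) = ascend K"
  proof (rule equalityI; rule subsetI)
    fix u assume "u \<in> ?\<rho> ` int_vectors (Suc d)"
    then show "u \<in> ascend K" using assms upd unfolding free_basis_def ascend_def by blast
  next
    fix u assume "u \<in> ascend K"
    then obtain i v where v: "v \<in> int_vectors d" "u = transl (of_int i) \<circ> hbar h (\<rho> v)"
      using assms unfolding free_basis_def ascend_def by blast
    have "(v(d := i))(d := 0) = v" using v(1) by (auto simp: int_vectors_def)
    then have "u = ?\<rho> (v(d := i))" using v(2) by simp
    moreover have "v(d := i) \<in> int_vectors (Suc d)" using v(1) by (auto simp: int_vectors_def)
    ultimately show "u \<in> ?\<rho> ` int_vectors (Suc d)" by blast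
  qed
  then show ?thesis using hom inj unfolding free_basis_def by blast
qed

end

section \<open>Groups of translations\<close>

lemma subgroup_Homeo_plus_R_iff: "subgroup K Homeo_plus_R \<longleftrightarrow> line_group K"
proof
  assume K: "subgroup K Homeo_plus_R"
  have sub: "f \<in> line_homeos" if "f \<in> K" for f
    using subgroup.mem_carrier[OF K that] by (simp add: carrier_Homeo_plus_R)
  show "line_group K"
    unfolding line_group_def
  proof (intro conjI ballI)
    show "id \<in> K" using subgroup.one_closed[OF K] by (simp add: one_Homeo_plus_R)
    show "f \<circ> g \<in> K" if "f \<in> K" "g \<in> K" for f g
      using subgroup.m_closed[OF K that] sub that by (simp add: mult_Homeo_plus_R)
    show "finv f \<in> K" if "f \<in> K" for f
      using subgroup.m_inv_closed[OF K that] sub that by (simp add: inv_Homeo_plus_R)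
  qed (use sub in blast)
next
  assume K: "line_group K"
  note G = line_groupD[OF K]
  show "subgroup K Homeo_plus_R"
    by (rule group.subgroupI[OF group_Homeo_plus_R])
      (use G in \<open>auto simp: carrier_Homeo_plus_R mult_Homeo_plus_R inv_Homeo_plus_R\<close>)
qed

lemma generate_Homeo_plus_R_eq:
  assumes "line_group M" "S \<subseteq> M" "\<And>K. line_group K \<Longrightarrow> S \<subseteq> K \<Longrightarrow> M \<subseteq> K"
  shows "generate Homeo_plus_R S = M"
  by (rule group.generateI[OF group_Homeo_plus_R, symmetric])
    (use assms in \<open>auto simp: subgroup_Homeo_plus_R_iff\<close>)

lemma line_group_transl:
  assumes "real_subgroup D"
  shows "line_group (transl ` D)"
  using assms unfolding line_group_def real_subgroup_def
  by (auto simp: transl_comp image_iff) (metis transl_0)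

lemma real_subgroup_transl:
  assumes "line_group (transl ` D)"
  shows "real_subgroup D"
proof -
  have *: "transl x \<in> transl ` D \<longleftrightarrow> x \<in> D" for x by auto
  note G = line_groupD[OF assms]
  have "0 \<in> D" using G(2) *[of 0] by simp
  moreover have "x + y \<in> D" if "x \<in> D" "y \<in> D" for x y
    using G(3)[of "transl x" "transl y"] that * by (simp add: transl_comp)
  moreover have "- x \<in> D" if "x \<in> D" for x
    using G(4)[of "transl x"] that * by simp
  ultimately show ?thesis by (simp add: real_subgroup_def)
qed

lemma interval_transitive_transl:
  assumes "\<And>a b. a < b \<Longrightarrow> \<exists>x\<in>D. a < x \<and> x < b"
  shows "interval_transitive (transl ` D)"
  unfolding interval_transitive_def
proof (intro allI impI)
  fix a b c d :: real assume ab: "a < b \<and> c < d"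
  let ?y = "(a + b) / 2"
  obtain x where "x \<in> D" "c - ?y < x" "x < d - ?y" using assms[of "c - ?y" "d - ?y"] ab by auto
  then show "\<exists>u\<in>transl ` D. \<exists>x. a < x \<and> x < b \<and> c < u x \<and> u x < d"
    using ab by (intro bexI[of _ "transl x"] exI[of _ ?y]) (auto simp: transl_def)
qed

lemma dense_of_interval_transitive_transl:
  assumes "interval_transitive (transl ` D)" "a < b"
  shows "\<exists>x\<in>D. a < x \<and> x < b"
proof -
  let ?e = "(b - a) / 4" and ?m = "(a + b) / 2"
  have "0 < ?e" using assms(2) by simp
  then have "- ?e < ?e \<and> ?m - ?e < ?m + ?e" by linarith
  then obtain u y where u: "u \<in> transl ` D" "- ?e < y" "y < ?e" "?m - ?e < u y" "u y < ?m + ?e"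
    using assms(1)[unfolded interval_transitive_def, rule_format] by metis
  then obtain x where "x \<in> D" "u = transl x" by blast
  then show ?thesis using u by (intro bexI[of _ x]) (auto simp: transl_def field_simps)
qed

definition lattice2 :: "real \<Rightarrow> real \<Rightarrow> real set" where
  "lattice2 b c = {of_int i * b + of_int j * c |i j::int. True}"

definition independent2 :: "real \<Rightarrow> real \<Rightarrow> bool" where
  "independent2 b c \<longleftrightarrow> (\<forall>i j::int. of_int i * b + of_int j * c = 0 \<longrightarrow> i = 0 \<and> j = 0)"

lemma independent2D:
  assumes "independent2 b c" "of_int i * b + of_int j * c = 0"
  shows "i = 0" "j = 0"
  using assms unfolding independent2_def by blast+

lemma real_subgroup_lattice2: "real_subgroup (lattice2 b c)"
  unfolding real_subgroup_def
proof (intro conjI ballI)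
  show "0 \<in> lattice2 b c" unfolding lattice2_def by (intro CollectI exI[of _ 0]) simp
  fix x assume "x \<in> lattice2 b c"
  then obtain i j :: int where x: "x = of_int i * b + of_int j * c" by (auto simp: lattice2_def)
  show "- x \<in> lattice2 b c"
    unfolding lattice2_def x by (intro CollectI exI[of _ "- i"] exI[of _ "- j"]) simp
  fix y assume "y \<in> lattice2 b c"
  then obtain k l :: int where y: "y = of_int k * b + of_int l * c" by (auto simp: lattice2_def)
  show "x + y \<in> lattice2 b c"
    unfolding lattice2_def x y
    by (intro CollectI exI[of _ "i + k"] exI[of _ "j + l"]) (simp add: algebra_simps)
qed

lemma lattice2_basis: "b \<in> lattice2 b c" "c \<in> lattice2 b c"
proof -
  have "b = of_int 1 * b + of_int 0 * c" "c = of_int 0 * b + of_int 1 * c" by simp_all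
  then show "b \<in> lattice2 b c" "c \<in> lattice2 b c" unfolding lattice2_def by blast+
qed

lemma lattice2_subset:
  assumes "real_subgroup D" "b \<in> D" "c \<in> D"
  shows "lattice2 b c \<subseteq> D"
  using real_subgroup_int_mult[OF assms(1,2)] real_subgroup_int_mult[OF assms(1,3)] assms(1)
  unfolding lattice2_def real_subgroup_def by auto

lemma lattice2_dense:
  assumes "independent2 b c" "x < y"
  shows "\<exists>z\<in>lattice2 b c. x < z \<and> z < y"
proof (rule ccontr)
  assume "\<not> ?thesis"
  then obtain e where e: "\<And>z. z \<in> lattice2 b c \<Longrightarrow> \<exists>n::int. z = of_int n * e"
    using real_subgroup_dense_or_cyclic[OF real_subgroup_lattice2, of b c] assms(2) by blast
  obtain m n :: int where mn: "b = of_int m * e" "c = of_int n * e" using e lattice2_basis by metis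
  have "of_int n * b + of_int (- m) * c = 0" by (simp add: mn)
  then have "m = 0" using independent2D(2)[OF assms(1), of n "- m"] by simp
  then have "of_int 1 * b + of_int 0 * c = 0" by (simp add: mn)
  then show False using independent2D(1)[OF assms(1), of 1 0] by simp
qed

text \<open>Finitely many denominators have a common multiple.\<close>

lemma common_multiplier:
  assumes fg: "fin_gen (transl ` D)" and E: "real_subgroup E"
    and "\<And>x. x \<in> D \<Longrightarrow> \<exists>m::nat. m \<ge> 1 \<and> real m * x \<in> E"
  shows "\<exists>M::nat. M \<ge> 1 \<and> (\<forall>x\<in>D. real M * x \<in> E)"
proof -
  obtain S where S: "finite S" "S \<subseteq> transl ` D" "\<And>K. line_group K \<Longrightarrow> S \<subseteq> K \<Longrightarrow> transl ` D \<subseteq> K"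
    using fin_genE[OF fg] by metis
  obtain S' where S': "finite S'" "S' \<subseteq> D" "S = transl ` S'"
    using finite_subset_image[OF S(1,2)] by blast
  obtain m where m: "\<And>x. x \<in> S' \<Longrightarrow> m x \<ge> (1::nat) \<and> real (m x) * x \<in> E"
    using assms(3) S'(2) by (metis subsetD)
  define M where "M = (\<Prod>x\<in>S'. m x)"
  have "M \<ge> 1" unfolding M_def using m by (intro prod_ge_1) auto
  have ME: "real M * x \<in> E" if "x \<in> S'" for x
  proof -
    have "M = m x * (\<Prod>y\<in>S' - {x}. m y)" unfolding M_def by (rule prod.remove[OF S'(1) that])
    then have "real M * x = of_int (int (\<Prod>y\<in>S' - {x}. m y)) * (real (m x) * x)" by simp
    then show ?thesis using real_subgroup_int_mult[OF E] m[OF that] by (simp only:)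
  qed
  have "real_subgroup {x. real M * x \<in> E}"
    using E unfolding real_subgroup_def by (auto simp: distrib_left)
  then have "line_group (transl ` {x. real M * x \<in> E})" by (rule line_group_transl)
  moreover have "S \<subseteq> transl ` {x. real M * x \<in> E}" using S'(3) ME by auto
  ultimately have "transl ` D \<subseteq> transl ` {x. real M * x \<in> E}" using S(3) by blast
  then have "x \<in> {x. real M * x \<in> E}" if "x \<in> D" for x using that by auto
  then show ?thesis using \<open>M \<ge> 1\<close> by blast
qed

lemma independent_element_exists:
  assumes D: "real_subgroup D" "fin_gen (transl ` D)" "\<And>a b. a < b \<Longrightarrow> \<exists>x\<in>D. a < x \<and> x < b"
    and c: "c \<noteq> 0"
  shows "\<exists>b\<in>D. independent2 b c"
proof (rule ccontr)
  assume no: "\<not> ?thesis"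
  let ?E = "{of_int n * c |n::int. True}"
  have "lattice2 0 c = ?E" by (auto simp: lattice2_def)
  then have E: "real_subgroup ?E" using real_subgroup_lattice2[of 0 c] by simp
  have "\<exists>m::nat. m \<ge> 1 \<and> real m * x \<in> ?E" if "x \<in> D" for x
  proof -
    obtain i j :: int where ij: "of_int i * x + of_int j * c = 0" "i \<noteq> 0 \<or> j \<noteq> 0"
      using no \<open>x \<in> D\<close> unfolding independent2_def by blast
    then have "i \<noteq> 0" using c by auto
    have "real (nat \<bar>i\<bar>) * x = of_int (- sgn i * j) * c"
      using ij(1) by (cases "i > 0") (auto simp: sgn_if abs_if algebra_simps)
    then have "real (nat \<bar>i\<bar>) * x \<in> ?E" by blast
    then show ?thesis using \<open>i \<noteq> 0\<close> by (intro exI[of _ "nat \<bar>i\<bar>"]) auto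
  qed
  then obtain M :: nat where M: "M \<ge> 1" "\<And>x. x \<in> D \<Longrightarrow> real M * x \<in> ?E"
    using common_multiplier[OF D(2) E] by blast
  obtain x where x: "x \<in> D" "0 < x" "x < \<bar>c\<bar> / real M"
    using D(3)[of 0 "\<bar>c\<bar> / real M"] c M(1) by auto
  obtain n :: int where n: "real M * x = of_int n * c" using M(2)[OF x(1)] by blast
  have "0 < real M * x" "real M * x < \<bar>c\<bar>" using x M(1) by (auto simp: field_simps)
  then have "0 < \<bar>of_int n\<bar> * \<bar>c\<bar>" "\<bar>of_int n\<bar> * \<bar>c\<bar> < 1 * \<bar>c\<bar>" by (auto simp: n abs_mult[symmetric])
  then have "(0::real) < \<bar>of_int n\<bar>" "\<bar>of_int n\<bar> < (1::real)"
    using c by (auto simp only: mult_less_cancel_right zero_less_mult_iff)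
  then have "0 < \<bar>n\<bar>" "\<bar>n\<bar> < 1" by simp_all
  then show False by simp
qed

lemma least_positive_int:
  assumes "P (n::int)" "n > 0"
  obtains m where "P m" "m > 0" "\<And>k. P k \<Longrightarrow> k > 0 \<Longrightarrow> m \<le> k"
proof -
  define m where "m = (LEAST k::nat. k > 0 \<and> P (int k))"
  have ex: "nat n > 0 \<and> P (int (nat n))" using assms by simp
  have "m > 0 \<and> P (int m)" unfolding m_def by (rule LeastI[of _ "nat n"]) (rule ex)
  moreover have "int m \<le> k" if "P k" "k > 0" for k
  proof -
    have "m \<le> nat k" unfolding m_def by (rule Least_le) (use that in simp)
    then show ?thesis using that by simp
  qed
  ultimately show ?thesis using that[of "int m"] by simp
qed

text \<open>The usual basis of a lattice in the plane: the element with the smallest positive second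
  coordinate, and the element with second coordinate zero and the smallest positive first
  coordinate.\<close>

lemma lattice2_of_commensurable:
  assumes D: "real_subgroup D" and bc: "b \<in> D" "c \<in> D" "independent2 b c"
    and M: "(M::nat) \<ge> 1" "\<And>x. x \<in> D \<Longrightarrow> real M * x \<in> lattice2 b c"
  shows "\<exists>p q. p > 0 \<and> independent2 p q \<and> D = lattice2 p q"
proof -
  have ind: "i = 0 \<and> j = 0" if "of_int i * b + of_int j * c = 0" for i j :: int
    using independent2D[OF bc(3) that] by blast
  let ?P = "\<lambda>j. \<exists>x\<in>D. \<exists>i::int. real M * x = of_int i * b + of_int j * c"
  have "?P (int M)" using bc(2) by (intro bexI[of _ c] exI[of _ 0]) auto
  then obtain j0 where j0: "?P j0" "j0 > 0" "\<And>k. ?P k \<Longrightarrow> k > 0 \<Longrightarrow> j0 \<le> k"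
    using least_positive_int[of ?P "int M"] M(1) by auto
  let ?Q = "\<lambda>i. \<exists>x\<in>D. real M * x = of_int i * b"
  have "?Q (int M)" using bc(1) by (intro bexI[of _ b]) auto
  then obtain i0 where i0: "?Q i0" "i0 > 0" "\<And>k. ?Q k \<Longrightarrow> k > 0 \<Longrightarrow> i0 \<le> k"
    using least_positive_int[of ?Q "int M"] M(1) by auto
  obtain q i1 where q: "q \<in> D" "real M * q = of_int i1 * b + of_int j0 * c" using j0(1) by blast
  obtain p where p: "p \<in> D" "real M * p = of_int i0 * b" using i0(1) by blast
  have sub: "x - of_int n * y \<in> D" if "x \<in> D" "y \<in> D" for x y and n :: int
  proof -
    have "x + of_int (- n) * y \<in> D"
      using that(1) real_subgroup_int_mult[OF D that(2), of "- n"] D unfolding real_subgroup_def by blast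
    then show ?thesis by simp
  qed
  have span: "D = lattice2 p q"
  proof (rule equalityI; rule subsetI)
    fix x assume x: "x \<in> D"
    obtain i j where ij: "real M * x = of_int i * b + of_int j * c"
      using M(2)[OF x] by (auto simp: lattice2_def)
    define n where "n = j div j0"
    define y where "y = x - of_int n * q"
    have y: "y \<in> D" using sub[OF x q(1)] by (simp add: y_def)
    have yM: "real M * y = of_int (i - n * i1) * b + of_int (j mod j0) * c"
    proof -
      have "real M * y = real M * x - of_int n * (real M * q)" by (simp add: y_def algebra_simps)
      also have "\<dots> = of_int (i - n * i1) * b + of_int (j - n * j0) * c"
        by (simp only: ij q(2)) (simp add: algebra_simps)
      also have "j - n * j0 = j mod j0" by (simp add: n_def minus_div_mult_eq_mod)
      finally show ?thesis .
    qed
    have "?P (j mod j0)" using y yM by blast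
    then have "j mod j0 = 0" using j0(2,3) pos_mod_bound[OF j0(2), of j] pos_mod_sign[OF j0(2), of j]
      by (metis linorder_not_less order_le_imp_less_or_eq)
    then have yM: "real M * y = of_int (i - n * i1) * b" using yM by simp
    define k where "k = i - n * i1"
    define m where "m = k div i0"
    define z where "z = y - of_int m * p"
    have z: "z \<in> D" using sub[OF y p(1)] by (simp add: z_def)
    have zM: "real M * z = of_int (k mod i0) * b"
    proof -
      have "real M * z = real M * y - of_int m * (real M * p)" by (simp add: z_def algebra_simps)
      also have "\<dots> = of_int (k - m * i0) * b"
        by (simp only: yM p(2)) (simp add: k_def algebra_simps)
      also have "k - m * i0 = k mod i0" by (simp add: m_def minus_div_mult_eq_mod)
      finally show ?thesis .
    qed
    then have "?Q (k mod i0)" using z by blast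
    then have "k mod i0 = 0" using i0(2,3) pos_mod_bound[OF i0(2), of k] pos_mod_sign[OF i0(2), of k]
      by (metis linorder_not_less order_le_imp_less_or_eq)
    then have "z = 0" using zM M(1) by simp
    then have "x = of_int m * p + of_int n * q" by (simp add: z_def y_def)
    then show "x \<in> lattice2 p q" by (auto simp: lattice2_def)
  next
    fix x assume "x \<in> lattice2 p q"
    then show "x \<in> D" using lattice2_subset[OF D p(1) q(1)] by blast
  qed
  have indep: "independent2 p q"
    unfolding independent2_def
  proof (intro allI impI)
    fix i j :: int assume 0: "of_int i * p + of_int j * q = 0"
    have "of_int (i * i0 + j * i1) * b + of_int (j * j0) * c = of_int i * (real M * p) + of_int j * (real M * q)"
      by (simp only: p(2) q(2)) (simp add: algebra_simps)
    also have "\<dots> = real M * (of_int i * p + of_int j * q)" by (simp add: algebra_simps)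
    finally have "i * i0 + j * i1 = 0 \<and> j * j0 = 0" by (intro ind) (simp only: 0 mult_zero_right)
    then show "i = 0 \<and> j = 0" using i0(2) j0(2) by auto
  qed
  show ?thesis
  proof (cases "p > 0")
    case True
    then show ?thesis using span indep by blast
  next
    case False
    have "p \<noteq> 0"
    proof
      assume "p = 0"
      then have "of_int 1 * p + of_int 0 * q = 0" by simp
      then show False using independent2D(1)[OF indep, of 1 0] by simp
    qed
    moreover have "lattice2 (- p) q = lattice2 p q"
    proof (rule equalityI)
      have "- p \<in> lattice2 p q" "p \<in> lattice2 (- p) q"
        using lattice2_basis(1)[of p q] lattice2_basis(1)[of "- p" q] real_subgroup_lattice2
        unfolding real_subgroup_def by force+
      then show "lattice2 (- p) q \<subseteq> lattice2 p q" "lattice2 p q \<subseteq> lattice2 (- p) q"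
        using lattice2_subset[OF real_subgroup_lattice2 _ lattice2_basis(2)] by blast+
    qed
    moreover have "independent2 (- p) q"
      unfolding independent2_def
    proof (intro allI impI)
      fix i j :: int assume "of_int i * (- p) + of_int j * q = 0"
      then have "of_int (- i) * p + of_int j * q = 0" by simp
      then show "i = 0 \<and> j = 0" using independent2D[OF indep, of "- i" j] by simp
    qed
    moreover have "- p > 0" using False \<open>p \<noteq> 0\<close> by simp
    ultimately show ?thesis using span by metis
  qed
qed

section \<open>Classification on the line\<close>

lemma generate_two_translations:
  "generate Homeo_plus_R {transl b, transl c} = transl ` lattice2 b c"
proof (rule generate_Homeo_plus_R_eq)
  show "line_group (transl ` lattice2 b c)" by (rule line_group_transl[OF real_subgroup_lattice2])
  show "{transl b, transl c} \<subseteq> transl ` lattice2 b c" using lattice2_basis by blast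
  fix K assume K: "line_group K" "{transl b, transl c} \<subseteq> K"
  show "transl ` lattice2 b c \<subseteq> K"
  proof
    fix u assume "u \<in> transl ` lattice2 b c"
    then obtain i j :: int where u: "u = transl (of_int i * b + of_int j * c)" by (auto simp: lattice2_def)
    have "transl (of_int i * b) \<in> K" "transl (of_int j * c) \<in> K"
      using line_group_transl_int_mult[OF K(1)] K(2) by auto
    then show "u \<in> K" using line_groupD(3)[OF K(1)] by (simp add: u transl_comp[symmetric])
  qed
qed

lemma G_line_2: "G_line h \<alpha> 2 = transl ` lattice2 1 \<alpha>"
  unfolding numeral_2_eq_2 G_line.simps generate_two_translations ..

lemma (in unit_interval_coordinate) G_line_Suc:
  assumes "d \<ge> 2" "line_group (G_line h \<alpha> d)"
  shows "G_line h \<alpha> (Suc d) = ascend (G_line h \<alpha> d)"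
proof -
  define m where "m = d - 2"
  have d: "d = Suc (Suc m)" using assms(1) by (simp add: m_def)
  have "generate Homeo_plus_R (hbar h ` G_line h \<alpha> d \<union> {transl 1}) = ascend (G_line h \<alpha> d)"
  proof (rule generate_Homeo_plus_R_eq)
    show "line_group (ascend (G_line h \<alpha> d))" by (rule line_group_ascend[OF assms(2)])
    show "hbar h ` G_line h \<alpha> d \<union> {transl 1} \<subseteq> ascend (G_line h \<alpha> d)"
      using transl_in_ascend[OF assms(2), of 1] by (auto simp: hbar_in_ascend)
    fix K assume K: "line_group K" "hbar h ` G_line h \<alpha> d \<union> {transl 1} \<subseteq> K"
    have "transl (of_int i) \<in> K" for i
      using line_group_transl_int_mult[OF K(1), of 1 i] K(2) by simp
    then show "ascend (G_line h \<alpha> d) \<subseteq> K"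
      using K line_groupD(3)[OF K(1)] unfolding ascend_def by blast
  qed
  then show ?thesis by (simp add: d)
qed

lemma line_group_G_line:
  assumes "d \<ge> 2" "unit_interval_coordinate h"
  shows "line_group (G_line h \<alpha> d)"
  using assms(1)
proof (induction d rule: dec_induct)
  case base
  then show ?case unfolding G_line_2 by (rule line_group_transl[OF real_subgroup_lattice2])
next
  case (step d)
  interpret unit_interval_coordinate h by (rule assms(2))
  show ?case using G_line_Suc[OF step(1) step(3)] line_group_ascend[OF step(3)] by simp
qed

lemma free_basis_lattice2:
  assumes "independent2 b c"
  shows "free_basis (transl ` lattice2 b c) 2 (\<lambda>v. transl (of_int (v 0) * b + of_int (v 1) * c))"
  unfolding free_basis_def
proof (intro conjI ballI)
  show "inj_on (\<lambda>v. transl (of_int (v 0) * b + of_int (v 1) * c)) (int_vectors 2)"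
  proof (rule inj_onI)
    fix v w :: "nat \<Rightarrow> int"
    assume vw: "v \<in> int_vectors 2" "w \<in> int_vectors 2"
      "transl (of_int (v 0) * b + of_int (v 1) * c) = transl (of_int (w 0) * b + of_int (w 1) * c)"
    have "of_int (v 0 - w 0) * b + of_int (v 1 - w 1) * c = 0" using vw(3) by (simp add: algebra_simps)
    then have eq: "v 0 = w 0" "v 1 = w 1" using independent2D[OF assms, of "v 0 - w 0" "v 1 - w 1"] by simp_all
    show "v = w"
    proof
      fix i show "v i = w i"
      proof (cases "i \<ge> 2")
        case True then show ?thesis using vw(1,2) by (simp add: int_vectors_def)
      next
        case False
        then have "i = 0 \<or> i = 1" by auto
        then show ?thesis using eq by auto
      qed
    qed
  qed
  show "(\<lambda>v. transl (of_int (v 0) * b + of_int (v 1) * c)) ` int_vectors 2 = transl ` lattice2 b c"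
  proof (rule equalityI; rule subsetI)
    fix u assume "u \<in> (\<lambda>v. transl (of_int (v 0) * b + of_int (v 1) * c)) ` int_vectors 2"
    then show "u \<in> transl ` lattice2 b c" by (auto simp: lattice2_def)
  next
    fix u assume "u \<in> transl ` lattice2 b c"
    then obtain i j :: int where u: "u = transl (of_int i * b + of_int j * c)" by (auto simp: lattice2_def)
    let ?v = "\<lambda>k::nat. if k = 0 then i else if k = 1 then j else 0"
    have "?v \<in> int_vectors 2" by (auto simp: int_vectors_def)
    then show "u \<in> (\<lambda>v. transl (of_int (v 0) * b + of_int (v 1) * c)) ` int_vectors 2"
      by (intro image_eqI[of _ _ ?v]) (simp_all add: u)
  qed
qed (simp add: transl_comp algebra_simps)

definition classified :: "(real \<Rightarrow> real) \<Rightarrow> (real \<Rightarrow> real) set \<Rightarrow> bool" where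
  "classified h H \<longleftrightarrow> (\<exists>\<alpha> d \<xi> \<rho>. \<alpha> \<in> {0<..<1} \<and> \<alpha> \<notin> \<rat> \<and> d \<ge> 2 \<and> \<xi> \<in> line_homeos \<and>
     conj_by \<xi> ` H = G_line h \<alpha> d \<and> free_basis H d \<rho>)"

lemma classified_conj:
  assumes \<psi>: "\<psi> \<in> line_homeos" and "classified h (conj_by \<psi> ` H)"
  shows "classified h H"
proof -
  obtain \<alpha> d \<xi> \<rho> where c: "\<alpha> \<in> {0<..<1}" "\<alpha> \<notin> \<rat>" "d \<ge> 2" "\<xi> \<in> line_homeos"
    "conj_by \<xi> ` conj_by \<psi> ` H = G_line h \<alpha> d" "free_basis (conj_by \<psi> ` H) d \<rho>"
    using assms(2) unfolding classified_def by blast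
  have "conj_by (\<xi> \<circ> \<psi>) ` H = G_line h \<alpha> d" using c(4,5) \<psi> by (simp add: conj_by_image_image)
  then show ?thesis
    unfolding classified_def using c(1-4) \<psi> free_basis_conj[OF \<psi> c(6)] line_homeos_comp[OF c(4) \<psi>] by blast
qed

lemma classified_lattice2:
  assumes pq: "p > 0" "independent2 p q"
  shows "classified h (transl ` lattice2 p q)"
proof -
  let ?\<beta> = "q / p"
  let ?\<alpha> = "frac ?\<beta>"
  have irr: "?\<beta> \<notin> \<rat>"
  proof
    assume "?\<beta> \<in> \<rat>"
    then obtain m n :: int where mn: "n \<noteq> 0" "?\<beta> = of_int m / of_int n"
      by (metis Rats_cases' less_irrefl)
    then have "of_int m * p + of_int (- n) * q = 0" using pq(1) by (simp add: field_simps)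
    then show False using independent2D(2)[OF pq(2), of m "- n"] mn(1) by simp
  qed
  have a_irr: "?\<alpha> \<notin> \<rat>"
  proof
    assume "?\<alpha> \<in> \<rat>"
    then have "?\<alpha> + of_int \<lfloor>?\<beta>\<rfloor> \<in> \<rat>" by simp
    then show False using irr by (simp add: frac_def)
  qed
  have "?\<alpha> \<noteq> 0" using a_irr by (metis Rats_0)
  then have \<alpha>: "?\<alpha> \<in> {0<..<1}" using frac_ge_0[of ?\<beta>] frac_lt_1[of ?\<beta>] by auto
  define \<xi> where "\<xi> x = x / p" for x
  have \<xi>: "\<xi> \<in> line_homeos"
  proof (rule line_homeosI)
    show "\<xi> x < \<xi> y" if "x < y" for x y using that pq(1) by (simp add: \<xi>_def divide_strict_right_mono)
    show "\<exists>x. \<xi> x = y" for y using pq(1) by (intro exI[of _ "y * p"]) (simp add: \<xi>_def)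
  qed
  have ct: "conj_by \<xi> (transl x) = transl (x / p)" for x
  proof
    fix y
    have "conj_by \<xi> (transl x) (\<xi> (y * p)) = \<xi> (transl x (y * p))" using \<xi> by simp
    then show "conj_by \<xi> (transl x) y = transl (x / p) y"
      using pq(1) by (simp add: \<xi>_def transl_def field_simps)
  qed
  have "(\<lambda>x. x / p) ` lattice2 p q = lattice2 1 ?\<alpha>"
  proof (rule equalityI; rule subsetI)
    fix y assume "y \<in> (\<lambda>x. x / p) ` lattice2 p q"
    then obtain i j :: int where "y = (of_int i * p + of_int j * q) / p" by (auto simp: lattice2_def)
    then have "y = of_int (i + j * \<lfloor>?\<beta>\<rfloor>) * 1 + of_int j * ?\<alpha>"
      using pq(1) by (simp add: frac_def field_simps)
    then show "y \<in> lattice2 1 ?\<alpha>" unfolding lattice2_def by blast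
  next
    fix y assume "y \<in> lattice2 1 ?\<alpha>"
    then obtain i j :: int where "y = of_int i * 1 + of_int j * ?\<alpha>" unfolding lattice2_def by blast
    then have "y = (of_int (i - j * \<lfloor>?\<beta>\<rfloor>) * p + of_int j * q) / p"
      using pq(1) by (simp add: frac_def field_simps)
    then show "y \<in> (\<lambda>x. x / p) ` lattice2 p q" unfolding lattice2_def by blast
  qed
  moreover have "conj_by \<xi> ` transl ` lattice2 p q = transl ` (\<lambda>x. x / p) ` lattice2 p q"
    by (simp only: image_image ct)
  ultimately have "conj_by \<xi> ` transl ` lattice2 p q = G_line h ?\<alpha> 2" unfolding G_line_2 by simp
  then show ?thesis
    unfolding classified_def using \<alpha> a_irr \<xi> free_basis_lattice2[OF pq(2)] by blast
qed

text \<open>Two independent translations already act transitively, and \<open>\<gamma>\<close> can be taken for one of them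
  unless it is trivial. Tightness makes the group commensurable with the lattice that they span.\<close>

lemma tight_translations_rank_two:
  assumes "tame (transl ` D)" "\<gamma> \<in> transl ` D" "tight_rel (transl ` D) \<gamma>"
  shows "\<exists>p q. p > 0 \<and> independent2 p q \<and> D = lattice2 p q"
proof -
  note T = tameD[OF assms(1)]
  have D: "real_subgroup D" using T(1) by (rule real_subgroup_transl)
  have dense: "\<exists>x\<in>D. a < x \<and> x < b" if "a < b" for a b
    using dense_of_interval_transitive_transl[OF T(4) that] .
  obtain x0 where x0: "x0 \<in> D" "\<gamma> = transl x0" using assms(2) by blast
  obtain c where c: "c \<in> D" "c \<noteq> 0" "x0 = c \<or> x0 = 0"
  proof (cases "x0 = 0")
    case True then show ?thesis using that dense[of 0 1] by force
  qed (use x0(1) that in blast)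
  obtain b where b: "b \<in> D" "independent2 b c"
    using independent_element_exists[OF D T(3) dense c(2)] by blast
  let ?E = "lattice2 b c"
  have E: "real_subgroup ?E" "?E \<subseteq> D" using real_subgroup_lattice2 lattice2_subset[OF D b(1) c(1)] by auto
  have "x0 \<in> ?E" using c(3) lattice2_basis[of c b] E(1) by (auto simp: real_subgroup_def)
  then have "line_group (transl ` ?E) \<and> transl ` ?E \<subseteq> transl ` D \<and> \<gamma> \<in> transl ` ?E \<and> interval_transitive (transl ` ?E)"
    using E x0(2) line_group_transl interval_transitive_transl lattice2_dense[OF b(2)] by blast
  then have comm: "\<forall>u\<in>transl ` D. \<exists>m\<ge>1. u ^^ m \<in> transl ` ?E"
    using assms(3) unfolding tight_rel_def by blast
  have "\<exists>m::nat. m \<ge> 1 \<and> real m * x \<in> ?E" if x: "x \<in> D" for x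
  proof -
    obtain m where "m \<ge> 1" "transl x ^^ m \<in> transl ` ?E" using comm x by blast
    then show ?thesis by (intro exI[of _ m]) (auto simp: funpow_transl)
  qed
  then obtain M :: nat where M: "M \<ge> 1" "\<And>x. x \<in> D \<Longrightarrow> real M * x \<in> ?E"
    using common_multiplier[OF T(3) E(1)] by blast
  show ?thesis by (rule lattice2_of_commensurable[OF D b(1) c(1) b(2) M])
qed

text \<open>Induction on the number of coordinates: either the group consists of translations, or the
  stabilizer of an orbit point acts on the fundamental interval, where it is again tame and tight
  but has smaller rank.\<close>

theorem tame_classification:
  assumes h: "unit_interval_coordinate h"
    and "finite A" "tame H" "\<gamma> \<in> H" "tight_rel H \<gamma>" "coordinates_on H A \<kappa>"
  shows "classified h H"
  using assms(2-)
proof (induction "card A" arbitrary: A H \<gamma> \<kappa> rule: less_induct)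
  case less
  interpret unit_interval_coordinate h by (rule h)
  show ?case using less.prems(2)
  proof (cases rule: tame_structure)
    case (translational \<psi> D)
    obtain p q where "p > 0" "independent2 p q" "D = lattice2 p q"
      using tight_translations_rank_two[of D "conj_by \<psi> \<gamma>"] tame_conj[OF translational(1) less.prems(2)] tight_rel_conj[OF translational(1) less.prems(4)]
        imageI[OF less.prems(3), of "conj_by \<psi>"]
      unfolding translational(2) by blast
    then have "classified h (conj_by \<psi> ` H)" using classified_lattice2 translational(2) by simp
    then show ?thesis by (rule classified_conj[OF translational(1)])
  next
    case (integral \<psi>)
    let ?H = "conj_by \<psi> ` H"
    have int0: "\<forall>u\<in>?H. u 0 \<in> \<int>" using integral(3) by blast
    have tame: "tame ?H" using tame_conj[OF integral(1) less.prems(2)] .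
    note T = tameD[OF tame]
    have asc: "ascend (descend ?H) = ?H" by (rule ascend_descend[OF T(1,2) integral(2) int0])
    have "conj_by \<psi> \<gamma> \<in> ascend (descend ?H)" unfolding asc using less.prems(3) by (rule imageI)
    then obtain k \<gamma>' where \<gamma>': "\<gamma>' \<in> descend ?H" "conj_by \<psi> \<gamma> = transl (of_int k) \<circ> hbar h \<gamma>'"
      unfolding ascend_def by blast
    have tight: "tight_rel (descend ?H) \<gamma>'"
      using tight_rel_conj[OF integral(1) less.prems(4)] unfolding \<gamma>'(2)
      by (rule tight_rel_descend[OF T(1,2) integral(2) int0])
    obtain j \<kappa>' where \<kappa>': "j \<in> A" "coordinates_on (descend ?H) (A - {j}) \<kappa>'"
      using coordinates_on_descend[OF T(1) integral(2) coordinates_on_conj[OF integral(1) less.prems(5)]]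
      by blast
    have "card (A - {j}) < card A" using \<kappa>'(1) less.prems(1) by (rule card_Diff1_less[rotated])
    then have "classified h (descend ?H)"
      using less.hyps[OF _ _ tame_descend[OF tame integral(2) int0] \<gamma>'(1) tight \<kappa>'(2)] less.prems(1) by blast
    then obtain \<alpha> d \<xi> \<rho> where c: "\<alpha> \<in> {0<..<1}" "\<alpha> \<notin> \<rat>" "d \<ge> 2" "\<xi> \<in> line_homeos"
      "conj_by \<xi> ` descend ?H = G_line h \<alpha> d" "free_basis (descend ?H) d \<rho>"
      unfolding classified_def by blast
    have "conj_by (hbar h \<xi>) ` ?H = ascend (conj_by \<xi> ` descend ?H)"
      using conj_ascend[OF c(4)] asc by metis
    also have "\<dots> = G_line h \<alpha> (Suc d)"
      using G_line_Suc[OF c(3) line_group_G_line[OF c(3) h]] c(5) by simp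
    finally have "conj_by (hbar h \<xi>) ` ?H = G_line h \<alpha> (Suc d)" .
    moreover have "free_basis ?H (Suc d) (\<lambda>v. transl (of_int (v d)) \<circ> hbar h (\<rho> (v(d := 0))))"
      using free_basis_ascend[OF c(6)] asc by simp
    ultimately have "classified h ?H"
      unfolding classified_def using c(1-3) hbar_line_homeos[OF c(4)] le_SucI by blast
    then show ?thesis by (rule classified_conj[OF integral(1)])
  qed
qed

section \<open>Integer vectors\<close>

text \<open>Gaussian elimination without division.\<close>

lemma int_vectors_dependent:
  fixes v :: "nat \<Rightarrow> nat \<Rightarrow> int"
  assumes "finite A" "d < card A"
  shows "\<exists>c. (\<exists>i\<in>A. c i \<noteq> 0) \<and> (\<forall>j<d. (\<Sum>i\<in>A. c i * v i j) = 0)"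
  using assms
proof (induction d arbitrary: A v)
  case 0
  then have "A \<noteq> {}" by auto
  then show ?case by (intro exI[of _ "\<lambda>_. 1"]) auto
next
  case (Suc d)
  show ?case
  proof (cases "\<forall>i\<in>A. v i d = 0")
    case True
    obtain c where c: "\<exists>i\<in>A. c i \<noteq> 0" "\<forall>j<d. (\<Sum>i\<in>A. c i * v i j) = 0"
      using Suc.IH[of A v] Suc.prems by auto
    have "(\<Sum>i\<in>A. c i * v i d) = 0" using True by (intro sum.neutral) auto
    then show ?thesis using c by (intro exI[of _ c]) (auto simp: less_Suc_eq)
  next
    case False
    then obtain p where p: "p \<in> A" "v p d \<noteq> 0" by blast
    let ?A = "A - {p}"
    define w where "w i j = v p d * v i j - v i d * v p j" for i j
    have "finite ?A" "d < card ?A" using Suc.prems p(1) by auto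
    then obtain c where c: "\<exists>i\<in>?A. c i \<noteq> 0" "\<forall>j<d. (\<Sum>i\<in>?A. c i * w i j) = 0"
      using Suc.IH[of ?A w] by blast
    define b where "b i = (if i = p then - (\<Sum>i\<in>?A. c i * v i d) else v p d * c i)" for i
    have "(\<Sum>i\<in>A. b i * v i j) = (\<Sum>i\<in>?A. c i * w i j)" for j
    proof -
      have "(\<Sum>i\<in>A. b i * v i j) = b p * v p j + (\<Sum>i\<in>?A. b i * v i j)"
        by (rule sum.remove[OF Suc.prems(1) p(1)])
      also have "(\<Sum>i\<in>?A. b i * v i j) = (\<Sum>i\<in>?A. v p d * c i * v i j)"
        by (intro sum.cong) (auto simp: b_def)
      finally have eq: "(\<Sum>i\<in>A. b i * v i j) = b p * v p j + (\<Sum>i\<in>?A. v p d * c i * v i j)" .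
      show ?thesis
        unfolding eq by (simp add: b_def w_def sum_distrib_left sum_subtractf algebra_simps)
    qed
    moreover have "w i d = 0" for i by (simp add: w_def)
    ultimately have "\<forall>j<Suc d. (\<Sum>i\<in>A. b i * v i j) = 0" using c(2) by (auto simp: less_Suc_eq)
    moreover have "\<exists>i\<in>A. b i \<noteq> 0" using c(1) p(2) by (auto simp: b_def)
    ultimately show ?thesis by blast
  qed
qed

definition additive_on :: "nat \<Rightarrow> ((nat \<Rightarrow> int) \<Rightarrow> nat \<Rightarrow> int) \<Rightarrow> bool" where
  "additive_on d \<mu> \<longleftrightarrow>
     (\<forall>v\<in>int_vectors d. \<forall>w\<in>int_vectors d. \<forall>l. \<mu> (\<lambda>i. v i + w i) l = \<mu> v l + \<mu> w l)"

lemma additive_on_mult: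
  assumes "additive_on d \<mu>" "v \<in> int_vectors d"
  shows "\<mu> (\<lambda>i. c * v i) l = c * \<mu> v l"
proof -
  have in_d: "(\<lambda>i. k * v i) \<in> int_vectors d" for k using assms(2) by (simp add: int_vectors_def)
  have add: "\<mu> (\<lambda>i. (k + m) * v i) l = \<mu> (\<lambda>i. k * v i) l + \<mu> (\<lambda>i. m * v i) l" for k m
    using assms(1) in_d unfolding additive_on_def by (simp add: distrib_right)
  show ?thesis
  proof (induction c rule: int_induct[where k = 0])
    case base then show ?case using add[of 0 0] by simp
  next
    case (step1 i) then show ?case using add[of i 1] by (simp add: distrib_right)
  next
    case (step2 i) then show ?case using add[of "i - 1" 1] by (simp add: left_diff_distrib)
  qed
qed

lemma additive_on_sum:
  assumes \<mu>: "additive_on d \<mu>" and "finite A" and w: "\<And>i. i \<in> A \<Longrightarrow> w i \<in> int_vectors d"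
  shows "\<mu> (\<lambda>j. \<Sum>i\<in>A. c i * w i j) l = (\<Sum>i\<in>A. c i * \<mu> (w i) l)"
  using assms(2) w
proof (induction A rule: finite_induct)
  case empty
  have "(\<lambda>_. 0) \<in> int_vectors d" by (simp add: int_vectors_def)
  then show ?case using additive_on_mult[OF \<mu>, of "\<lambda>_. 0" 0 l] by simp
next
  case (insert a A)
  have "(\<lambda>j. c a * w a j) \<in> int_vectors d" "(\<lambda>j. \<Sum>i\<in>A. c i * w i j) \<in> int_vectors d"
    using insert.prems by (auto simp: int_vectors_def intro!: sum.neutral)
  then have "\<mu> (\<lambda>j. c a * w a j + (\<Sum>i\<in>A. c i * w i j)) l
      = \<mu> (\<lambda>j. c a * w a j) l + \<mu> (\<lambda>j. \<Sum>i\<in>A. c i * w i j) l"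
    by (rule \<mu>[unfolded additive_on_def, rule_format])
  then show ?case using insert additive_on_mult[OF \<mu>, of "w a" "c a" l] by simp
qed

lemma additive_injective_le:
  assumes \<mu>: "additive_on a \<mu>" "\<And>v. v \<in> int_vectors a \<Longrightarrow> \<mu> v \<in> int_vectors b"
    and inj: "\<And>v. v \<in> int_vectors a \<Longrightarrow> (\<And>l. \<mu> v l = 0) \<Longrightarrow> v = (\<lambda>_. 0)"
  shows "a \<le> b"
proof (rule ccontr)
  assume "\<not> a \<le> b"
  define u where "u i = (\<lambda>j. if j = i then 1 else 0 :: int)" for i :: nat
  have u: "u i \<in> int_vectors a" if "i \<in> {..<a}" for i using that by (auto simp: u_def int_vectors_def)
  obtain c where c: "\<exists>i\<in>{..<a}. c i \<noteq> 0" "\<forall>j<b. (\<Sum>i\<in>{..<a}. c i * \<mu> (u i) j) = 0"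
    using int_vectors_dependent[of "{..<a}" b "\<lambda>i. \<mu> (u i)"] \<open>\<not> a \<le> b\<close> by auto
  let ?v = "\<lambda>j. \<Sum>i\<in>{..<a}. c i * u i j"
  have v: "?v j = (if j < a then c j else 0)" for j
    by (simp add: u_def if_distrib cong: if_cong)
  have va: "?v \<in> int_vectors a" unfolding int_vectors_def using v by auto
  have "\<mu> ?v l = 0" for l
  proof (cases "l < b")
    case True
    then show ?thesis using additive_on_sum[where A = "{..<a}" and c = c and l = l, OF \<mu>(1) finite_lessThan u] c(2) by simp
  next
    case False
    then show ?thesis using \<mu>(2)[OF va] by (simp add: int_vectors_def)
  qed
  then have "?v = (\<lambda>_. 0)" by (rule inj[OF va])
  then have "c j = 0" if "j < a" for j using v[of j] that by (metis (no_types, lifting))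
  then show False using c(1) by auto
qed

text \<open>Below, \<open>t\<close> stands for the deck transformation of the circle: the group of lifts is an extension
  by \<open>t\<close> of the group on the circle, so its rank is larger by one.\<close>

lemma rank_of_cyclic_extension:
  assumes \<mu>: "additive_on d \<mu>" "\<And>v. v \<in> int_vectors d \<Longrightarrow> \<mu> v \<in> int_vectors n"
    and onto: "\<And>w. w \<in> int_vectors n \<Longrightarrow> \<exists>v\<in>int_vectors d. \<mu> v = w"
    and t: "t \<in> int_vectors d" "t \<noteq> (\<lambda>_. 0)" "\<mu> t = (\<lambda>_. 0)"
    and ker: "\<And>v. v \<in> int_vectors d \<Longrightarrow> \<mu> v = (\<lambda>_. 0) \<Longrightarrow> \<exists>m. v = (\<lambda>i. m * t i)"
  shows "d = n + 1"
proof (rule antisym)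
  obtain j where j: "t j \<noteq> 0" using t(2) by auto
  define \<nu> where "\<nu> v = (\<mu> v)(n := v j)" for v
  show "d \<le> n + 1"
  proof (rule additive_injective_le)
    show "additive_on d \<nu>" using \<mu>(1) by (auto simp: additive_on_def \<nu>_def)
    show "\<nu> v \<in> int_vectors (n + 1)" if "v \<in> int_vectors d" for v
      using \<mu>(2)[OF that] by (auto simp: int_vectors_def \<nu>_def)
    fix v assume v: "v \<in> int_vectors d" "\<And>l. \<nu> v l = 0"
    have "\<mu> v l = 0" for l using v(2)[of l] \<mu>(2)[OF v(1)] by (cases "l = n") (auto simp: \<nu>_def int_vectors_def)
    then obtain m where m: "v = (\<lambda>i. m * t i)" using ker[OF v(1)] by blast
    have "m * t j = 0" using v(2)[of n] m by (simp add: \<nu>_def)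
    then show "v = (\<lambda>_. 0)" using j m by simp
  qed
  show "n + 1 \<le> d"
  proof (rule ccontr)
    assume "\<not> n + 1 \<le> d"
    define u where "u i = (\<lambda>j. if j = i then 1 else 0 :: int)" for i :: nat
    have "\<exists>v\<in>int_vectors d. \<mu> v = u i" if "i < n" for i
      using that by (intro onto) (auto simp: u_def int_vectors_def)
    then obtain w where w: "\<And>i. i < n \<Longrightarrow> w i \<in> int_vectors d \<and> \<mu> (w i) = u i" by metis
    define x where "x i = (if i = n then t else w i)" for i
    have x: "x i \<in> int_vectors d" if "i \<in> {..n}" for i using w t(1) that by (auto simp: x_def)
    obtain c where c: "\<exists>i\<in>{..n}. c i \<noteq> 0" "\<forall>j<d. (\<Sum>i\<in>{..n}. c i * x i j) = 0"
      using int_vectors_dependent[of "{..n}" d x] \<open>\<not> n + 1 \<le> d\<close> by auto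
    have zero: "(\<Sum>i\<in>{..n}. c i * x i j) = 0" for j
    proof (cases "j < d")
      case False
      then show ?thesis using x by (intro sum.neutral) (auto simp: int_vectors_def)
    qed (use c(2) in blast)
    have cl: "c l = 0" if l: "l < n" for l
    proof -
      have "0 = \<mu> (\<lambda>j. \<Sum>i\<in>{..n}. c i * x i j) l"
        using additive_on_mult[OF \<mu>(1) t(1), of 0 l] by (simp add: zero)
      also have "\<dots> = (\<Sum>i\<in>{..n}. c i * \<mu> (x i) l)" by (rule additive_on_sum[OF \<mu>(1) _ x]) auto
      also have "\<dots> = (\<Sum>i\<in>{..n}. if i = l then c i else 0)"
        by (intro sum.cong) (use w t(3) l in \<open>auto simp: x_def u_def\<close>)
      also have "\<dots> = c l" using l by simp
      finally show ?thesis by simp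
    qed
    have "(\<Sum>i\<in>{..n}. c i * x i j) = (\<Sum>i\<in>{..n}. if i = n then c i * t j else 0)"
      by (intro sum.cong) (use cl in \<open>auto simp: x_def\<close>)
    then have "c n * t j = 0" using zero by simp
    then have "c n = 0" using j by simp
    then show False using c(1) cl by (metis atMost_iff le_neq_implies_less)
  qed
qed

section \<open>Circle homeomorphisms and their lifts\<close>

definition circ :: "real \<Rightarrow> complex" where
  "circ x = cis (2 * pi * x)"

lemma norm_circ [simp]: "norm (circ x) = 1"
  by (simp add: circ_def)

lemma circ_eq_iff: "circ x = circ y \<longleftrightarrow> x - y \<in> \<int>"
proof -
  have "circ x = circ y \<longleftrightarrow> (\<exists>n::int. 2 * pi * x = 2 * pi * y + 2 * pi * of_int n)"
    using sin_cos_eq_iff[of "2 * pi * x" "2 * pi * y"] by (auto simp: circ_def complex_eq_iff)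
  also have "\<dots> \<longleftrightarrow> (\<exists>n::int. 2 * pi * x = 2 * pi * (y + of_int n))" by (simp only: distrib_left)
  also have "\<dots> \<longleftrightarrow> (\<exists>n::int. x = y + of_int n)" by simp
  also have "\<dots> \<longleftrightarrow> x - y \<in> \<int>" by (auto elim!: Ints_cases simp: algebra_simps)
  finally show ?thesis .
qed

lemma circ_add_int [simp]: "circ (x + of_int n) = circ x" "circ (x + 1) = circ x"
  by (simp_all add: circ_eq_iff)

lemma circ_eqE:
  assumes "circ x = circ y"
  obtains n :: int where "x = y + of_int n"
  using assms by (auto simp: circ_eq_iff elim!: Ints_cases) (metis add.commute diff_add_cancel)

lemma circ_Arg: "z \<in> S1 \<Longrightarrow> circ (Arg z / (2 * pi)) = z"
  by (simp add: circ_def cis_Arg sgn_div_norm) (metis cis_Arg norm_zero sgn_eq zero_neq_one div_by_1 of_real_1)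

lemma circ_surj:
  assumes "z \<in> S1"
  obtains x where "z = circ x" "a \<le> x" "x < a + 1"
proof -
  define y where "y = Arg z / (2 * pi)"
  define n where "n = \<lfloor>y - a\<rfloor>"
  have "a \<le> y - of_int n" "y - of_int n < a + 1" unfolding n_def by linarith+
  moreover have "z = circ (y - of_int n)"
    using circ_Arg[OF assms] circ_add_int(1)[of y "- n"] by (simp add: y_def)
  ultimately show ?thesis using that by blast
qed

lemma continuous_circ: "continuous_on A circ"
  unfolding circ_def by (intro continuous_intros)

definition circle_map :: "(real \<Rightarrow> real) \<Rightarrow> complex \<Rightarrow> complex" where
  "circle_map F = (\<lambda>z\<in>S1. circ (F (Arg z / (2 * pi))))"

lemma circle_map_circ [simp]:
  assumes "F \<in> periodic_homeos"
  shows "circle_map F (circ x) = circ (F x)"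
proof -
  let ?y = "Arg (circ x) / (2 * pi)"
  have "circ x = circ ?y" using circ_Arg[of "circ x"] by simp
  then obtain n where "x = ?y + of_int n" by (rule circ_eqE)
  then have "circ (F x) = circ (F ?y)" using periodic_homeos_int[OF assms, of ?y n] by simp
  then show ?thesis by (simp add: circle_map_def)
qed

lemma circle_map_ext:
  assumes "f \<in> extensional S1" "g \<in> extensional S1" "\<And>x. f (circ x) = g (circ x)"
  shows "f = g"
  using assms circ_Arg by (intro extensionalityI[of f S1 g]) (auto, metis)

lemma circle_map_extensional [simp]: "circle_map F \<in> extensional S1"
  by (simp add: circle_map_def)

lemma norm_circle_map [simp]: "norm z = 1 \<Longrightarrow> norm (circle_map F z) = 1"
  by (simp add: circle_map_def)

text \<open>The circle carries the quotient topology of \<open>[0,1]\<close>.\<close>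

lemma continuous_circle_map:
  assumes F: "F \<in> periodic_homeos"
  shows "continuous_on S1 (circle_map F)"
proof -
  have im: "circ ` {0..1} = S1"
  proof
    show "S1 \<subseteq> circ ` {0..1}"
    proof
      fix z assume "z \<in> S1"
      then obtain x where "z = circ x" "0 \<le> x" "x < 0 + 1" by (rule circ_surj)
      then show "z \<in> circ ` {0..1}" by simp
    qed
  qed auto
  have "quotient_map (top_of_set {0..1}) (top_of_set S1) circ"
    by (rule continuous_imp_quotient_map)
      (use im in \<open>auto simp: continuous_circ compact_space_subtopology Hausdorff_space_subtopology\<close>)
  moreover have "continuous_on {0..1} (\<lambda>x. circ (F x))"
    using continuous_on_compose2[OF continuous_circ continuous_on_subset[OF line_homeos_continuous[OF periodic_homeosD[OF F]]]]
    by blast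
  then have "continuous_map (top_of_set {0..1}) euclidean (circle_map F \<circ> circ)"
    using F by (simp add: comp_def)
  ultimately have "continuous_map (top_of_set S1) euclidean (circle_map F)"
    by (rule continuous_compose_quotient_map)
  then show ?thesis by simp
qed

lemma circle_map_inverse:
  assumes "F \<in> periodic_homeos" "z \<in> S1"
  shows "circle_map (finv F) (circle_map F z) = z" "circle_map F (circle_map (finv F) z) = z"
proof -
  have F: "F \<in> line_homeos" "finv F \<in> periodic_homeos"
    using assms(1) line_groupD(1,4)[OF line_group_periodic_homeos] by auto
  obtain x where "z = circ x" using circ_Arg[OF assms(2)] by metis
  then show "circle_map (finv F) (circle_map F z) = z" "circle_map F (circle_map (finv F) z) = z"
    using assms(1) F by simp_all
qed

lemma circle_map_carrier [simp]:
  assumes F: "F \<in> periodic_homeos"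
  shows "circle_map F \<in> carrier Homeo_plus_S1"
proof -
  have Fl: "F \<in> line_homeos" "finv F \<in> periodic_homeos"
    using F line_groupD(1,4)[OF line_group_periodic_homeos] by auto
  have "z \<in> circle_map F ` S1 \<and> z \<in> circle_map (finv F) ` S1" if "z \<in> S1" for z
    using circle_map_inverse[OF F that] that
      imageI[of "circle_map (finv F) z" S1 "circle_map F"] imageI[of "circle_map F z" S1 "circle_map (finv F)"]
    by simp
  then have "circle_map F ` S1 = S1" "circle_map (finv F) ` S1 = S1" by auto
  then have "homeomorphism S1 S1 (circle_map F) (circle_map (finv F))"
    unfolding homeomorphism_def
    using circle_map_inverse[OF F] continuous_circle_map[OF F] continuous_circle_map[OF Fl(2)] by auto
  moreover define F' where "F' t = 2 * pi * F (t / (2 * pi))" for t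
  have "continuous_on UNIV F'"
    unfolding F'_def by (intro continuous_intros continuous_on_compose2[OF line_homeos_continuous[OF Fl(1)]]) auto
  moreover have "strict_mono F'" using Fl(1) by (simp add: strict_mono_def F'_def divide_strict_right_mono)
  moreover have "F' (t + 2 * pi) = F' t + 2 * pi" for t
  proof -
    have "F ((t + 2 * pi) / (2 * pi)) = F (t / (2 * pi) + of_int 1)" by (simp add: field_simps)
    also have "\<dots> = F (t / (2 * pi)) + of_int 1" by (rule periodic_homeos_int[OF F])
    finally show ?thesis by (simp add: F'_def distrib_left)
  qed
  moreover have "circle_map F (cis t) = cis (F' t)" for t
    using circle_map_circ[OF F, of "t / (2 * pi)"] by (simp add: circ_def F'_def)
  ultimately show ?thesis unfolding Homeo_plus_S1_def by auto
qed

lemma carrier_circle_mapE: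
  assumes "f \<in> carrier Homeo_plus_S1"
  obtains F where "F \<in> periodic_homeos" "f = circle_map F"
proof -
  obtain F' where F': "continuous_on UNIV F'" "strict_mono F'"
      "\<And>t. F' (t + 2 * pi) = F' t + 2 * pi" "\<And>t. f (cis t) = cis (F' t)" and ext: "f \<in> extensional S1"
    using assms unfolding Homeo_plus_S1_def by auto
  define F where "F t = F' (2 * pi * t) / (2 * pi)" for t
  have less: "F x < F y" if "x < y" for x y
    using that F'(2) by (simp add: F_def strict_mono_def divide_strict_right_mono)
  have per: "F (x + 1) = F x + 1" for x
    using F'(3)[of "2 * pi * x"] by (simp add: F_def algebra_simps add_divide_distrib)
  have cont: "continuous_on A F" for A
    unfolding F_def by (intro continuous_intros continuous_on_compose2[OF F'(1)]) auto
  have nat: "F (x + real m) = F x + real m" for x m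
  proof (induction m)
    case (Suc m)
    then show ?case using per[of "x + real m"] by (simp add: add_ac)
  qed simp
  have "\<exists>x. F x = y" for y
  proof -
    obtain m where m: "\<bar>y - F 0\<bar> \<le> real m" using real_arch_simple by blast
    have "F (0 + real m) = F 0 + real m" "F (- real m + real m) = F (- real m) + real m"
      by (rule nat)+
    then have "F (- real m) \<le> y" "y \<le> F (real m)" using m by (auto simp: abs_le_iff)
    then show ?thesis using IVT'[of F "- real m" y "real m"] cont by auto
  qed
  then have F: "F \<in> periodic_homeos"
    using less per line_homeosI[of F] by (simp add: periodic_homeos_def)
  have "f (circ x) = circle_map F (circ x)" for x
    using F F'(4)[of "2 * pi * x"] by simp (simp add: circ_def F_def)
  then have "f = circle_map F" by (rule circle_map_ext[OF ext circle_map_extensional])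
  then show ?thesis using that F by blast
qed

lemma circle_map_Bij:
  assumes "F \<in> periodic_homeos"
  shows "circle_map F \<in> Bij S1"
proof -
  have "bij_betw (circle_map F) S1 S1"
    by (rule bij_betwI[of _ _ _ "circle_map (finv F)"]) (use circle_map_inverse[OF assms] in auto)
  then show ?thesis by (simp add: Bij_def)
qed

lemma circle_map_mult [simp]:
  assumes "F \<in> periodic_homeos" "F' \<in> periodic_homeos"
  shows "circle_map F \<otimes>\<^bsub>Homeo_plus_S1\<^esub> circle_map F' = circle_map (F \<circ> F')"
proof -
  have c: "F \<circ> F' \<in> periodic_homeos" using assms line_groupD(3)[OF line_group_periodic_homeos] by blast
  have "circle_map F \<otimes>\<^bsub>Homeo_plus_S1\<^esub> circle_map F' = compose S1 (circle_map F) (circle_map F')"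
    using assms circle_map_Bij by (simp add: Homeo_plus_S1_def BijGroup_def)
  also have "\<dots> = circle_map (F \<circ> F')"
    by (rule circle_map_ext) (use assms c in \<open>auto simp: compose_def\<close>)
  finally show ?thesis .
qed

lemma circle_map_one: "\<one>\<^bsub>Homeo_plus_S1\<^esub> = circle_map id"
proof -
  have "\<one>\<^bsub>Homeo_plus_S1\<^esub> = (\<lambda>z\<in>S1. z)" by (simp add: Homeo_plus_S1_def BijGroup_def)
  also have "\<dots> = circle_map id"
    by (rule circle_map_ext) (use line_groupD(2)[OF line_group_periodic_homeos] in auto)
  finally show ?thesis .
qed

lemma group_Homeo_plus_S1: "group Homeo_plus_S1"
proof (rule groupI)
  note P = line_groupD[OF line_group_periodic_homeos]
  fix f assume "f \<in> carrier Homeo_plus_S1"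
  then obtain F where F: "F \<in> periodic_homeos" "f = circle_map F" by (rule carrier_circle_mapE)
  show "\<one>\<^bsub>Homeo_plus_S1\<^esub> \<otimes>\<^bsub>Homeo_plus_S1\<^esub> f = f" using F P(2) by (simp add: circle_map_one)
  show "\<exists>g\<in>carrier Homeo_plus_S1. g \<otimes>\<^bsub>Homeo_plus_S1\<^esub> f = \<one>\<^bsub>Homeo_plus_S1\<^esub>"
    using F P(1,4) by (intro bexI[of _ "circle_map (finv F)"]) (simp_all add: circle_map_one)
  fix g assume "g \<in> carrier Homeo_plus_S1"
  then obtain F' where F': "F' \<in> periodic_homeos" "g = circle_map F'" by (rule carrier_circle_mapE)
  show "f \<otimes>\<^bsub>Homeo_plus_S1\<^esub> g \<in> carrier Homeo_plus_S1" using F F' P(3) by simp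
  fix k assume "k \<in> carrier Homeo_plus_S1"
  then obtain F'' where F'': "F'' \<in> periodic_homeos" "k = circle_map F''" by (rule carrier_circle_mapE)
  show "f \<otimes>\<^bsub>Homeo_plus_S1\<^esub> g \<otimes>\<^bsub>Homeo_plus_S1\<^esub> k = f \<otimes>\<^bsub>Homeo_plus_S1\<^esub> (g \<otimes>\<^bsub>Homeo_plus_S1\<^esub> k)"
    using F F' F'' P(3) by (simp add: comp_assoc)
next
  show "\<one>\<^bsub>Homeo_plus_S1\<^esub> \<in> carrier Homeo_plus_S1"
    using line_groupD(2)[OF line_group_periodic_homeos] by (simp add: circle_map_one)
qed

lemma circle_map_inv:
  assumes "F \<in> periodic_homeos"
  shows "inv\<^bsub>Homeo_plus_S1\<^esub> (circle_map F) = circle_map (finv F)"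
  using assms line_groupD(1,4)[OF line_group_periodic_homeos]
  by (intro group.inv_equality[OF group_Homeo_plus_S1]) (simp_all add: circle_map_one)

text \<open>A lift of the identity moves each point by an integer, and the integer cannot jump within a
  fundamental domain because the lift is increasing and gains only \<open>1\<close> along it.\<close>

lemma circle_map_eq_one_iff:
  assumes F: "F \<in> periodic_homeos" and "circle_map F = circle_map id"
  shows "\<exists>m. F = transl (of_int m)"
proof -
  have "circ (F x) = circ x" for x
    using F line_groupD(2)[OF line_group_periodic_homeos] assms(2) by (metis circle_map_circ id_apply)
  then have "\<exists>n. F x = x + of_int n" for x by (metis circ_eqE)
  then obtain N where N: "\<And>x. F x = x + of_int (N x)" by metis
  have "F x = x + of_int (N 0)" for x
  proof -
    let ?y = "frac x"
    have "F 0 \<le> F ?y" "F ?y < F (0 + 1)"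
      using periodic_homeosD[OF F] frac_ge_0[of x] frac_lt_1[of x] by simp_all
    moreover have "F (0 + 1) = F 0 + 1" using periodic_homeos_int[OF F, of 0 1] by simp
    ultimately have "of_int (N 0) \<le> ?y + of_int (N ?y)" "?y + of_int (N ?y) < of_int (N 0) + 1"
      using N[of 0] N[of ?y] by simp_all
    then have "N ?y = N 0" using frac_ge_0[of x] frac_lt_1[of x] by linarith
    then have "F (?y + of_int \<lfloor>x\<rfloor>) = ?y + of_int (N 0) + of_int \<lfloor>x\<rfloor>"
      using periodic_homeos_int[OF F, of ?y "\<lfloor>x\<rfloor>"] N[of ?y] by simp
    then show ?thesis by (simp add: frac_def)
  qed
  then show ?thesis by (intro exI[of _ "N 0"]) (auto simp: transl_def)
qed

lemma circle_map_transl_int [simp]: "circle_map (transl (of_int m)) = circle_map id"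
  by (rule circle_map_ext) (use line_groupD(2)[OF line_group_periodic_homeos] in \<open>auto simp: transl_def\<close>)

lemma circle_map_eqE:
  assumes F: "F \<in> periodic_homeos" "F' \<in> periodic_homeos" and "circle_map F = circle_map F'"
  obtains m where "F = transl (of_int m) \<circ> F'"
proof -
  note P = line_groupD[OF line_group_periodic_homeos]
  have "circle_map (F \<circ> finv F') = circle_map F \<otimes>\<^bsub>Homeo_plus_S1\<^esub> circle_map (finv F')"
    using F P(4) by simp
  also have "\<dots> = circle_map id" using F P(1,4) by (simp add: assms(3))
  finally obtain m where "F \<circ> finv F' = transl (of_int m)"
    using circle_map_eq_one_iff[OF P(3)[OF F(1) P(4)[OF F(2)]]] by blast
  then have "(F \<circ> finv F') \<circ> F' = transl (of_int m) \<circ> F'" by simp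
  then show ?thesis using that P(1)[OF F(2)] by (simp add: comp_assoc)
qed

lemma subgroup_circle_map:
  assumes L: "line_group L" "L \<subseteq> periodic_homeos"
  shows "subgroup (circle_map ` L) Homeo_plus_S1"
proof (rule group.subgroupI[OF group_Homeo_plus_S1])
  note G = line_groupD[OF L(1)]
  show "circle_map ` L \<subseteq> carrier Homeo_plus_S1" using L(2) by auto
  show "circle_map ` L \<noteq> {}" using G(2) by auto
  show "inv\<^bsub>Homeo_plus_S1\<^esub> f \<in> circle_map ` L" if "f \<in> circle_map ` L" for f
    using that L(2) G(4) by (auto simp: circle_map_inv subset_iff)
  show "f \<otimes>\<^bsub>Homeo_plus_S1\<^esub> g \<in> circle_map ` L" if "f \<in> circle_map ` L" "g \<in> circle_map ` L" for f g
    using that L(2) G(3) by (auto simp: subset_iff)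
qed

definition lifts :: "(complex \<Rightarrow> complex) set \<Rightarrow> (real \<Rightarrow> real) set" where
  "lifts G = {F \<in> periodic_homeos. circle_map F \<in> G}"

lemma circle_map_lifts:
  assumes "subgroup G Homeo_plus_S1"
  shows "circle_map ` lifts G = G"
  using subgroup.mem_carrier[OF assms] carrier_circle_mapE unfolding lifts_def by blast

lemma line_group_lifts:
  assumes G: "subgroup G Homeo_plus_S1"
  shows "line_group (lifts G)"
  unfolding line_group_def
proof (intro conjI ballI)
  note P = line_groupD[OF line_group_periodic_homeos]
  show "lifts G \<subseteq> line_homeos" using P(1) by (auto simp: lifts_def)
  show "id \<in> lifts G" using P(2) subgroup.one_closed[OF G] by (simp add: lifts_def circle_map_one)
  show "f \<circ> g \<in> lifts G" if "f \<in> lifts G" "g \<in> lifts G" for f g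
    using that P(3) subgroup.m_closed[OF G, of "circle_map f" "circle_map g"] by (simp add: lifts_def)
  show "finv f \<in> lifts G" if "f \<in> lifts G" for f
    using that P(4) subgroup.m_inv_closed[OF G, of "circle_map f"] by (simp add: lifts_def circle_map_inv)
qed

lemma transl_int_lifts:
  assumes "subgroup G Homeo_plus_S1"
  shows "transl (of_int m) \<in> lifts G"
  using subgroup.one_closed[OF assms] by (simp add: lifts_def circle_map_one)

text \<open>A commutator of lifts is an integer translation, and a nontrivial one would let the displacements
  of the powers of the first lift grow, although they are additive up to a bounded error.\<close>

lemma commuting_lifts:
  assumes comm: "\<And>f g. f \<in> G \<Longrightarrow> g \<in> G \<Longrightarrow> f \<otimes>\<^bsub>Homeo_plus_S1\<^esub> g = g \<otimes>\<^bsub>Homeo_plus_S1\<^esub> f"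
  shows "commuting (lifts G)"
  unfolding commuting_def
proof (intro ballI)
  note P = line_groupD[OF line_group_periodic_homeos]
  fix F K assume "F \<in> lifts G" "K \<in> lifts G"
  then have FK: "F \<in> periodic_homeos" "K \<in> periodic_homeos" "circle_map F \<in> G" "circle_map K \<in> G"
    by (auto simp: lifts_def)
  have "circle_map (F \<circ> K) = circle_map (K \<circ> F)" using comm[OF FK(3,4)] FK(1,2) by simp
  then obtain m where m: "F \<circ> K = transl (of_int m) \<circ> (K \<circ> F)"
    using circle_map_eqE[OF P(3)[OF FK(1,2)] P(3)[OF FK(2,1)]] by blast
  then have m': "F (K x) = K (F x) + of_int m" for x by (auto simp: fun_eq_iff transl_def)
  have iter: "(F ^^ j) (K x) = K ((F ^^ j) x) + of_int (int j * m)" for j x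
  proof (induction j)
    case (Suc j)
    have "(F ^^ Suc j) (K x) = F (K ((F ^^ j) x) + of_int (int j * m))" using Suc by simp
    also have "\<dots> = F (K ((F ^^ j) x)) + of_int (int j * m)" by (rule periodic_homeos_int[OF FK(1)])
    finally show ?case using m' by (simp add: algebra_simps)
  qed simp
  have "\<bar>real j * of_int m\<bar> \<le> 2" for j
    using iter[of j 0] periodic_homeos_displacement[OF FK(2), of "(F ^^ j) 0"]
      periodic_homeos_displacement[OF line_group_funpow[OF line_group_periodic_homeos FK(1)], of j "K 0"]
    by simp
  then have "real j * of_int m \<le> 2" "real j * (- of_int m) \<le> 2" for j by (auto simp: abs_le_iff)
  then have "(of_int m :: real) \<le> 0" "- (of_int m :: real) \<le> 0" by (metis bounded_multiples_imp_0)+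
  then have "m = 0" by simp
  then show "F \<circ> K = K \<circ> F" using m by simp
qed

section \<open>The group of lifts\<close>

text \<open>The isomorphism of the group on the circle with the integer vectors, read on the lifts, where its
  kernel consists of the deck transformations.\<close>

definition deck_coordinates ::
    "(real \<Rightarrow> real) set \<Rightarrow> nat \<Rightarrow> ((real \<Rightarrow> real) \<Rightarrow> nat \<Rightarrow> int) \<Rightarrow> bool" where
  "deck_coordinates H n \<kappa> \<longleftrightarrow>
     (\<forall>f\<in>H. \<forall>g\<in>H. \<forall>i. \<kappa> (f \<circ> g) i = \<kappa> f i + \<kappa> g i) \<and> \<kappa> ` H = int_vectors n \<and>
     (\<forall>f\<in>H. \<kappa> f = (\<lambda>_. 0) \<longleftrightarrow> (\<exists>m::int. f = transl (of_int m)))"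

lemma deck_coordinatesD:
  assumes "deck_coordinates H n \<kappa>"
  shows "f \<in> H \<Longrightarrow> g \<in> H \<Longrightarrow> \<kappa> (f \<circ> g) i = \<kappa> f i + \<kappa> g i"
    "f \<in> H \<Longrightarrow> \<kappa> f \<in> int_vectors n"
    "w \<in> int_vectors n \<Longrightarrow> \<exists>f\<in>H. \<kappa> f = w"
    "f \<in> H \<Longrightarrow> \<kappa> f = (\<lambda>_. 0) \<longleftrightarrow> (\<exists>m::int. f = transl (of_int m))"
proof -
  have *: "\<forall>f\<in>H. \<forall>g\<in>H. \<forall>i. \<kappa> (f \<circ> g) i = \<kappa> f i + \<kappa> g i" "\<kappa> ` H = int_vectors n"
    "\<forall>f\<in>H. \<kappa> f = (\<lambda>_. 0) \<longleftrightarrow> (\<exists>m::int. f = transl (of_int m))"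
    using assms unfolding deck_coordinates_def by blast+
  show "f \<in> H \<Longrightarrow> g \<in> H \<Longrightarrow> \<kappa> (f \<circ> g) i = \<kappa> f i + \<kappa> g i" using *(1) by blast
  show "f \<in> H \<Longrightarrow> \<kappa> f \<in> int_vectors n" using *(2) by blast
  show "w \<in> int_vectors n \<Longrightarrow> \<exists>f\<in>H. \<kappa> f = w" using *(2) by (metis imageE)
  show "f \<in> H \<Longrightarrow> \<kappa> f = (\<lambda>_. 0) \<longleftrightarrow> (\<exists>m::int. f = transl (of_int m))" using *(3) by blast
qed

lemma product_integer_group_coordinates:
  assumes "Q \<cong> product_group {..<n} (\<lambda>_. integer_group)"
  obtains \<kappa> where "\<And>f g i. f \<in> carrier Q \<Longrightarrow> g \<in> carrier Q \<Longrightarrow> \<kappa> (f \<otimes>\<^bsub>Q\<^esub> g) i = \<kappa> f i + \<kappa> g i"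
    "bij_betw \<kappa> (carrier Q) (int_vectors n)"
proof -
  obtain \<iota> where \<iota>: "\<iota> \<in> iso Q (product_group {..<n} (\<lambda>_. integer_group))"
    using assms unfolding is_iso_def by blast
  have hom: "\<iota> (f \<otimes>\<^bsub>Q\<^esub> g) = (\<lambda>i\<in>{..<n}. \<iota> f i + \<iota> g i)"
    if "f \<in> carrier Q" "g \<in> carrier Q" for f g
  proof -
    have "\<iota> (f \<otimes>\<^bsub>Q\<^esub> g) = \<iota> f \<otimes>\<^bsub>product_group {..<n} (\<lambda>_. integer_group)\<^esub> \<iota> g"
      using \<iota> that by (intro hom_mult) (auto simp: iso_def)
    then show ?thesis by simp
  qed
  have bij: "bij_betw \<iota> (carrier Q) (PiE {..<n} (\<lambda>_. UNIV))"
    using \<iota> by (simp add: iso_def integer_group_def)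
  define \<kappa> where "\<kappa> f i = (if i < n then \<iota> f i else 0)" for f i
  have "inj_on \<kappa> (carrier Q)"
  proof (rule inj_onI)
    fix f g assume fg: "f \<in> carrier Q" "g \<in> carrier Q" "\<kappa> f = \<kappa> g"
    have ext: "\<iota> f \<in> PiE {..<n} (\<lambda>_. UNIV)" "\<iota> g \<in> PiE {..<n} (\<lambda>_. UNIV)"
      using bij_betwE[OF bij] fg(1,2) by blast+
    have "\<iota> f i = \<iota> g i" if "i < n" for i
      using fun_cong[OF fg(3), of i] that by (simp add: \<kappa>_def)
    then have "\<iota> f = \<iota> g" using PiE_ext[OF ext] by simp
    then show "f = g" using bij fg(1,2) by (auto simp: bij_betw_def dest: inj_onD)
  qed
  moreover have "\<kappa> ` carrier Q = int_vectors n"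
  proof (rule equalityI; rule subsetI)
    fix w assume "w \<in> \<kappa> ` carrier Q"
    then show "w \<in> int_vectors n" by (auto simp: \<kappa>_def int_vectors_def)
  next
    fix w :: "nat \<Rightarrow> int" assume w: "w \<in> int_vectors n"
    have "restrict w {..<n} \<in> \<iota> ` carrier Q" using bij by (auto simp: bij_betw_def)
    then obtain f where f: "f \<in> carrier Q" "\<iota> f = restrict w {..<n}" by force
    have "\<kappa> f = w" using w by (auto simp: \<kappa>_def f(2) int_vectors_def fun_eq_iff)
    then show "w \<in> \<kappa> ` carrier Q" using f(1) by blast
  qed
  moreover have "\<kappa> (f \<otimes>\<^bsub>Q\<^esub> g) i = \<kappa> f i + \<kappa> g i" if "f \<in> carrier Q" "g \<in> carrier Q" for f g i
    using hom[OF that] by (simp add: \<kappa>_def)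
  ultimately show ?thesis using that[of \<kappa>] by (simp add: bij_betw_def)
qed

lemma lifts_deck_coordinates:
  assumes G: "subgroup G Homeo_plus_S1"
    and iso: "Homeo_plus_S1\<lparr>carrier := G\<rparr> \<cong> product_group {..<n} (\<lambda>_. integer_group)"
  shows "commuting (lifts G)" "\<exists>\<kappa>. deck_coordinates (lifts G) n \<kappa>"
proof -
  obtain \<kappa>0 where \<kappa>0: "\<And>f g i. f \<in> G \<Longrightarrow> g \<in> G \<Longrightarrow> \<kappa>0 (f \<otimes>\<^bsub>Homeo_plus_S1\<^esub> g) i = \<kappa>0 f i + \<kappa>0 g i"
      "bij_betw \<kappa>0 G (int_vectors n)"
    using product_integer_group_coordinates[OF iso] by auto
  have inj: "f = g" if "f \<in> G" "g \<in> G" "\<kappa>0 f = \<kappa>0 g" for f g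
    using \<kappa>0(2) that by (auto simp: bij_betw_def dest: inj_onD)
  have "f \<otimes>\<^bsub>Homeo_plus_S1\<^esub> g = g \<otimes>\<^bsub>Homeo_plus_S1\<^esub> f" if "f \<in> G" "g \<in> G" for f g
    using that by (intro inj subgroup.m_closed[OF G]) (auto simp: \<kappa>0(1) fun_eq_iff)
  then show "commuting (lifts G)" by (rule commuting_lifts)
  have per: "F \<in> periodic_homeos" "circle_map F \<in> G" if "F \<in> lifts G" for F
    using that by (auto simp: lifts_def)
  have one: "circle_map id \<in> G" using subgroup.one_closed[OF G] by (simp add: circle_map_one)
  have zero: "\<kappa>0 (circle_map id) = (\<lambda>_. 0)"
    using \<kappa>0(1)[OF one one] line_groupD(2)[OF line_group_periodic_homeos] by (auto simp: fun_eq_iff)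
  have "deck_coordinates (lifts G) n (\<lambda>F. \<kappa>0 (circle_map F))"
    unfolding deck_coordinates_def
  proof (intro conjI ballI allI iffI)
    fix F F' i assume "F \<in> lifts G" "F' \<in> lifts G"
    then show "\<kappa>0 (circle_map (F \<circ> F')) i = \<kappa>0 (circle_map F) i + \<kappa>0 (circle_map F') i"
      using \<kappa>0(1)[of "circle_map F" "circle_map F'"] per by simp
  next
    show "(\<lambda>F. \<kappa>0 (circle_map F)) ` lifts G = int_vectors n"
      using \<kappa>0(2) circle_map_lifts[OF G] by (simp add: bij_betw_def image_image[symmetric])
  next
    fix F assume F: "F \<in> lifts G" "\<kappa>0 (circle_map F) = (\<lambda>_. 0)"
    then have "circle_map F = circle_map id" using inj[OF per(2)[OF F(1)] one] zero by simp
    then show "\<exists>m::int. F = transl (of_int m)" by (rule circle_map_eq_one_iff[OF per(1)[OF F(1)]])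
  next
    fix F assume "F \<in> lifts G" "\<exists>m::int. F = transl (of_int m)"
    then show "\<kappa>0 (circle_map F) = (\<lambda>_. 0)" using zero by auto
  qed
  then show "\<exists>\<kappa>. deck_coordinates (lifts G) n \<kappa>" by blast
qed

text \<open>Lifts of the standard basis clear the coordinates of an element one by one, until a deck
  transformation is left.\<close>

lemma fin_gen_deck_coordinates:
  assumes H: "line_group H" "transl 1 \<in> H" and \<kappa>: "deck_coordinates H n \<kappa>"
  shows "fin_gen H"
proof -
  note D = deck_coordinatesD[OF \<kappa>] and G = line_groupD[OF H(1)]
  have "\<exists>f\<in>H. \<kappa> f = (\<lambda>j. if j = i then 1 else 0)" if "i < n" for i
    using that by (intro D(3)) (auto simp: int_vectors_def)
  then obtain e where e: "\<And>i. i < n \<Longrightarrow> e i \<in> H \<and> \<kappa> (e i) = (\<lambda>j. if j = i then 1 else 0)" by metis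
  have "H \<subseteq> K" if K: "line_group K" "insert (transl 1) (e ` {..<n}) \<subseteq> K" for K
  proof -
    note GK = line_groupD[OF K(1)]
    have HK: "line_group (H \<inter> K)" using H(1) K(1) by (auto simp: line_group_def)
    have id0: "\<kappa> id i = 0" for i using D(1)[OF G(2) G(2), of i] by simp
    have tr: "transl (of_int m) \<in> K" for m
      using line_group_transl_int_mult[OF K(1), of 1 m] K(2) by simp
    have pow: "\<exists>p\<in>H \<inter> K. \<forall>j. \<kappa> p j = c * \<kappa> f j" if f: "f \<in> H \<inter> K" for f and c :: int
    proof (induction c rule: int_induct[where k = 0])
      case base
      have "\<forall>j. \<kappa> id j = 0 * \<kappa> f j" unfolding id0 by simp
      then show ?case using G(2) GK(2) by blast
    next
      case (step1 c)
      then obtain p where p: "p \<in> H \<inter> K" "\<forall>j. \<kappa> p j = c * \<kappa> f j" by blast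
      have "\<kappa> (p \<circ> f) j = (c + 1) * \<kappa> f j" for j
        using D(1)[of p f j] p f by (simp only: Int_iff) (simp add: algebra_simps)
      then show ?case using line_groupD(3)[OF HK p(1) f] by blast
    next
      case (step2 c)
      then obtain p where p: "p \<in> H \<inter> K" "\<forall>j. \<kappa> p j = c * \<kappa> f j" by blast
      have inv: "\<kappa> (finv f) j = - \<kappa> f j" for j
        using D(1)[of f "finv f" j] f G(1,4) id0 by simp
      have fi: "finv f \<in> H \<inter> K" using line_groupD(4)[OF HK f] .
      have "\<kappa> (p \<circ> finv f) j = (c - 1) * \<kappa> f j" for j
        using D(1)[of p "finv f" j] p fi inv by (simp only: Int_iff) (simp add: algebra_simps)
      then show ?case using line_groupD(3)[OF HK p(1) fi] by blast
    qed
    have "f \<in> K" if "m \<le> n" "f \<in> H" "\<forall>i\<ge>m. \<kappa> f i = 0" for m f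
      using that
    proof (induction m arbitrary: f)
      case 0
      then have "\<kappa> f = (\<lambda>_. 0)" by auto
      then show ?case using D(4)[OF 0(2)] tr by blast
    next
      case (Suc m)
      have em: "e m \<in> H \<inter> K" "\<kappa> (e m) = (\<lambda>j. if j = m then 1 else 0)" using e[of m] Suc.prems(1) K(2) by auto
      obtain p where p: "p \<in> H \<inter> K" "\<forall>j. \<kappa> p j = - \<kappa> f m * \<kappa> (e m) j" using pow[OF em(1)] by blast
      have "\<forall>i\<ge>m. \<kappa> (f \<circ> p) i = 0"
        using Suc.prems(2,3) p D(1)[of f p] em(2) by auto
      moreover have "f \<circ> p \<in> H" using Suc.prems(2) p(1) G(3) by blast
      ultimately have "f \<circ> p \<in> K" using Suc.IH Suc.prems(1) Suc_leD by blast
      then have "(f \<circ> p) \<circ> finv p \<in> K" using GK(3,4) p(1) by blast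
      then show ?case using GK(1) p(1) by (simp add: comp_assoc)
    qed
    then show ?thesis using D(2) unfolding int_vectors_def by blast
  qed
  then show ?thesis unfolding fin_gen_def using e H(2) by (intro exI[of _ "insert (transl 1) (e ` {..<n})"]) auto
qed

lemma rank_deck_coordinates:
  assumes H: "line_group H" "transl 1 \<in> H" and \<kappa>: "deck_coordinates H n \<kappa>" and \<rho>: "free_basis H d \<rho>"
  shows "d = n + 1"
proof -
  note D = deck_coordinatesD[OF \<kappa>]
  have \<rho>add: "\<rho> (\<lambda>i. v i + w i) = \<rho> v \<circ> \<rho> w" if "v \<in> int_vectors d" "w \<in> int_vectors d" for v w
    using \<rho> that by (simp add: free_basis_def)
  have \<rho>in: "\<rho> v \<in> H" if "v \<in> int_vectors d" for v using \<rho> that by (auto simp: free_basis_def)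
  have \<rho>inj: "v = w" if "v \<in> int_vectors d" "w \<in> int_vectors d" "\<rho> v = \<rho> w" for v w
    using \<rho> that by (auto simp: free_basis_def dest: inj_onD)
  have \<rho>onto: "\<exists>v\<in>int_vectors d. \<rho> v = f" if "f \<in> H" for f using \<rho> that by (auto simp: free_basis_def)
  obtain t where t: "t \<in> int_vectors d" "\<rho> t = transl 1" using \<rho>onto[OF H(2)] by blast
  have mt: "(\<lambda>i. m * t i) \<in> int_vectors d" for m using t(1) by (simp add: int_vectors_def)
  have add: "\<rho> (\<lambda>i. (k + m) * t i) = \<rho> (\<lambda>i. k * t i) \<circ> \<rho> (\<lambda>i. m * t i)" for k m
    using \<rho>add[OF mt mt] by (simp add: distrib_right)
  have lh: "\<rho> (\<lambda>i. m * t i) \<in> line_homeos" for m using \<rho>in[OF mt] line_groupD(1)[OF H(1)] by blast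
  have \<rho>0: "\<rho> (\<lambda>i. 0 * t i) = id"
  proof
    fix x
    have "\<rho> (\<lambda>i. 0 * t i) (\<rho> (\<lambda>i. 0 * t i) x) = \<rho> (\<lambda>i. 0 * t i) x" using fun_cong[OF add[of 0 0], of x] by simp
    then show "\<rho> (\<lambda>i. 0 * t i) x = id x" using line_homeos_eq[OF lh[of 0]] by simp
  qed
  have \<rho>t: "\<rho> (\<lambda>i. m * t i) = transl (of_int m)" for m
  proof (induction m rule: int_induct[where k = 0])
    case base then show ?case using \<rho>0 by (simp add: id_def)
  next
    case (step1 i)
    then show ?case using add[of i 1] t(2) by (simp add: transl_comp)
  next
    case (step2 i)
    have "transl (of_int i) = \<rho> (\<lambda>l. (i - 1) * t l) \<circ> transl 1" using add[of "i - 1" 1] t(2) step2 by simp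
    then have "transl (of_int i) \<circ> transl (- 1) = \<rho> (\<lambda>l. (i - 1) * t l) \<circ> (transl 1 \<circ> transl (- 1))"
      by (simp add: comp_assoc)
    then show ?case by (simp add: transl_comp)
  qed
  show ?thesis
  proof (rule rank_of_cyclic_extension)
    show "additive_on d (\<lambda>v. \<kappa> (\<rho> v))" unfolding additive_on_def using \<rho>add \<rho>in D(1) by simp
    show "\<kappa> (\<rho> v) \<in> int_vectors n" if "v \<in> int_vectors d" for v using D(2)[OF \<rho>in[OF that]] .
    show "\<exists>v\<in>int_vectors d. \<kappa> (\<rho> v) = w" if "w \<in> int_vectors n" for w
      using D(3)[OF that] \<rho>onto by metis
    show "t \<in> int_vectors d" by (rule t(1))
    show "t \<noteq> (\<lambda>_. 0)"
    proof
      assume "t = (\<lambda>_. 0)"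
      then have "transl 1 = id" using \<rho>0 t(2) by simp
      then have "transl 1 0 = 0" by simp
      then show False by (simp add: transl_def)
    qed
    show "\<kappa> (\<rho> t) = (\<lambda>_. 0)" using D(4)[OF H(2)] t(2) of_int_1 by metis
    fix v assume v: "v \<in> int_vectors d" "\<kappa> (\<rho> v) = (\<lambda>_. 0)"
    then obtain m :: int where "\<rho> v = transl (of_int m)" using D(4)[OF \<rho>in[OF v(1)]] by blast
    then show "\<exists>m. v = (\<lambda>i. m * t i)" using \<rho>inj[OF v(1) mt] \<rho>t by metis
  qed
qed

lemma openin_circ_image:
  assumes "b \<le> a + 1"
  shows "openin (top_of_set S1) (circ ` {a<..<b})"
proof -
  have eq: "circ ` {a<..<b} = S1 - circ ` {b..a + 1}"
  proof (rule equalityI; rule subsetI)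
    fix z assume "z \<in> circ ` {a<..<b}"
    then obtain x where x: "z = circ x" "a < x" "x < b" by auto
    have "z \<notin> circ ` {b..a + 1}"
    proof
      assume "z \<in> circ ` {b..a + 1}"
      then obtain y where y: "b \<le> y" "y \<le> a + 1" "circ x = circ y" using x(1) by auto
      from y(3) obtain n where n: "y = x + of_int n" by (metis circ_eqE)
      then have "0 < (of_int n :: real)" "(of_int n :: real) < 1" using x y by linarith+
      then show False by simp
    qed
    then show "z \<in> S1 - circ ` {b..a + 1}" by (simp add: x(1))
  next
    fix z assume z: "z \<in> S1 - circ ` {b..a + 1}"
    then have "z \<in> S1" by blast
    then obtain x where x: "z = circ x" "a \<le> x" "x < a + 1" by (rule circ_surj)
    have "circ a \<in> circ ` {b..a + 1}"
      using imageI[of "a + 1" "{b..a + 1}" circ] assms by simp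
    then have "x \<noteq> a" using z x(1) by blast
    moreover have "\<not> b \<le> x" using z x by auto
    ultimately show "z \<in> circ ` {a<..<b}" using x by auto
  qed
  have "compact (circ ` {b..a + 1})" by (intro compact_continuous_image continuous_circ compact_Icc)
  then have "closed (circ ` {b..a + 1})" by (rule compact_imp_closed)
  then show ?thesis unfolding eq Diff_eq by (intro openin_open_Int open_Compl)
qed

lemma openin_circle_contains_arc:
  assumes "openin (top_of_set S1) U" "U \<noteq> {}"
  obtains a b where "a < b" "\<And>x. a < x \<Longrightarrow> x < b \<Longrightarrow> circ x \<in> U"
proof -
  have "openin (top_of_set UNIV) (UNIV \<inter> circ -` U)"
    by (rule continuous_openin_preimage[OF continuous_circ _ assms(1)]) auto
  then have op: "open (circ -` U)" by simp
  obtain z where z: "z \<in> U" using assms(2) by blast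
  then have "z \<in> S1" using openin_imp_subset[OF assms(1)] by blast
  then have "Arg z / (2 * pi) \<in> circ -` U" using z circ_Arg by simp
  then obtain x where "x \<in> circ -` U" ..
  then obtain a b where "a < x" "x < b" "\<forall>y. a < y \<and> y < b \<longrightarrow> y \<in> circ -` U"
    using open_real_contains_interval[OF op] by blast
  then show ?thesis using that[of a b] by simp
qed

lemma interval_transitive_lifts:
  assumes G: "subgroup G Homeo_plus_S1" and "topologically_transitive (top_of_set S1) G"
  shows "interval_transitive (lifts G)"
  unfolding interval_transitive_def
proof (intro allI impI)
  fix a b c d :: real assume abcd: "a < b \<and> c < d"
  let ?U = "circ ` {a<..<min b (a + 1)}" and ?V = "circ ` {c<..<min d (c + 1)}"
  have "openin (top_of_set S1) ?U" "openin (top_of_set S1) ?V" by (rule openin_circ_image; simp)+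
  moreover have "?U \<noteq> {}" "?V \<noteq> {}" using abcd by auto
  ultimately have "openin (top_of_set S1) ?U \<and> openin (top_of_set S1) ?V \<and> ?U \<noteq> {} \<and> ?V \<noteq> {}"
    by simp
  then have "\<exists>g\<in>G. g ` ?U \<inter> ?V \<noteq> {}"
    by (rule assms(2)[unfolded topologically_transitive_def, rule_format])
  then obtain g where g: "g \<in> G" "g ` ?U \<inter> ?V \<noteq> {}" ..
  then obtain x y where xy: "a < x" "x < b" "c < y" "y < d" "g (circ x) = circ y" by auto
  obtain F where F: "F \<in> lifts G" "g = circle_map F" using circle_map_lifts[OF G] g(1) by blast
  then have "circ (F x) = circ y" using xy(5) by (simp add: lifts_def)
  then obtain m where m: "F x = y + of_int m" by (rule circ_eqE)
  have "transl (of_int (- m)) \<circ> F \<in> lifts G"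
    using line_groupD(3)[OF line_group_lifts[OF G] transl_int_lifts[OF G] F(1)] .
  moreover have "(transl (of_int (- m)) \<circ> F) x = y" using m by (simp add: transl_def)
  ultimately show "\<exists>h\<in>lifts G. \<exists>x. a < x \<and> x < b \<and> c < h x \<and> h x < d" using xy by metis
qed

lemma avoiding_points_lifts:
  assumes G: "subgroup G Homeo_plus_S1" and "almost_minimal (top_of_set S1) G"
  shows "countable (avoiding_points (lifts G))"
proof -
  let ?N = "{z. nontransitive_point (top_of_set S1) G z}"
  have "circ x \<in> ?N" if x: "x \<in> avoiding_points (lifts G)" for x
  proof -
    obtain c d where cd: "c < d" "\<And>h. h \<in> lifts G \<Longrightarrow> \<not> (c < h x \<and> h x < d)"
      using x unfolding avoiding_points_def by blast
    let ?V = "circ ` {c<..<min d (c + 1)}"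
    have V: "openin (top_of_set S1) ?V" by (rule openin_circ_image) simp
    have "?V \<inter> (\<lambda>g. g (circ x)) ` G = {}"
    proof (rule ccontr)
      assume "\<not> ?thesis"
      then obtain z where z: "z \<in> ?V" "z \<in> (\<lambda>g. g (circ x)) ` G" by blast
      obtain y where y: "c < y" "y < d" "z = circ y" using z(1) by auto
      obtain g where "g \<in> G" "z = g (circ x)" using z(2) by blast
      then have g: "g \<in> G" "c < y" "y < d" "g (circ x) = circ y" using y by auto
      obtain F where F: "F \<in> lifts G" "g = circle_map F" using circle_map_lifts[OF G] g(1) by blast
      then have "circ (F x) = circ y" using g(4) by (simp add: lifts_def)
      then obtain m where m: "F x = y + of_int m" by (rule circ_eqE)
      have "transl (of_int (- m)) \<circ> F \<in> lifts G"
        using line_groupD(3)[OF line_group_lifts[OF G] transl_int_lifts[OF G] F(1)] .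
      moreover have "(transl (of_int (- m)) \<circ> F) x = y" using m by (simp add: transl_def)
      ultimately show False using cd(2) g(2,3) by metis
    qed
    then have "?V \<inter> (top_of_set S1) closure_of ((\<lambda>g. g (circ x)) ` G) = {}"
      using openin_Int_closure_of_eq_empty[OF V] by blast
    moreover have "circ ((c + min d (c + 1)) / 2) \<in> ?V" using cd(1) by (intro imageI) (auto simp: min_def)
    moreover have "circ ((c + min d (c + 1)) / 2) \<in> S1" by simp
    ultimately have "(top_of_set S1) closure_of ((\<lambda>g. g (circ x)) ` G) \<noteq> topspace (top_of_set S1)"
      by auto
    then show ?thesis by (simp add: nontransitive_point_def)
  qed
  moreover have "x \<in> (\<lambda>(z, m). Arg z / (2 * pi) + of_int m) ` (?N \<times> (UNIV :: int set))" if "circ x \<in> ?N" for x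
  proof -
    have "circ x = circ (Arg (circ x) / (2 * pi))" by (rule circ_Arg[symmetric]) simp
    then obtain m where "x = Arg (circ x) / (2 * pi) + of_int m" by (rule circ_eqE)
    then show ?thesis using that by (intro image_eqI[of _ _ "(circ x, m)"]) auto
  qed
  ultimately have "avoiding_points (lifts G) \<subseteq> (\<lambda>(z, m). Arg z / (2 * pi) + of_int m) ` (?N \<times> (UNIV :: int set))"
    by blast
  moreover have "countable (?N \<times> (UNIV :: int set))" using assms(2) by (simp add: almost_minimal_def)
  ultimately show ?thesis by (meson countable_image countable_subset)
qed

text \<open>The cosets of the powers of an element repeat when there are finitely many of them.\<close>

lemma tight_rel_lifts:
  assumes G: "subgroup G Homeo_plus_S1"
    and tight: "tightly_transitive (top_of_set S1) (Homeo_plus_S1\<lparr>carrier := G\<rparr>)"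
  shows "tight_rel (lifts G) (transl 1)"
  unfolding tight_rel_def
proof (intro allI impI ballI)
  fix K F assume K: "line_group K \<and> K \<subseteq> lifts G \<and> transl 1 \<in> K \<and> interval_transitive K" and F: "F \<in> lifts G"
  let ?Q = "Homeo_plus_S1\<lparr>carrier := G\<rparr>" and ?K = "circle_map ` K"
  have Kper: "K \<subseteq> periodic_homeos" using K by (auto simp: lifts_def)
  have "subgroup ?K Homeo_plus_S1" using K Kper by (intro subgroup_circle_map) auto
  then have sub: "subgroup ?K ?Q"
    using K by (intro group.subgroup_incl[OF group_Homeo_plus_S1 _ G]) (auto simp: lifts_def)
  have "topologically_transitive (top_of_set S1) ?K"
    unfolding topologically_transitive_def
  proof (intro allI impI)
    fix U V assume UV: "openin (top_of_set S1) U \<and> openin (top_of_set S1) V \<and> U \<noteq> {} \<and> V \<noteq> {}"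
    then obtain a b c d where ab: "a < b" "\<And>x. a < x \<Longrightarrow> x < b \<Longrightarrow> circ x \<in> U"
        and cd: "c < d" "\<And>x. c < x \<Longrightarrow> x < d \<Longrightarrow> circ x \<in> V"
      by (metis openin_circle_contains_arc)
    obtain u x where u: "u \<in> K" "a < x" "x < b" "c < u x" "u x < d"
      using K ab(1) cd(1) unfolding interval_transitive_def by metis
    have "circle_map u (circ x) = circ (u x)" using u(1) Kper by auto
    then have "circ (u x) \<in> circle_map u ` U \<inter> V" using ab(2)[OF u(2,3)] cd(2)[OF u(4,5)] by (metis IntI imageI)
    then show "\<exists>g\<in>?K. g ` U \<inter> V \<noteq> {}" using u(1) by blast
  qed
  then have fin: "finite (rcosets\<^bsub>?Q\<^esub> ?K)" using tight sub unfolding tightly_transitive_def by blast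
  have Fper: "F ^^ m \<in> periodic_homeos" "circle_map (F ^^ m) \<in> G" for m
    using line_group_funpow[OF line_group_lifts[OF G] F, of m] by (auto simp: lifts_def)
  let ?c = "\<lambda>m. ?K #>\<^bsub>?Q\<^esub> circle_map (F ^^ m)"
  have "range ?c \<subseteq> rcosets\<^bsub>?Q\<^esub> ?K" using Fper(2) by (auto simp: RCOSETS_def)
  then have "finite (range ?c)" using fin finite_subset by blast
  then have "\<not> inj ?c" using finite_imageD infinite_UNIV_nat by blast
  then obtain i j where ij: "i < j" "?c i = ?c j" unfolding inj_def by (metis linorder_neqE_nat)
  have "circle_map (F ^^ j) \<in> ?c j"
  proof -
    have "circle_map (F ^^ j) = circle_map id \<otimes>\<^bsub>Homeo_plus_S1\<^esub> circle_map (F ^^ j)"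
      using Fper line_groupD(2)[OF line_group_periodic_homeos] by simp
    moreover have "circle_map id \<in> ?K" using K line_groupD(2) by blast
    ultimately show ?thesis by (auto simp: r_coset_def)
  qed
  then obtain u where u: "u \<in> K" "circle_map (F ^^ j) = circle_map u \<otimes>\<^bsub>Homeo_plus_S1\<^esub> circle_map (F ^^ i)"
    unfolding ij(2)[symmetric] by (auto simp: r_coset_def)
  have up: "u \<in> periodic_homeos" using u(1) Kper by blast
  have "circle_map (F ^^ j) = circle_map (u \<circ> F ^^ i)" using u(2) up Fper by simp
  then obtain m where m: "F ^^ j = transl (of_int m) \<circ> (u \<circ> F ^^ i)"
    using circle_map_eqE[OF Fper(1) line_groupD(3)[OF line_group_periodic_homeos up Fper(1)]] by blast
  have "F ^^ (j - i) \<circ> F ^^ i = transl (of_int m) \<circ> u \<circ> F ^^ i"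
    using m ij(1) by (simp add: funpow_add[symmetric] comp_assoc)
  then have "(F ^^ (j - i) \<circ> F ^^ i) \<circ> finv (F ^^ i) = (transl (of_int m) \<circ> u \<circ> F ^^ i) \<circ> finv (F ^^ i)"
    by (rule arg_cong[where f = "\<lambda>f. f \<circ> finv (F ^^ i)"])
  then have "F ^^ (j - i) = transl (of_int m) \<circ> u"
    using periodic_homeosD[OF Fper(1)[of i]] by (simp add: comp_assoc)
  moreover have "transl (of_int m) \<in> K" using line_group_transl_int_mult[of K 1 m] K by simp
  ultimately have "F ^^ (j - i) \<in> K" using line_groupD(3) K u(1) by metis
  then show "\<exists>m\<ge>1. F ^^ m \<in> K" using ij(1) by (intro exI[of _ "j - i"]) auto
qed

lemma tame_lifts:
  assumes G: "subgroup G Homeo_plus_S1"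
    and "topologically_transitive (top_of_set S1) G" "almost_minimal (top_of_set S1) G"
    and "commuting (lifts G)" "deck_coordinates (lifts G) n \<kappa>"
  shows "tame (lifts G)"
  unfolding tame_def
  using assms line_group_lifts[OF G] interval_transitive_lifts avoiding_points_lifts
    fin_gen_deck_coordinates[OF line_group_lifts[OF G] _ assms(5)] transl_int_lifts[OF G, of 1]
  by simp

section \<open>Parametrized arcs\<close>

lemma cpt_eq_circ: "cpt k j = circ (real j / real k)"
  by (simp add: cpt_def circ_def)

lemma arc_between_eq: "arc_between k i = (\<lambda>t. circ (t / real k)) ` {real i<..<real (i + 1)}"
  by (simp add: arc_between_def circ_def)

lemma circ_divide_inj:
  assumes "k \<ge> 1" "circ (s / real k) = circ (t / real k)" "\<bar>s - t\<bar> < real k"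
  shows "s = t"
proof -
  obtain n where n: "s / real k = t / real k + of_int n" using assms(2) by (rule circ_eqE)
  then have st: "s - t = real k * of_int n" using assms(1) by (simp add: field_simps)
  then have "real k * \<bar>of_int n\<bar> < real k * 1" using assms(3) by (simp add: abs_mult)
  then have "\<bar>of_int n\<bar> < (1::real)" using assms(1) by (simp only: mult_less_cancel_left_pos)
  then have "n = 0" by linarith
  then show ?thesis using st by simp
qed

text \<open>A lift of an oriented parametrization of the first arc, rescaled to the unit interval. The angle
  of the parametrization ranges over a connected set and so stays in a single one of the preimages of
  the arc.\<close>

lemma oriented_parametrization_coordinate:
  assumes "oriented_parametrization (arc_between k 1) \<phi>" "k \<ge> 1"
  obtains h1 where "unit_interval_coordinate h1" "\<And>t. \<phi> t = circ ((h1 t + 1) / real k)"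
proof -
  obtain \<psi> \<theta> where \<psi>: "homeomorphism UNIV (arc_between k 1) \<phi> \<psi>"
    and \<theta>: "continuous_on UNIV \<theta>" "strict_mono \<theta>" "\<And>t. \<phi> t = cis (\<theta> t)"
    using assms(1) unfolding oriented_parametrization_def by blast
  have k: "real k \<ge> 1" "1 / real k \<le> 1" using assms(2) by simp_all
  have k2: "2 / real k = 1 / real k + 1 / real k" by simp
  define \<beta> where "\<beta> t = \<theta> t / (2 * pi)" for t
  have \<phi>\<beta>: "\<phi> t = circ (\<beta> t)" for t by (simp add: \<theta>(3) circ_def \<beta>_def)
  have cont: "continuous_on A \<beta>" for A
    unfolding \<beta>_def by (intro continuous_intros continuous_on_subset[OF \<theta>(1)]) auto
  have arc: "\<exists>m::int. of_int m + 1 / real k < \<beta> t \<and> \<beta> t < of_int m + 2 / real k" for t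
  proof -
    have "\<phi> t \<in> arc_between k 1" using \<psi> unfolding homeomorphism_def by blast
    then obtain s where s: "1 < s" "s < 2" "circ (\<beta> t) = circ (s / real k)"
      unfolding \<phi>\<beta> arc_between_eq by auto
    then obtain m where "\<beta> t = s / real k + of_int m" by (metis circ_eqE)
    moreover have "1 / real k < s / real k" "s / real k < 2 / real k"
      using s(1,2) k(1) by (auto intro!: divide_strict_right_mono)
    ultimately show ?thesis by (intro exI[of _ m]) linarith
  qed
  obtain m where m: "of_int m + 1 / real k < \<beta> 0" "\<beta> 0 < of_int m + 2 / real k" using arc by blast
  have no_boundary: "\<beta> t \<noteq> of_int i + 2 / real k" "\<beta> t \<noteq> of_int i + 1 / real k" for t i
  proof -
    obtain l where l: "of_int l + 1 / real k < \<beta> t" "\<beta> t < of_int l + 2 / real k" using arc by blast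
    show "\<beta> t \<noteq> of_int i + 2 / real k"
    proof
      assume "\<beta> t = of_int i + 2 / real k"
      then have "(of_int l :: real) < of_int i + 1" "(of_int i :: real) < of_int l"
        using l k(2) k2 by linarith+
      then have "l < i + 1" "i < l" by (metis of_int_1 of_int_add of_int_less_iff)+
      then show False by simp
    qed
    show "\<beta> t \<noteq> of_int i + 1 / real k"
    proof
      assume "\<beta> t = of_int i + 1 / real k"
      then have "(of_int l :: real) < of_int i" "(of_int i :: real) < of_int l + 1"
        using l k(2) k2 by linarith+
      then have "l < i" "i < l + 1" by (metis of_int_1 of_int_add of_int_less_iff)+
      then show False by simp
    qed
  qed
  have range: "of_int m + 1 / real k < \<beta> t \<and> \<beta> t < of_int m + 2 / real k" for t
  proof (rule ccontr)
    assume "\<not> ?thesis"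
    then have "\<beta> t \<le> of_int m + 1 / real k \<or> of_int m + 2 / real k \<le> \<beta> t" by auto
    then have "\<exists>s. \<beta> s = of_int m + 1 / real k \<or> \<beta> s = of_int m + 2 / real k"
    proof
      assume "\<beta> t \<le> of_int m + 1 / real k"
      then show ?thesis
        using IVT'[of \<beta> t "of_int m + 1 / real k" 0] IVT2'[of \<beta> t "of_int m + 1 / real k" 0] m(1) cont
        by (metis less_imp_le linear)
    next
      assume "of_int m + 2 / real k \<le> \<beta> t"
      then show ?thesis
        using IVT'[of \<beta> 0 "of_int m + 2 / real k" t] IVT2'[of \<beta> 0 "of_int m + 2 / real k" t] m(2) cont
        by (metis less_imp_le linear)
    qed
    then show False using no_boundary by blast
  qed
  define h1 where "h1 t = real k * (\<beta> t - of_int m) - 1" for t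
  have h\<beta>: "(h1 t + 1) / real k = \<beta> t + of_int (- m)" for t using k(1) by (simp add: h1_def)
  have \<phi>h: "\<phi> t = circ ((h1 t + 1) / real k)" for t unfolding h\<beta> circ_add_int \<phi>\<beta> ..
  have h01: "0 < h1 t" "h1 t < 1" for t
    using range[of t] k(1) by (auto simp: h1_def field_simps)
  have unique: "y = h1 t" if y: "0 < y" "y < 1" "circ ((y + 1) / real k) = \<phi> t" for y t
  proof -
    have "\<bar>(y + 1) - (h1 t + 1)\<bar> < real k" using y(1,2) h01[of t] k(1) by linarith
    then have "y + 1 = h1 t + 1" using circ_divide_inj[OF assms(2)] y(3) unfolding \<phi>h by blast
    then show ?thesis by simp
  qed
  have circ_arc: "circ ((y + 1) / real k) \<in> arc_between k 1" if "0 < y" "y < 1" for y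
    unfolding arc_between_eq using that by (intro image_eqI[of _ _ "y + 1"]) auto
  have inverse: "h1 (\<psi> (circ ((y + 1) / real k))) = y" if "0 < y" "y < 1" for y
    using unique[OF that, of "\<psi> (circ ((y + 1) / real k))"] circ_arc[OF that] \<psi>
    by (simp add: homeomorphism_def)
  have "homeomorphism UNIV {0<..<1} h1 (\<lambda>y. \<psi> (circ ((y + 1) / real k)))"
    unfolding homeomorphism_def
  proof (intro conjI ballI)
    show "\<psi> (circ ((h1 t + 1) / real k)) = t" for t
      using \<psi> unfolding \<phi>h[symmetric] homeomorphism_def by blast
    show im: "h1 ` UNIV = {0<..<1}"
    proof (rule equalityI; rule subsetI)
      fix y :: real assume "y \<in> {0<..<1}"
      then show "y \<in> range h1" using inverse[of y] by (metis greaterThanLessThan_iff rangeI)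
    qed (use h01 in auto)
    show "continuous_on UNIV h1" unfolding h1_def by (intro continuous_intros cont)
    have *: "continuous_on (arc_between k 1) \<psi>" using \<psi> by (simp add: homeomorphism_def)
    show "continuous_on {0<..<1} (\<lambda>y. \<psi> (circ ((y + 1) / real k)))"
      by (rule continuous_on_compose2[OF * continuous_on_compose2[OF continuous_circ[of UNIV]]])
        (use k(1) circ_arc in \<open>auto intro!: continuous_intros\<close>)
    show "(\<lambda>y. \<psi> (circ ((y + 1) / real k))) ` {0<..<1} = UNIV"
    proof -
      have "t = \<psi> (circ ((h1 t + 1) / real k))" for t
        using \<psi> unfolding \<phi>h[symmetric] homeomorphism_def by auto
      then show ?thesis using h01 by (metis (no_types, lifting) UNIV_eq_I greaterThanLessThan_iff image_eqI)
    qed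
    show "h1 (\<psi> (circ ((y + 1) / real k))) = y" if "y \<in> {0<..<1}" for y using inverse that by auto
  qed
  then have "unit_interval_coordinate h1" by (intro unit_interval_coordinate.intro) blast
  then show ?thesis using that \<phi>h by blast
qed

section \<open>The model groups on the circle\<close>

lemma periodic_conj:
  assumes \<Phi>: "\<Phi> \<in> line_homeos" "conj_by \<Phi> T = transl 1" and u: "u \<in> line_homeos" "u \<circ> T = T \<circ> u"
  shows "conj_by \<Phi> u \<in> periodic_homeos"
proof -
  have "conj_by \<Phi> u \<circ> transl 1 = transl 1 \<circ> conj_by \<Phi> u"
    using u(2) \<Phi> by (metis conj_by_comp)
  then have "conj_by \<Phi> u (x + 1) = conj_by \<Phi> u x + 1" for x
    by (auto simp: fun_eq_iff transl_def)
  then show ?thesis using u \<Phi>(1) by (simp add: periodic_homeos_def)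
qed

text \<open>Here \<open>\<Phi>\<close> conjugates the homeomorphism \<open>transl k \<circ> hbar h1 \<gamma>\<close> to the deck transformation of
  the circle and is affine on the first \<open>k\<close> unit intervals, which thereby become the \<open>k\<close> arcs. The
  translation by \<open>1\<close> descends to the map that permutes the arcs cyclically, and its \<open>k\<close>-th power
  acts on the first arc as the inverse of \<open>\<gamma>\<close>.\<close>

locale arc_model = unit_interval_coordinate h1 for h1 :: "real \<Rightarrow> real" +
  fixes \<phi> :: "real \<Rightarrow> complex" and k :: nat and \<Phi> :: "real \<Rightarrow> real"
    and L :: "(real \<Rightarrow> real) set" and \<gamma> :: "real \<Rightarrow> real"
  assumes k: "k \<ge> 1"
    and \<phi>: "\<And>t. \<phi> t = circ ((h1 t + 1) / real k)"
    and \<Phi>: "\<Phi> \<in> line_homeos"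
    and L: "line_group L" "commuting L" "\<gamma> \<in> L"
    and affine: "\<And>x. 0 \<le> x \<Longrightarrow> x \<le> real k \<Longrightarrow> \<Phi> x = (x + 1) / real k"
    and deck: "conj_by \<Phi> (transl (of_int (int k)) \<circ> hbar h1 \<gamma>) = transl 1"
begin

definition rot :: "complex \<Rightarrow> complex" where
  "rot = circle_map (conj_by \<Phi> (transl 1))"

lemma commuting_ascend: "commuting (ascend L)"
  unfolding commuting_def
proof (intro ballI)
  fix f g assume "f \<in> ascend L" "g \<in> ascend L"
  then obtain i \<sigma> j \<rho> where f: "f = transl (of_int i) \<circ> hbar h1 \<sigma>" "\<sigma> \<in> L"
    and g: "g = transl (of_int j) \<circ> hbar h1 \<rho>" "\<rho> \<in> L" unfolding ascend_def by blast
  have "\<sigma> \<circ> \<rho> = \<rho> \<circ> \<sigma>" using L(2) f(2) g(2) by (simp add: commuting_def)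
  then show "f \<circ> g = g \<circ> f" unfolding f(1) g(1) ascend_normal_form by (simp add: add.commute)
qed

lemma conj_ascend_periodic:
  assumes "u \<in> ascend L"
  shows "conj_by \<Phi> u \<in> periodic_homeos"
proof (rule periodic_conj[OF \<Phi> deck])
  show "u \<in> line_homeos" using line_groupD(1)[OF line_group_ascend[OF L(1)] assms] .
  have "transl (of_int (int k)) \<circ> hbar h1 \<gamma> \<in> ascend L" using L(3) unfolding ascend_def by blast
  then show "u \<circ> (transl (of_int (int k)) \<circ> hbar h1 \<gamma>) = (transl (of_int (int k)) \<circ> hbar h1 \<gamma>) \<circ> u"
    using commuting_ascend assms unfolding commuting_def by blast
qed

lemma circle_map_conj:
  assumes "u \<in> ascend L"
  shows "circle_map (conj_by \<Phi> u) (circ (\<Phi> x)) = circ (\<Phi> (u x))"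
  using conj_ascend_periodic[OF assms] \<Phi> by simp

lemma transl_int_ascend: "transl (of_int i) \<in> ascend L"
  by (rule transl_in_ascend[OF L(1)])

lemma rot_carrier: "rot \<in> carrier Homeo_plus_S1"
  using conj_ascend_periodic[OF transl_int_ascend[of 1]] by (simp add: rot_def)

lemma rot_int_pow: "rot [^]\<^bsub>Homeo_plus_S1\<^esub> (i::int) = circle_map (conj_by \<Phi> (transl (of_int i)))"
proof -
  interpret S: group Homeo_plus_S1 by (rule group_Homeo_plus_S1)
  have per: "conj_by \<Phi> (transl (of_int i)) \<in> periodic_homeos" for i
    by (rule conj_ascend_periodic[OF transl_int_ascend])
  have mult: "circle_map (conj_by \<Phi> (transl (of_int i))) \<otimes>\<^bsub>Homeo_plus_S1\<^esub> circle_map (conj_by \<Phi> (transl (of_int j)))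
      = circle_map (conj_by \<Phi> (transl (of_int (i + j))))" for i j
    unfolding circle_map_mult[OF per per] conj_by_comp[OF \<Phi>, symmetric] transl_comp by simp
  have one: "rot [^]\<^bsub>Homeo_plus_S1\<^esub> (1::int) = circle_map (conj_by \<Phi> (transl (of_int 1)))"
    using S.int_pow_1[OF rot_carrier] by (simp add: rot_def)
  have zero: "rot [^]\<^bsub>Homeo_plus_S1\<^esub> (0::int) = circle_map (conj_by \<Phi> (transl (of_int 0)))"
    using \<Phi> by (simp add: circle_map_one)
  have "finv (conj_by \<Phi> (transl (of_int 1))) = conj_by \<Phi> (transl (of_int (- 1)))"
    using conj_by_inv[OF \<Phi>, of "transl (of_int 1)"] by simp
  then have neg: "rot [^]\<^bsub>Homeo_plus_S1\<^esub> (- 1::int) = circle_map (conj_by \<Phi> (transl (of_int (- 1))))"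
    using S.int_pow_neg[OF rot_carrier, of 1] circle_map_inv[OF per[of 1]] one by simp
  show ?thesis
  proof (induction i rule: int_induct[where k = 0])
    case base then show ?case by (rule zero)
  next
    case (step1 i)
    then show ?case using S.int_pow_mult[OF rot_carrier, of i 1] one mult[of i 1] by simp
  next
    case (step2 i)
    then show ?case using S.int_pow_mult[OF rot_carrier, of i "- 1"] neg mult[of i "- 1"] by simp
  qed
qed

lemma rot_int_pow_apply:
  "(rot [^]\<^bsub>Homeo_plus_S1\<^esub> (i::int)) (circ (\<Phi> x)) = circ (\<Phi> (x + of_int i))"
  unfolding rot_int_pow circle_map_conj[OF transl_int_ascend] by (simp add: transl_def)

lemma \<Phi>_h1: "circ (\<Phi> (h1 w)) = \<phi> w"
  using affine[of "h1 w"] h_range[of w] k by (simp add: \<phi>)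

lemma transport_\<phi>: "transport \<phi> \<sigma> (\<phi> w) = \<phi> (\<sigma> w)"
proof -
  have "inj \<phi>"
  proof (rule injI)
    fix x y assume eq: "\<phi> x = \<phi> y"
    have "h1 x + 1 = h1 y + 1"
      by (rule circ_divide_inj[OF k]) (use eq h_range[of x] h_range[of y] k in \<open>auto simp: \<phi>\<close>)
    then show "x = y" by simp
  qed
  then show ?thesis by (simp add: transport_def)
qed

lemma rot_in_Homeo_plus_S1_kg: "rot \<in> Homeo_plus_S1_kg \<phi> k (finv \<gamma>)"
  unfolding Homeo_plus_S1_kg_def
proof (intro CollectI conjI ballI)
  show "rot \<in> carrier Homeo_plus_S1" by (rule rot_carrier)
next
  fix i assume i: "i \<in> {1..k}"
  have "cpt k i = circ (\<Phi> (real i - 1))" using affine[of "real i - 1"] i by (simp add: cpt_eq_circ)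
  then have "rot (cpt k i) = circ (\<Phi> (real i))"
    using circle_map_conj[OF transl_int_ascend, of 1 "real i - 1"] by (simp add: rot_def transl_def)
  then show "rot (cpt k i) = cpt k (i + 1)" using affine[of "real i"] i by (simp add: cpt_eq_circ add.commute)
next
  fix z assume "z \<in> arc_between k 1"
  then obtain t where t: "z = circ (t / real k)" "1 < t" "t < 2" unfolding arc_between_eq by auto
  obtain w where w: "t - 1 = h1 w" using h_onto[of "t - 1"] t by auto
  then have z: "z = \<phi> w" using t(1) by (simp add: \<phi>) (simp flip: w)
  have \<gamma>l: "\<gamma> \<in> line_homeos" using line_groupD(1)[OF L(1,3)] .
  have "(transl (of_int (int k)) \<circ> hbar h1 \<gamma>) (h1 (finv \<gamma> w)) = h1 w + real k"
    using \<gamma>l by (simp add: transl_def)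
  then have "\<Phi> (h1 w + real k) = \<Phi> (h1 (finv \<gamma> w)) + 1"
    using conj_by_apply[OF \<Phi>, of "transl (of_int (int k)) \<circ> hbar h1 \<gamma>" "h1 (finv \<gamma> w)"]
    unfolding deck by (simp add: transl_def)
  then have "circ (\<Phi> (h1 w + real k)) = circ (\<Phi> (h1 (finv \<gamma> w)))" by simp
  moreover have "(rot [^]\<^bsub>Homeo_plus_S1\<^esub> k) z = circ (\<Phi> (h1 w + real k))"
    using rot_int_pow_apply[of "int k" "h1 w"] by (simp add: int_pow_int \<Phi>_h1 z)
  ultimately show "(rot [^]\<^bsub>Homeo_plus_S1\<^esub> k) z = transport \<phi> (finv \<gamma>) z"
    by (simp add: z transport_\<phi> \<Phi>_h1)
qed

lemma overline_eq:
  assumes \<sigma>: "\<sigma> \<in> L"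
  shows "overline \<phi> k rot \<sigma> = circle_map (conj_by \<Phi> (hbar h1 \<sigma>))"
proof (rule circle_map_ext)
  fix x0
  have \<sigma>a: "hbar h1 \<sigma> \<in> ascend L" using \<sigma> by (simp add: hbar_in_ascend)
  obtain y where y: "circ x0 = circ y" "1 / real k \<le> y" "y < 1 / real k + 1"
    by (rule circ_surj[of "circ x0" "1 / real k"]) simp_all
  define x where "x = real k * y - 1"
  have x: "0 \<le> x" "x < real k" using y(2,3) k by (auto simp: x_def field_simps)
  have \<Phi>x: "\<Phi> x = y" using affine[of x] x k by (simp add: x_def)
  have rhs: "circle_map (conj_by \<Phi> (hbar h1 \<sigma>)) (circ x0) = circ (\<Phi> (hbar h1 \<sigma> x))"
    unfolding y(1) \<Phi>x[symmetric] by (rule circle_map_conj[OF \<sigma>a])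
  have z: "circ x0 = circ ((x + 1) / real k)" using k by (simp add: y(1) x_def)
  show "overline \<phi> k rot \<sigma> (circ x0) = circle_map (conj_by \<Phi> (hbar h1 \<sigma>)) (circ x0)"
  proof (cases x rule: int_or_coordinate)
    case (int m)
    then have m: "0 \<le> m" "m < int k" using x by auto
    have "circ x0 = cpt k (nat m + 1)" using m by (simp add: z int cpt_eq_circ add.commute)
    then have "circ x0 \<in> cpt k ` {1..k}" using m by (intro image_eqI[of _ _ "nat m + 1"]) auto
    then have "overline \<phi> k rot \<sigma> (circ x0) = circ x0" by (simp add: overline_def)
    moreover have "hbar h1 \<sigma> x = x" by (simp add: int)
    ultimately show ?thesis unfolding rhs by (simp add: \<Phi>x y(1))
  next
    case (coord w m)
    have "\<lfloor>x\<rfloor> = m" by (simp add: coord floor_coordinate)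
    then have m: "0 \<le> m" "m < int k" using x by linarith+
    define i where "i = nat m + 1"
    have i: "i \<in> {1..k}" "int i = m + 1" "real i = of_int m + 1" using m by (auto simp: i_def)
    have t: "real i < x + 1" "x + 1 < real i + 1" using coord h_range[of w] i(3) by auto
    \<comment> \<open>The angles of points of the arcs and of the division points lie in one period.\<close>
    have unique: "s = x + 1" if "circ x0 = circ (s / real k)" "1 \<le> s" "s < real k + 1" for s
      using circ_divide_inj[OF k, of s "x + 1"] that x z by simp
    have "circ x0 \<notin> cpt k ` {1..k}"
    proof
      assume "circ x0 \<in> cpt k ` {1..k}"
      then obtain j where j: "j \<in> {1..k}" "circ x0 = circ (real j / real k)" by (auto simp: cpt_eq_circ)
      then have "real j = x + 1" by (intro unique) auto
      then have "real i < real j" "real j < real (i + 1)" using t by simp_all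
      then show False by (simp only: of_nat_less_iff)
    qed
    moreover have "(THE i. i \<in> {1..k} \<and> circ x0 \<in> arc_between k i) = i"
    proof (rule the_equality)
      show "i \<in> {1..k} \<and> circ x0 \<in> arc_between k i"
        using i(1) t z unfolding arc_between_eq by (intro conjI image_eqI[of _ _ "x + 1"]) auto
      fix j assume j: "j \<in> {1..k} \<and> circ x0 \<in> arc_between k j"
      then obtain s where s: "real j < s" "s < real (j + 1)" "circ x0 = circ (s / real k)"
        unfolding arc_between_eq by auto
      have "s < real k + 1" using s(2) j by auto
      moreover have "1 \<le> s" using s(1) j by auto
      ultimately have "s = x + 1" using unique s(3) by blast
      then show "j = i" using s(1,2) t by linarith
    qed
    ultimately have "overline \<phi> k rot \<sigma> (circ x0) =
        (rot [^]\<^bsub>Homeo_plus_S1\<^esub> m) (transport \<phi> \<sigma> ((rot [^]\<^bsub>Homeo_plus_S1\<^esub> (- m)) (circ x0)))"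
      by (simp add: overline_def Let_def i(2))
    also have "(rot [^]\<^bsub>Homeo_plus_S1\<^esub> (- m)) (circ x0) = \<phi> w"
    proof -
      have "x + of_int (- m) = h1 w" by (simp add: coord)
      then show ?thesis using rot_int_pow_apply[of "- m" x] unfolding y(1) \<Phi>x by (simp only: \<Phi>_h1)
    qed
    also have "transport \<phi> \<sigma> (\<phi> w) = circ (\<Phi> (h1 (\<sigma> w)))" by (simp add: transport_\<phi> \<Phi>_h1)
    also have "(rot [^]\<^bsub>Homeo_plus_S1\<^esub> m) \<dots> = circ (\<Phi> (h1 (\<sigma> w) + of_int m))" by (rule rot_int_pow_apply)
    also have "h1 (\<sigma> w) + of_int m = hbar h1 \<sigma> x" by (simp add: coord)
    finally show ?thesis unfolding rhs .
  qed
qed (simp_all add: overline_def)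

lemma subgroup_model: "subgroup (circle_map ` conj_by \<Phi> ` ascend L) Homeo_plus_S1"
  using conj_ascend_periodic line_group_conj[OF \<Phi> line_group_ascend[OF L(1)]]
  by (intro subgroup_circle_map) auto

lemma generate_model:
  "generate Homeo_plus_S1 (overline \<phi> k rot ` L \<union> {rot}) = circle_map ` conj_by \<Phi> ` ascend L"
proof (rule group.generateI[OF group_Homeo_plus_S1 subgroup_model, symmetric])
  have "overline \<phi> k rot \<sigma> \<in> circle_map ` conj_by \<Phi> ` ascend L" if "\<sigma> \<in> L" for \<sigma>
    using that by (simp add: overline_eq hbar_in_ascend)
  moreover have "rot \<in> circle_map ` conj_by \<Phi> ` ascend L"
    using transl_int_ascend[of 1] by (simp add: rot_def)
  ultimately show "overline \<phi> k rot ` L \<union> {rot} \<subseteq> circle_map ` conj_by \<Phi> ` ascend L" by blast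
next
  interpret S: group Homeo_plus_S1 by (rule group_Homeo_plus_S1)
  fix K assume K: "subgroup K Homeo_plus_S1" "overline \<phi> k rot ` L \<union> {rot} \<subseteq> K"
  show "circle_map ` conj_by \<Phi> ` ascend L \<subseteq> K"
  proof (intro subsetI)
    fix f assume "f \<in> circle_map ` conj_by \<Phi> ` ascend L"
    then obtain i \<sigma> where f: "f = circle_map (conj_by \<Phi> (transl (of_int i) \<circ> hbar h1 \<sigma>))" "\<sigma> \<in> L"
      unfolding ascend_def by blast
    have "circle_map (conj_by \<Phi> (transl (of_int i))) \<in> K"
      using S.subgroup_int_pow_closed[OF K(1), of rot i] K(2) by (simp add: rot_int_pow)
    moreover have "circle_map (conj_by \<Phi> (hbar h1 \<sigma>)) \<in> K"
      using K(2) f(2) by (auto simp: overline_eq[symmetric])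
    ultimately have "circle_map (conj_by \<Phi> (transl (of_int i))) \<otimes>\<^bsub>Homeo_plus_S1\<^esub>
        circle_map (conj_by \<Phi> (hbar h1 \<sigma>)) \<in> K"
      by (rule subgroup.m_closed[OF K(1)])
    then show "f \<in> K"
      using circle_map_mult[OF conj_ascend_periodic[OF transl_int_ascend] conj_ascend_periodic, of "hbar h1 \<sigma>" i] f(2)
      by (simp add: f(1) conj_by_comp[OF \<Phi>] hbar_in_ascend)
  qed
qed

end

text \<open>The affine normalization of \<open>\<Phi>\<close> on the first \<open>k\<close> unit intervals is possible because these
  form a fundamental domain of the map that is conjugated to the deck transformation.\<close>

lemma arc_model_exists:
  assumes h1: "unit_interval_coordinate h1" and k: "k \<ge> 1" and \<phi>: "\<And>t. \<phi> t = circ ((h1 t + 1) / real k)"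
    and L: "line_group L" "commuting L" "\<gamma> \<in> L"
    and up: "\<And>x. x < (transl (of_int (int k)) \<circ> hbar h1 \<gamma>) x"
  obtains \<Phi> where "arc_model h1 \<phi> k \<Phi> L \<gamma>"
proof -
  interpret unit_interval_coordinate h1 by (rule h1)
  let ?T = "transl (of_int (int k)) \<circ> hbar h1 \<gamma>"
  have T: "?T \<in> line_homeos" using line_groupD(1)[OF L(1,3)] by simp
  have T0: "?T 0 = real k" by (simp add: transl_def)
  obtain \<psi> where \<psi>: "\<psi> \<in> line_homeos" "\<And>x. \<psi> (?T x) = \<psi> x + 1"
    "\<And>x. 0 \<le> x \<Longrightarrow> x \<le> ?T 0 \<Longrightarrow> \<psi> x = (x - 0) / (?T 0 - 0)"
    using conjugate_to_translation[OF T up, where ?x0.0 = 0] by blast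
  let ?\<Phi> = "transl (1 / real k) \<circ> \<psi>"
  have \<Phi>: "?\<Phi> \<in> line_homeos" using \<psi>(1) by simp
  have "conj_by ?\<Phi> ?T y = transl 1 y" for y
  proof -
    have "conj_by ?\<Phi> ?T (?\<Phi> (finv ?\<Phi> y)) = ?\<Phi> (finv ?\<Phi> y) + 1"
      unfolding conj_by_apply[OF \<Phi>] using \<psi>(2)[of "finv ?\<Phi> y"] by (simp add: transl_def)
    then show ?thesis unfolding line_homeos_inv_right[OF \<Phi>] by (simp add: transl_def)
  qed
  then have "conj_by ?\<Phi> ?T = transl 1" by auto
  moreover have "?\<Phi> x = (x + 1) / real k" if "0 \<le> x" "x \<le> real k" for x
    using \<psi>(3)[of x] that unfolding T0 by (simp add: transl_def add_divide_distrib)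
  ultimately have "arc_model h1 \<phi> k ?\<Phi> L \<gamma>"
    using h1 k \<phi> \<Phi> L unfolding arc_model_def arc_model_axioms_def by blast
  then show ?thesis by (rule that)
qed

section \<open>Classification on the circle\<close>

lemma topologically_conjugate_lifts:
  assumes G: "subgroup G Homeo_plus_S1" and \<Omega>: "\<Omega> \<in> periodic_homeos"
  shows "topologically_conjugate G (circle_map ` conj_by \<Omega> ` lifts G)"
proof -
  note P = line_groupD[OF line_group_periodic_homeos]
  have eq: "circle_map \<Omega> \<otimes>\<^bsub>Homeo_plus_S1\<^esub> circle_map F \<otimes>\<^bsub>Homeo_plus_S1\<^esub> inv\<^bsub>Homeo_plus_S1\<^esub> (circle_map \<Omega>)
      = circle_map (conj_by \<Omega> F)" if "F \<in> lifts G" for F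
    using that \<Omega> P(3,4) by (simp add: lifts_def circle_map_inv conj_by_def)
  have "(\<lambda>\<sigma>. circle_map \<Omega> \<otimes>\<^bsub>Homeo_plus_S1\<^esub> \<sigma> \<otimes>\<^bsub>Homeo_plus_S1\<^esub> inv\<^bsub>Homeo_plus_S1\<^esub> (circle_map \<Omega>)) ` circle_map ` lifts G
      = circle_map ` conj_by \<Omega> ` lifts G"
    unfolding image_image by (rule image_cong[OF refl eq])
  then show ?thesis
    unfolding topologically_conjugate_def circle_map_lifts[OF G] using circle_map_carrier[OF \<Omega>] by blast
qed

text \<open>On the stabilizer of a point the deck coordinates are injective, because no nontrivial deck
  transformation has a fixed point.\<close>

lemma (in unit_interval_coordinate) deck_coordinates_descend:
  assumes \<kappa>: "deck_coordinates H n \<kappa>" and \<psi>: "\<psi> \<in> line_homeos"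
  shows "coordinates_on (descend (conj_by \<psi> ` H)) {..<n} (\<lambda>\<sigma>. \<kappa> (conj_by (finv \<psi>) (hbar h \<sigma>)))"
proof -
  note D = deck_coordinatesD[OF \<kappa>]
  have in_H: "conj_by (finv \<psi>) (hbar h \<sigma>) \<in> H" if "\<sigma> \<in> descend (conj_by \<psi> ` H)" for \<sigma>
    using that \<psi> by (auto simp: descend_def)
  show ?thesis
    unfolding coordinates_on_def
  proof (intro conjI ballI allI impI)
    fix f g i assume "f \<in> descend (conj_by \<psi> ` H)" "g \<in> descend (conj_by \<psi> ` H)"
    then show "\<kappa> (conj_by (finv \<psi>) (hbar h (f \<circ> g))) i =
        \<kappa> (conj_by (finv \<psi>) (hbar h f)) i + \<kappa> (conj_by (finv \<psi>) (hbar h g)) i"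
      using D(1)[OF in_H in_H] \<psi> by (simp only: hbar_comp conj_by_comp[OF line_homeos_inv[OF \<psi>]])
  next
    fix f i assume "f \<in> descend (conj_by \<psi> ` H)" "i \<notin> {..<n}"
    then show "\<kappa> (conj_by (finv \<psi>) (hbar h f)) i = 0" using D(2)[OF in_H] by (simp add: int_vectors_def)
  next
    fix f assume f: "f \<in> descend (conj_by \<psi> ` H)" "\<forall>i. \<kappa> (conj_by (finv \<psi>) (hbar h f)) i = 0"
    then obtain m :: int where m: "conj_by (finv \<psi>) (hbar h f) = transl (of_int m)"
      using D(4)[OF in_H[OF f(1)]] by auto
    have "conj_by (finv \<psi>) (hbar h f) (finv \<psi> 0) = finv \<psi> 0"
      using conj_by_apply[OF line_homeos_inv[OF \<psi>], of "hbar h f" 0] by simp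
    then have "m = 0" unfolding m by (simp add: transl_def)
    then have "conj_by \<psi> (conj_by (finv \<psi>) (hbar h f)) = conj_by \<psi> id" unfolding m by simp
    then have "hbar h f = hbar h id" using \<psi> by simp
    then show "f = id" by (simp only: hbar_eq_iff)
  qed
qed

text \<open>The group on the circle is torsion free, so a root of the deck transformation is itself a power
  of the deck transformation.\<close>

lemma deck_root_trivial:
  assumes H: "line_group H" "transl 1 \<in> H" and \<kappa>: "deck_coordinates H n \<kappa>"
    and w: "w \<in> H" "w ^^ d = transl 1"
  shows "d = 1"
proof -
  note D = deck_coordinatesD[OF \<kappa>]
  have "\<kappa> id i = 0" for i using D(1)[OF line_groupD(2)[OF H(1)] line_groupD(2)[OF H(1)], of i] by simp
  then have pow: "\<kappa> (w ^^ j) i = int j * \<kappa> w i" for i j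
  proof (induction j)
    case 0 then show ?case by (simp add: id_def)
  next
    case (Suc j)
    then show ?case unfolding funpow.simps(2) D(1)[OF w(1) line_group_funpow[OF H(1) w(1)]]
      by (simp add: algebra_simps)
  qed
  have "\<kappa> (transl 1) = (\<lambda>_. 0)" using D(4)[OF H(2)] of_int_1 by metis
  then have "int d * \<kappa> w i = 0" for i using pow[of d i] by (simp add: w(2))
  moreover have "d \<noteq> 0"
  proof
    assume "d = 0"
    then have "transl 1 0 = 0" using fun_cong[OF w(2), of 0] by simp
    then show False by (simp add: transl_def)
  qed
  ultimately have "\<kappa> w = (\<lambda>_. 0)" by auto
  then obtain m :: int where "w = transl (of_int m)" using D(4)[OF w(1)] by blast
  then have "transl (real d * of_int m) = transl 1" using w(2) by (simp add: funpow_transl)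
  then have "real_of_int (int d * m) = of_int 1" by simp
  then have "int d * m = 1" by (simp only: of_int_eq_iff)
  then show ?thesis using zmult_eq_1_iff[of "int d" m] by simp
qed

text \<open>Suppose that the inverse of \<open>\<gamma>\<close> is \<open>u\<^sup>s\<close>, let \<open>d\<close> be the greatest common divisor of \<open>k\<close> and \<open>s\<close>, and
  let \<open>v\<close> be the inverse of \<open>u\<close>. Then the translation by \<open>k/d\<close> composed with the copy of \<open>v\<^bsup>s/d\<^esup>\<close> is a
  \<open>d\<close>-th root of the deck transformation, hence \<open>d = 1\<close>.\<close>

lemma (in unit_interval_coordinate) admissible_inverse:
  assumes H: "line_group H" "transl 1 \<in> H" and \<kappa>: "deck_coordinates H n' \<kappa>" and \<Psi>: "\<Psi> \<in> line_homeos"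
    and conj: "conj_by \<Psi> ` H = ascend L" and L: "line_group L" "commuting (ascend L)" "L = G_line h' \<alpha> n" "\<gamma> \<in> L"
    and deck: "conj_by \<Psi> (transl 1) = transl (of_int (int k)) \<circ> hbar h \<gamma>"
  shows "admissible h' \<alpha> n k (finv \<gamma>)"
proof -
  note GL = line_groupD[OF L(1)]
  have "finv \<gamma> \<noteq> u [^]\<^bsub>Homeo_plus_R\<^esub> s" if u: "u \<in> L" "1 \<le> s" "gcd k s \<noteq> 1" for u s
  proof
    assume "finv \<gamma> = u [^]\<^bsub>Homeo_plus_R\<^esub> s"
    then have inv: "finv \<gamma> = u ^^ s" using nat_pow_Homeo_plus_R[OF GL(1)[OF u(1)]] by simp
    define d where "d = gcd k s"
    have d: "k = k div d * d" "s = s div d * d" by (simp_all add: d_def)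
    define v where "v = finv u"
    have v: "v \<in> L" using GL(4)[OF u(1)] by (simp add: v_def)
    have uv: "(u ^^ j) ((v ^^ j) x) = x" for j x
    proof (induction j arbitrary: x)
      case (Suc j)
      have "(u ^^ Suc j) ((v ^^ Suc j) x) = u ((u ^^ j) ((v ^^ j) (v x)))" by (simp add: funpow_swap1)
      then show ?case using Suc GL(1)[OF u(1)] by (simp add: v_def)
    qed simp
    have "finv (finv \<gamma>) = v ^^ s"
      using uv[of s] GL(1)[OF L(4)] unfolding inv
      by (intro line_homeos_inv_unique) (auto simp: fun_eq_iff GL(1)[OF u(1)])
    then have \<gamma>: "\<gamma> = v ^^ s" using GL(1)[OF L(4)] by simp
    define a where "a = transl (of_int (int (k div d)))"
    define b where "b = hbar h (v ^^ (s div d))"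
    have ab: "a \<in> ascend L" "b \<in> ascend L"
      unfolding a_def b_def hbar_in_ascend by (rule transl_in_ascend[OF L(1)], rule line_group_funpow[OF L(1) v])
    have "(a \<circ> b) ^^ d = a ^^ d \<circ> b ^^ d"
      by (rule commuting_funpow_comp[OF L(2) line_group_ascend[OF L(1)] ab])
    also have "a ^^ d = transl (of_int (int k))"
      unfolding a_def funpow_transl using arg_cong[OF d(1), of real] by (simp add: mult.commute)
    also have "b ^^ d = hbar h \<gamma>"
      unfolding b_def hbar_funpow[symmetric] funpow_mult \<gamma> using d(2) by (simp add: mult.commute)
    finally have pow: "(a \<circ> b) ^^ d = conj_by \<Psi> (transl 1)" unfolding deck .
    have "a \<circ> b \<in> conj_by \<Psi> ` H" unfolding conj using line_groupD(3)[OF line_group_ascend[OF L(1)] ab] .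
    then obtain w where w: "w \<in> H" "a \<circ> b = conj_by \<Psi> w" by blast
    have "conj_by \<Psi> (w ^^ d) = conj_by \<Psi> (transl 1)" using pow unfolding w(2) conj_by_funpow[OF \<Psi>] .
    then have "w ^^ d = transl 1" using conj_by_inv_left[OF \<Psi>] by metis
    then have "d = 1" by (rule deck_root_trivial[OF H \<kappa> w(1)])
    then show False using u(3) by (simp add: d_def)
  qed
  then show ?thesis using GL(4)[OF L(4)] unfolding admissible_def L(3) by auto
qed

theorem theorem5p3:
  fixes h :: "real \<Rightarrow> real" and \<phi> :: "nat \<Rightarrow> real \<Rightarrow> complex"
    and n :: nat and G :: "(complex \<Rightarrow> complex) set"
  assumes "\<exists>h'. homeomorphism UNIV {0<..<1} h h'"
    and "\<And>k. k \<ge> 1 \<Longrightarrow> oriented_parametrization (arc_between k 1) (\<phi> k)"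
    and "n \<ge> 2"
    and "subgroup G Homeo_plus_S1"
    and "tightly_transitive (top_of_set S1) (Homeo_plus_S1\<lparr>carrier := G\<rparr>)"
    and "almost_minimal (top_of_set S1) G"
    and "Homeo_plus_S1\<lparr>carrier := G\<rparr> \<cong> product_group {..<n} (\<lambda>_. integer_group)"
  shows "\<exists>\<alpha> k g f. \<alpha> \<in> {0<..<1} \<and> \<alpha> \<notin> \<rat> \<and> k \<ge> 1 \<and> admissible h \<alpha> n k g \<and>
           f \<in> Homeo_plus_S1_kg (\<phi> k) k g \<and>
           topologically_conjugate G (G_circle h (\<phi> k) \<alpha> n k f)"
proof -
  note G = assms(4)
  have h: "unit_interval_coordinate h" using assms(1) by (rule unit_interval_coordinate.intro)
  let ?H = "lifts G"
  have line: "line_group ?H" by (rule line_group_lifts[OF G])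
  have deck_in: "transl 1 \<in> ?H" using transl_int_lifts[OF G, of 1] by simp
  obtain \<kappa> where \<kappa>: "deck_coordinates ?H n \<kappa>" using lifts_deck_coordinates(2)[OF G assms(7)] by blast
  have "topologically_transitive (top_of_set S1) G" using assms(5) by (simp add: tightly_transitive_def)
  then have tame: "tame ?H" by (rule tame_lifts[OF G _ assms(6) lifts_deck_coordinates(1)[OF G assms(7)] \<kappa>])
  have tight: "tight_rel ?H (transl 1)" by (rule tight_rel_lifts[OF G assms(5)])
  show ?thesis using tame
  proof (cases rule: tame_structure)
    case (translational \<psi> D)
    \<comment> \<open>The lifts would have rank two, so the group on the circle would have rank one.\<close>
    have "tame (transl ` D)" "tight_rel (transl ` D) (conj_by \<psi> (transl 1))" "conj_by \<psi> (transl 1) \<in> transl ` D"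
      using tame_conj[OF translational(1) tame] tight_rel_conj[OF translational(1) tight]
        imageI[OF deck_in, of "conj_by \<psi>"] unfolding translational(2) by blast+
    then obtain p q where pq: "independent2 p q" "D = lattice2 p q"
      using tight_translations_rank_two by blast
    have "2 = n + 1"
      using free_basis_lattice2[OF pq(1)] unfolding pq(2)[symmetric] translational(2)[symmetric]
      by (rule rank_deck_coordinates[OF line deck_in \<kappa> free_basis_conj[OF translational(1)]])
    then show ?thesis using assms(3) by simp
  next
    case (integral \<psi>)
    let ?H' = "conj_by \<psi> ` ?H"
    note T = tameD[OF tame_conj[OF integral(1) tame]]
    let ?T = "conj_by \<psi> (transl 1)"
    have T_in: "?T \<in> ?H'" using deck_in by (rule imageI)
    have int0: "\<forall>u\<in>?H'. u 0 \<in> \<int>" using integral(3) by blast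
    have T_up: "x < ?T x" for x
      using conj_by_apply[OF integral(1), of "transl 1" "finv \<psi> x"] line_homeos_less_inv[OF integral(1)] integral(1)
      by (simp add: transl_def line_homeos_inv_less[symmetric] conj_by_def)
    obtain k' where k': "?T 0 = of_int k'" using int0 T_in by (metis Ints_cases)
    then have "k' > 0" using T_up[of 0] by simp
    define k where "k = nat k'"
    have k: "k \<ge> 1" "int k = k'" using \<open>k' > 0\<close> by (auto simp: k_def)
    obtain h1 where h1: "unit_interval_coordinate h1" "\<And>t. \<phi> k t = circ ((h1 t + 1) / real k)"
      using oriented_parametrization_coordinate[OF assms(2)[OF k(1)] k(1)] by metis
    interpret unit_interval_coordinate h1 by (rule h1(1))
    let ?K = "descend ?H'"
    have asc: "ascend ?K = ?H'" by (rule ascend_descend[OF T(1,2) integral(2) int0])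
    obtain i \<gamma>' where i\<gamma>: "\<gamma>' \<in> ?K" "?T = transl (of_int i) \<circ> hbar h1 \<gamma>'"
      using T_in asc unfolding ascend_def by blast
    have "i = k'" using k' unfolding i\<gamma>(2) by (simp add: transl_def)
    then have \<gamma>': "?T = transl (of_int (int k)) \<circ> hbar h1 \<gamma>'" using i\<gamma>(2) k(2) by simp
    have "tight_rel ?K \<gamma>'"
      using tight_rel_conj[OF integral(1) tight] unfolding \<gamma>'
      by (rule tight_rel_descend[OF T(1,2) integral(2) int0])
    then have "classified h ?K"
      using tame_descend[OF tame_conj[OF integral(1) tame] integral(2) int0]
        deck_coordinates_descend[OF \<kappa> integral(1)] i\<gamma>(1)
      by (intro tame_classification[OF h finite_lessThan])
    then obtain \<alpha> d \<xi> \<rho> where c: "\<alpha> \<in> {0<..<1}" "\<alpha> \<notin> \<rat>" "d \<ge> 2" "\<xi> \<in> line_homeos"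
      "conj_by \<xi> ` ?K = G_line h \<alpha> d" "free_basis ?K d \<rho>"
      unfolding classified_def by blast
    have "Suc d = n + 1"
      using free_basis_ascend[OF c(6)] unfolding asc
      by (rule rank_deck_coordinates[OF line deck_in \<kappa> free_basis_conj[OF integral(1)]])
    then have d: "d = n" by simp
    let ?L = "G_line h \<alpha> n"
    have L: "line_group ?L" by (rule line_group_G_line[OF assms(3) h])
    define \<gamma> where "\<gamma> = conj_by \<xi> \<gamma>'"
    have \<gamma>: "\<gamma> \<in> ?L" using imageI[OF i\<gamma>(1), of "conj_by \<xi>"] c(5) d by (simp add: \<gamma>_def)
    define \<Psi> where "\<Psi> = hbar h1 \<xi> \<circ> \<psi>"
    have \<Psi>: "\<Psi> \<in> line_homeos" using c(4) integral(1) by (simp add: \<Psi>_def)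
    have conj: "conj_by \<Psi> ` ?H = ascend ?L"
      using conj_ascend[OF c(4), of ?K] c(4,5) d integral(1)
      by (simp add: asc \<Psi>_def conj_by_image_image)
    have deck: "conj_by \<Psi> (transl 1) = transl (of_int (int k)) \<circ> hbar h1 \<gamma>"
    proof -
      have "conj_by \<Psi> (transl 1) = conj_by (hbar h1 \<xi>) ?T" using c(4) integral(1) by (simp add: \<Psi>_def conj_by_conj_by)
      also have "\<dots> = transl (of_int (int k)) \<circ> hbar h1 \<gamma>" unfolding \<gamma>' \<gamma>_def by (rule conj_by_normal_form[OF c(4)])
      finally show ?thesis .
    qed
    have commL: "commuting ?L"
      using commuting_conj[OF c(4) tameD(2)[OF tame_descend[OF tame_conj[OF integral(1) tame] integral(2) int0]]]
      unfolding c(5) d .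
    have "x < (transl (of_int (int k)) \<circ> hbar h1 \<gamma>) x" for x
    proof -
      have "conj_by \<Psi> (transl 1) (\<Psi> (finv \<Psi> x)) = \<Psi> (finv \<Psi> x + 1)"
        unfolding conj_by_apply[OF \<Psi>] by (simp add: transl_def)
      moreover have "\<Psi> (finv \<Psi> x) < \<Psi> (finv \<Psi> x + 1)" unfolding line_homeos_less[OF \<Psi>] by simp
      ultimately show ?thesis unfolding deck line_homeos_inv_right[OF \<Psi>] by simp
    qed
    then obtain \<Phi> where "arc_model h1 (\<phi> k) k \<Phi> ?L \<gamma>"
      using arc_model_exists[OF h1(1) k(1) h1(2) L commL \<gamma>] by blast
    then interpret M: arc_model h1 "\<phi> k" k \<Phi> ?L \<gamma> .
    let ?\<Omega> = "\<Phi> \<circ> \<Psi>"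
    have \<Omega>1: "conj_by ?\<Omega> (transl 1) = transl 1"
      using M.deck conj_by_conj_by[OF M.\<Phi> \<Psi>, of "transl 1"] unfolding deck by simp
    have "?\<Omega> \<in> periodic_homeos"
    proof -
      have \<Omega>l: "?\<Omega> \<in> line_homeos" using M.\<Phi> \<Psi> by simp
      have "?\<Omega> (x + 1) = ?\<Omega> x + 1" for x
        using conj_by_apply[OF \<Omega>l, of "transl 1" x] unfolding \<Omega>1 by (simp add: transl_def)
      then show ?thesis using \<Omega>l by (simp add: periodic_homeos_def)
    qed
    then have "topologically_conjugate G (circle_map ` conj_by ?\<Omega> ` ?H)"
      by (rule topologically_conjugate_lifts[OF G])
    moreover have "conj_by ?\<Omega> ` ?H = conj_by \<Phi> ` ascend ?L"
      using conj_by_image_image[OF M.\<Phi> \<Psi>, of ?H] conj by simp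
    ultimately have "topologically_conjugate G (G_circle h (\<phi> k) \<alpha> n k M.rot)"
      unfolding G_circle_def M.generate_model by simp
    moreover have "admissible h \<alpha> n k (finv \<gamma>)"
      by (rule admissible_inverse[OF line deck_in \<kappa> \<Psi> conj L M.commuting_ascend refl \<gamma> deck])
    ultimately show ?thesis using c(1,2) k(1) M.rot_in_Homeo_plus_S1_kg by blast
  qed
qed

end
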